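(* $\mathsf{ZF}$ and $\mathsf{BLT}_{\mathsf{ZF}}$ are definitionally equivalent, and $\mathsf{LT}^{+}$ and $\mathsf{BLT}^{+}$ are definitionally equivalent.
   Context: Two theories $S,T$ in languages with only $\in$ are definitionally equivalent iff there are interpretations (translations) $I$ of $S$ in $T$ and $J$ of $T$ in $S$ such that: $S\vdash\phi$ implies $T\vdash\phi^I$, $T\vdash\phi$ implies $S\vdash\phi^J$, $S\vdash\phi\leftrightarrow(\phi^I)^J$ and $T\vdash\phi\leftrightarrow(\phi^J)^I$ for all formulas $\phi$ of the respective languages. Ordinary level notions: $\mathrm{pot}(a)=\{x:\exists c(x\subseteq c\wedge c\in a)\}$; a history is $h$ with $x=\mathrm{pot}(x\cap h)$ for $x\in h$; a level is $\mathrm{pot}(h)$ for a history $h$. $\mathsf{LT}$: Extensionality, Separation ($\forall F\forall a\exists b\forall x(x\in b\leftrightarrow(F(x)\wedge x\in a))$), Stratification (every set is a subset of some level); $\mathsf{LT}^{+}=\mathsf{LT}+$ "every level is a member of some level". Boolean notions: $\overline{a}=\{x:x\notin a\}$; $\mathrm{bpot}(a)=\{x:\exists c(c\in a\wedge c\notin c\wedge(x\subseteq c\vee\overline{x}\subseteq c))\}$; a boolean-history is $h$ with $h\notin h$ and $x=\mathrm{bpot}(x\cap h)$ for $x\in h$; a boolean-level is $\mathrm{bpot}(h)$ for a boolean-history $h$. $\mathsf{BLT}$: Extensionality; Complements $\forall a\exists c(c=\overline{a}\wedge(a\notin a\leftrightarrow c\in c))$; Separation$_\notin$ $\forall F\forall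 a(a\notin a\to\exists b(b\notin b\wedge\forall x(x\in b\leftrightarrow(F(x)\wedge x\in a))))$; Stratification$_\notin$ (every $a\notin a$ is a subset of a boolean-level). $\mathsf{BLT}^{+}=\mathsf{BLT}+$ "every boolean-level is a member of some boolean-level". $\mathsf{BLT}_{\mathsf{ZF}}=\mathsf{BLT}+$Infinity$_\notin+$Unbounded$_\notin$, where Infinity$_\notin$: some boolean-level $s$ contains a boolean-level and for every boolean-level $q\in s$ there is a boolean-level $r$ with $q\in r\in s$; Unbounded$_\notin$: $\forall P\forall a(a\notin a\to\exists s(s\text{ a boolean-level}\wedge\forall x\in a\,P(x)\in s))$, $P$ a second-order function variable. The theories are formulated in second-order logic (the result also holds for their natural first-order schematic versions). *)

theory Defs
  imports Main
begin

text \<open>Terms: first-order variables (de Bruijn indices) and applications of unary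
  function variables (de Bruijn indices, separate index space).\<close>
datatype trm = V nat | Ap nat trm

text \<open>Formulas: membership, identity, application of monadic predicate variables,
  falsum, implication, first-order, predicate and function quantifiers.
  Each sort of variable has its own de Bruijn index space.\<close>
datatype fm = Mem trm trm | Eq trm trm | PA nat trm | Bot | Imp fm fm
  | All fm | AllP fm | AllF fm

definition Not :: "fm \<Rightarrow> fm" where "Not \<phi> = Imp \<phi> Bot"
definition And :: "fm \<Rightarrow> fm \<Rightarrow> fm" where "And \<phi> \<psi> = Not (Imp \<phi> (Not \<psi>))"
definition Iff :: "fm \<Rightarrow> fm \<Rightarrow> fm" where "Iff \<phi> \<psi> = And (Imp \<phi> \<psi>) (Imp \<psi> \<phi>)"
definition Ex :: "fm \<Rightarrow> fm" where "Ex \<phi> = Not (All (Not \<phi>))"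
definition ExP :: "fm \<Rightarrow> fm" where "ExP \<phi> = Not (AllP (Not \<phi>))"
definition ExF :: "fm \<Rightarrow> fm" where "ExF \<phi> = Not (AllF (Not \<phi>))"

primrec liftT :: "nat \<Rightarrow> trm \<Rightarrow> trm" where
  "liftT k (V n) = V (if k \<le> n then Suc n else n)"
| "liftT k (Ap f t) = Ap f (liftT k t)"

primrec liftFT :: "nat \<Rightarrow> trm \<Rightarrow> trm" where
  "liftFT k (V n) = V n"
| "liftFT k (Ap f t) = Ap (if k \<le> f then Suc f else f) (liftFT k t)"

primrec substT :: "nat \<Rightarrow> trm \<Rightarrow> trm \<Rightarrow> trm" where
  "substT k u (V n) = (if n = k then u else if k < n then V (n - 1) else V n)"
| "substT k u (Ap f t) = Ap f (substT k u t)"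

primrec renFT :: "nat \<Rightarrow> nat \<Rightarrow> trm \<Rightarrow> trm" where
  "renFT k g (V n) = V n"
| "renFT k g (Ap f t) = Ap (if f = k then g else if k < f then f - 1 else f) (renFT k g t)"

primrec lift :: "nat \<Rightarrow> fm \<Rightarrow> fm" where
  "lift k (Mem s t) = Mem (liftT k s) (liftT k t)"
| "lift k (Eq s t) = Eq (liftT k s) (liftT k t)"
| "lift k (PA p t) = PA p (liftT k t)"
| "lift k Bot = Bot"
| "lift k (Imp \<phi> \<psi>) = Imp (lift k \<phi>) (lift k \<psi>)"
| "lift k (All \<phi>) = All (lift (Suc k) \<phi>)"
| "lift k (AllP \<phi>) = AllP (lift k \<phi>)"
| "lift k (AllF \<phi>) = AllF (lift k \<phi>)"

primrec liftP :: "nat \<Rightarrow> fm \<Rightarrow> fm" where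
  "liftP k (Mem s t) = Mem s t"
| "liftP k (Eq s t) = Eq s t"
| "liftP k (PA p t) = PA (if k \<le> p then Suc p else p) t"
| "liftP k Bot = Bot"
| "liftP k (Imp \<phi> \<psi>) = Imp (liftP k \<phi>) (liftP k \<psi>)"
| "liftP k (All \<phi>) = All (liftP k \<phi>)"
| "liftP k (AllP \<phi>) = AllP (liftP (Suc k) \<phi>)"
| "liftP k (AllF \<phi>) = AllF (liftP k \<phi>)"

primrec liftF :: "nat \<Rightarrow> fm \<Rightarrow> fm" where
  "liftF k (Mem s t) = Mem (liftFT k s) (liftFT k t)"
| "liftF k (Eq s t) = Eq (liftFT k s) (liftFT k t)"
| "liftF k (PA p t) = PA p (liftFT k t)"
| "liftF k Bot = Bot"
| "liftF k (Imp \<phi> \<psi>) = Imp (liftF k \<phi>) (liftF k \<psi>)"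
| "liftF k (All \<phi>) = All (liftF k \<phi>)"
| "liftF k (AllP \<phi>) = AllP (liftF k \<phi>)"
| "liftF k (AllF \<phi>) = AllF (liftF (Suc k) \<phi>)"

text \<open>\<open>subst k u \<phi>\<close>: replace first-order variable \<open>k\<close> by \<open>u\<close>
  (\<open>u\<close> is read in the context where variable \<open>k\<close> has been removed).\<close>
primrec subst :: "nat \<Rightarrow> trm \<Rightarrow> fm \<Rightarrow> fm" where
  "subst k u (Mem s t) = Mem (substT k u s) (substT k u t)"
| "subst k u (Eq s t) = Eq (substT k u s) (substT k u t)"
| "subst k u (PA p t) = PA p (substT k u t)"
| "subst k u Bot = Bot"
| "subst k u (Imp \<phi> \<psi>) = Imp (subst k u \<phi>) (subst k u \<psi>)"
| "subst k u (All \<phi>) = All (subst (Suc k) (liftT 0 u) \<phi>)"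
| "subst k u (AllP \<phi>) = AllP (subst k u \<phi>)"
| "subst k u (AllF \<phi>) = AllF (subst k (liftFT 0 u) \<phi>)"

primrec renP :: "nat \<Rightarrow> nat \<Rightarrow> fm \<Rightarrow> fm" where
  "renP k g (Mem s t) = Mem s t"
| "renP k g (Eq s t) = Eq s t"
| "renP k g (PA p t) = PA (if p = k then g else if k < p then p - 1 else p) t"
| "renP k g Bot = Bot"
| "renP k g (Imp \<phi> \<psi>) = Imp (renP k g \<phi>) (renP k g \<psi>)"
| "renP k g (All \<phi>) = All (renP k g \<phi>)"
| "renP k g (AllP \<phi>) = AllP (renP (Suc k) (Suc g) \<phi>)"
| "renP k g (AllF \<phi>) = AllF (renP k g \<phi>)"

primrec renF :: "nat \<Rightarrow> nat \<Rightarrow> fm \<Rightarrow> fm" where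
  "renF k g (Mem s t) = Mem (renFT k g s) (renFT k g t)"
| "renF k g (Eq s t) = Eq (renFT k g s) (renFT k g t)"
| "renF k g (PA p t) = PA p (renFT k g t)"
| "renF k g Bot = Bot"
| "renF k g (Imp \<phi> \<psi>) = Imp (renF k g \<phi>) (renF k g \<psi>)"
| "renF k g (All \<phi>) = All (renF k g \<phi>)"
| "renF k g (AllP \<phi>) = AllP (renF k g \<phi>)"
| "renF k g (AllF \<phi>) = AllF (renF (Suc k) (Suc g) \<phi>)"

inductive prv :: "fm set \<Rightarrow> fm \<Rightarrow> bool" for \<Gamma> :: "fm set" where
  ax: "\<phi> \<in> \<Gamma> \<Longrightarrow> prv \<Gamma> \<phi>"
| K: "prv \<Gamma> (Imp \<phi> (Imp \<psi> \<phi>))"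
| S: "prv \<Gamma> (Imp (Imp \<phi> (Imp \<psi> \<chi>)) (Imp (Imp \<phi> \<psi>) (Imp \<phi> \<chi>)))"
| DN: "prv \<Gamma> (Imp (Not (Not \<phi>)) \<phi>)"
| MP: "prv \<Gamma> (Imp \<phi> \<psi>) \<Longrightarrow> prv \<Gamma> \<phi> \<Longrightarrow> prv \<Gamma> \<psi>"
| AllE: "prv \<Gamma> (Imp (All \<phi>) (subst 0 t \<phi>))"
| AllD: "prv \<Gamma> (Imp (All (Imp (lift 0 \<phi>) \<psi>)) (Imp \<phi> (All \<psi>)))"
| Gen: "prv \<Gamma> \<phi> \<Longrightarrow> prv \<Gamma> (All \<phi>)"
| AllPE: "prv \<Gamma> (Imp (AllP \<phi>) (renP 0 g \<phi>))"
| AllPD: "prv \<Gamma> (Imp (AllP (Imp (liftP 0 \<phi>) \<psi>)) (Imp \<phi> (AllP \<psi>)))"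
| GenP: "prv \<Gamma> \<phi> \<Longrightarrow> prv \<Gamma> (AllP \<phi>)"
| AllFE: "prv \<Gamma> (Imp (AllF \<phi>) (renF 0 g \<phi>))"
| AllFD: "prv \<Gamma> (Imp (AllF (Imp (liftF 0 \<phi>) \<psi>)) (Imp \<phi> (AllF \<psi>)))"
| GenF: "prv \<Gamma> \<phi> \<Longrightarrow> prv \<Gamma> (AllF \<phi>)"
| Refl: "prv \<Gamma> (Eq t t)"
| Leib: "prv \<Gamma> (Imp (Eq t u) (Imp (subst 0 t \<phi>) (subst 0 u \<phi>)))"
| CompP: "prv \<Gamma> (ExP (All (Iff (PA 0 (V 0)) (liftP 0 \<phi>))))"
| CompF: "prv \<Gamma> (Imp (All (Ex (And \<phi> (All (Imp (lift 1 \<phi>) (Eq (V 0) (V 1)))))))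
                     (ExF (All (subst 0 (Ap 0 (V 0)) (liftF 0 \<phi>)))))"

primrec clT :: "nat \<Rightarrow> trm \<Rightarrow> bool" where
  "clT k (V n) = (n < k)"
| "clT k (Ap f t) = clT k t"

primrec noFT :: "nat \<Rightarrow> trm \<Rightarrow> bool" where
  "noFT k (V n) = True"
| "noFT k (Ap f t) = (f < k \<and> noFT k t)"

primrec closed :: "nat \<Rightarrow> nat \<Rightarrow> nat \<Rightarrow> fm \<Rightarrow> bool" where
  "closed k m j (Mem s t) = (clT k s \<and> clT k t \<and> noFT j s \<and> noFT j t)"
| "closed k m j (Eq s t) = (clT k s \<and> clT k t \<and> noFT j s \<and> noFT j t)"
| "closed k m j (PA p t) = (p < m \<and> clT k t \<and> noFT j t)"
| "closed k m j Bot = True"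
| "closed k m j (Imp \<phi> \<psi>) = (closed k m j \<phi> \<and> closed k m j \<psi>)"
| "closed k m j (All \<phi>) = closed (Suc k) m j \<phi>"
| "closed k m j (AllP \<phi>) = closed k (Suc m) j \<phi>"
| "closed k m j (AllF \<phi>) = closed k m (Suc j) \<phi>"

text \<open>An interpretation is given by a formula \<open>\<psi>(x,y)\<close> (variable 0 = x, variable 1 = y,
  no other free variables of any sort) translating \<open>x \<in> y\<close>; identity and the logical
  vocabulary are translated homomorphically.\<close>
definition interp :: "fm \<Rightarrow> bool" where
  "interp \<psi> \<longleftrightarrow> closed 2 0 0 \<psi>"

definition inst2 :: "fm \<Rightarrow> trm \<Rightarrow> trm \<Rightarrow> fm" where
  "inst2 \<psi> s t = subst 0 s (subst 1 (liftT 0 t) \<psi>)"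

primrec tr :: "fm \<Rightarrow> fm \<Rightarrow> fm" where
  "tr \<psi> (Mem s t) = inst2 \<psi> s t"
| "tr \<psi> (Eq s t) = Eq s t"
| "tr \<psi> (PA p t) = PA p t"
| "tr \<psi> Bot = Bot"
| "tr \<psi> (Imp \<phi> \<chi>) = Imp (tr \<psi> \<phi>) (tr \<psi> \<chi>)"
| "tr \<psi> (All \<phi>) = All (tr \<psi> \<phi>)"
| "tr \<psi> (AllP \<phi>) = AllP (tr \<psi> \<phi>)"
| "tr \<psi> (AllF \<phi>) = AllF (tr \<psi> \<phi>)"

definition defeq :: "fm set \<Rightarrow> fm set \<Rightarrow> bool" where
  "defeq S T \<longleftrightarrow> (\<exists>I J. interp I \<and> interp J
      \<and> (\<forall>\<phi>. prv S \<phi> \<longrightarrow> prv T (tr I \<phi>))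
      \<and> (\<forall>\<phi>. prv T \<phi> \<longrightarrow> prv S (tr J \<phi>))
      \<and> (\<forall>\<phi>. prv S (Iff \<phi> (tr J (tr I \<phi>))))
      \<and> (\<forall>\<phi>. prv T (Iff \<phi> (tr I (tr J \<phi>)))))"

section \<open>Named syntax for writing axioms, compiled to de Bruijn form\<close>

datatype ntrm = NV nat | NAp nat ntrm
datatype nfm = NMem ntrm ntrm | NEq ntrm ntrm | NPA nat ntrm | NBot | NImp nfm nfm
  | NAll nat nfm | NAllP nat nfm | NAllF nat nfm

fun idx :: "nat list \<Rightarrow> nat \<Rightarrow> nat" where
  "idx [] n = n"
| "idx (x # xs) n = (if x = n then 0 else Suc (idx xs n))"

primrec dbT :: "nat list \<Rightarrow> nat list \<Rightarrow> ntrm \<Rightarrow> trm" where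
  "dbT vs fs (NV n) = V (idx vs n)"
| "dbT vs fs (NAp f t) = Ap (idx fs f) (dbT vs fs t)"

primrec db :: "nat list \<Rightarrow> nat list \<Rightarrow> nat list \<Rightarrow> nfm \<Rightarrow> fm" where
  "db vs ps fs (NMem s t) = Mem (dbT vs fs s) (dbT vs fs t)"
| "db vs ps fs (NEq s t) = Eq (dbT vs fs s) (dbT vs fs t)"
| "db vs ps fs (NPA p t) = PA (idx ps p) (dbT vs fs t)"
| "db vs ps fs NBot = Bot"
| "db vs ps fs (NImp \<phi> \<psi>) = Imp (db vs ps fs \<phi>) (db vs ps fs \<psi>)"
| "db vs ps fs (NAll x \<phi>) = All (db (x # vs) ps fs \<phi>)"
| "db vs ps fs (NAllP p \<phi>) = AllP (db vs (p # ps) fs \<phi>)"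
| "db vs ps fs (NAllF f \<phi>) = AllF (db vs ps (f # fs) \<phi>)"

definition sent :: "nfm \<Rightarrow> fm" where "sent \<phi> = db [] [] [] \<phi>"

definition NNot :: "nfm \<Rightarrow> nfm" where "NNot \<phi> = NImp \<phi> NBot"
definition NAnd :: "nfm \<Rightarrow> nfm \<Rightarrow> nfm" where "NAnd \<phi> \<psi> = NNot (NImp \<phi> (NNot \<psi>))"
definition NOr :: "nfm \<Rightarrow> nfm \<Rightarrow> nfm" where "NOr \<phi> \<psi> = NImp (NNot \<phi>) \<psi>"
definition NIff :: "nfm \<Rightarrow> nfm \<Rightarrow> nfm" where "NIff \<phi> \<psi> = NAnd (NImp \<phi> \<psi>) (NImp \<psi> \<phi>)"
definition NEx :: "nat \<Rightarrow> nfm \<Rightarrow> nfm" where "NEx x \<phi> = NNot (NAll x (NNot \<phi>))"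

definition mem :: "nat \<Rightarrow> nat \<Rightarrow> nfm" where "mem x y = NMem (NV x) (NV y)"
definition eqv :: "nat \<Rightarrow> nat \<Rightarrow> nfm" where "eqv x y = NEq (NV x) (NV y)"

text \<open>Convention for the macros below: the bound variables used are \<open>n, n+1, \<dots>\<close>,
  and the argument variables must be distinct from them (all arguments are \<open>< n\<close>
  in every use below).\<close>

definition nsub :: "nat \<Rightarrow> nat \<Rightarrow> nat \<Rightarrow> nfm" where
  "nsub z x y = NAll z (NImp (mem z x) (mem z y))"

definition ncsub :: "nat \<Rightarrow> nat \<Rightarrow> nat \<Rightarrow> nfm" where
  "ncsub z x y = NAll z (NImp (NNot (mem z x)) (mem z y))"

definition inPot :: "nat \<Rightarrow> nat \<Rightarrow> nat \<Rightarrow> nfm" where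
  "inPot n x a = NEx n (NAnd (nsub (n+1) x n) (mem n a))"

text \<open>history h: for all \<open>x \<in> h\<close>, \<open>x = pot(x \<inter> h)\<close>\<close>
definition hist :: "nat \<Rightarrow> nat \<Rightarrow> nfm" where
  "hist n h = NAll n (NImp (mem n h)
      (NAll (n+1) (NIff (mem (n+1) n)
         (NEx (n+2) (NAnd (nsub (n+3) (n+1) (n+2)) (NAnd (mem (n+2) n) (mem (n+2) h)))))))"

definition level :: "nat \<Rightarrow> nat \<Rightarrow> nfm" where
  "level n s = NEx n (NAnd (hist (n+1) n)
      (NAll (n+1) (NIff (mem (n+1) s) (inPot (n+2) (n+1) n))))"

definition inBpot :: "nat \<Rightarrow> nat \<Rightarrow> nat \<Rightarrow> nfm" where
  "inBpot n x a = NEx n (NAnd (mem n a) (NAnd (NNot (mem n n))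
      (NOr (nsub (n+1) x n) (ncsub (n+1) x n))))"

text \<open>boolean-history h: \<open>h \<notin> h\<close> and for all \<open>x \<in> h\<close>, \<open>x = bpot(x \<inter> h)\<close>\<close>
definition bhist :: "nat \<Rightarrow> nat \<Rightarrow> nfm" where
  "bhist n h = NAnd (NNot (mem h h)) (NAll n (NImp (mem n h)
      (NAll (n+1) (NIff (mem (n+1) n)
         (NEx (n+2) (NAnd (NAnd (mem (n+2) n) (mem (n+2) h))
             (NAnd (NNot (mem (n+2) (n+2)))
                   (NOr (nsub (n+3) (n+1) (n+2)) (ncsub (n+3) (n+1) (n+2))))))))))"

definition blevel :: "nat \<Rightarrow> nat \<Rightarrow> nfm" where
  "blevel n s = NEx n (NAnd (bhist (n+1) n)
      (NAll (n+1) (NIff (mem (n+1) s) (inBpot (n+2) (n+1) n))))"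

definition Extensionality :: nfm where
  "Extensionality = NAll 0 (NAll 1 (NImp (NAll 2 (NIff (mem 2 0) (mem 2 1))) (eqv 0 1)))"

definition Separation :: nfm where
  "Separation = NAllP 0 (NAll 0 (NEx 1 (NAll 2
      (NIff (mem 2 1) (NAnd (NPA 0 (NV 2)) (mem 2 0))))))"

definition Pairing :: nfm where
  "Pairing = NAll 0 (NAll 1 (NEx 2 (NAll 3 (NIff (mem 3 2) (NOr (eqv 3 0) (eqv 3 1))))))"

definition Union :: nfm where
  "Union = NAll 0 (NEx 1 (NAll 2 (NIff (mem 2 1) (NEx 3 (NAnd (mem 3 0) (mem 2 3))))))"

definition Powerset :: nfm where
  "Powerset = NAll 0 (NEx 1 (NAll 2 (NIff (mem 2 1) (nsub 3 2 0))))"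

definition Infinity :: nfm where
  "Infinity = NEx 0 (NAnd (NEx 1 (NAnd (mem 1 0) (NAll 2 (NNot (mem 2 1)))))
      (NAll 1 (NImp (mem 1 0) (NEx 2 (NAnd (mem 2 0)
         (NAll 3 (NIff (mem 3 2) (NOr (mem 3 1) (eqv 3 1)))))))))"

definition Foundation :: nfm where
  "Foundation = NAll 0 (NImp (NEx 1 (mem 1 0))
      (NEx 1 (NAnd (mem 1 0) (NAll 2 (NImp (mem 2 1) (NNot (mem 2 0)))))))"

definition Replacement :: nfm where
  "Replacement = NAllF 0 (NAll 0 (NEx 1 (NAll 2
      (NImp (mem 2 0) (NMem (NAp 0 (NV 2)) (NV 1))))))"

definition ZF :: "fm set" where
  "ZF = sent ` {Extensionality, Separation, Pairing, Union, Powerset, Infinity,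
                Foundation, Replacement}"

definition Stratification :: nfm where
  "Stratification = NAll 0 (NEx 1 (NAnd (level 10 1) (nsub 2 0 1)))"

definition LevelsEndless :: nfm where
  "LevelsEndless = NAll 0 (NImp (level 10 0) (NEx 1 (NAnd (level 10 1) (mem 0 1))))"

definition LT :: "fm set" where
  "LT = sent ` {Extensionality, Separation, Stratification}"

definition LTplus :: "fm set" where
  "LTplus = LT \<union> {sent LevelsEndless}"

definition Complements :: nfm where
  "Complements = NAll 0 (NEx 1 (NAnd (NAll 2 (NIff (mem 2 1) (NNot (mem 2 0))))
      (NIff (NNot (mem 0 0)) (mem 1 1))))"

definition SeparationN :: nfm where
  "SeparationN = NAllP 0 (NAll 0 (NImp (NNot (mem 0 0)) (NEx 1 (NAnd (NNot (mem 1 1))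
      (NAll 2 (NIff (mem 2 1) (NAnd (NPA 0 (NV 2)) (mem 2 0))))))))"

definition StratificationN :: nfm where
  "StratificationN = NAll 0 (NImp (NNot (mem 0 0))
      (NEx 1 (NAnd (blevel 10 1) (nsub 2 0 1))))"

definition BLevelsEndless :: nfm where
  "BLevelsEndless = NAll 0 (NImp (blevel 10 0) (NEx 1 (NAnd (blevel 10 1) (mem 0 1))))"

definition InfinityN :: nfm where
  "InfinityN = NEx 0 (NAnd (blevel 10 0) (NAnd
      (NEx 1 (NAnd (blevel 10 1) (mem 1 0)))
      (NAll 1 (NImp (NAnd (blevel 10 1) (mem 1 0))
         (NEx 2 (NAnd (blevel 10 2) (NAnd (mem 1 2) (mem 2 0))))))))"

definition UnboundedN :: nfm where
  "UnboundedN = NAllF 0 (NAll 0 (NImp (NNot (mem 0 0))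
      (NEx 1 (NAnd (blevel 10 1)
         (NAll 2 (NImp (mem 2 0) (NMem (NAp 0 (NV 2)) (NV 1))))))))"

definition BLT :: "fm set" where
  "BLT = sent ` {Extensionality, Complements, SeparationN, StratificationN}"

definition BLTplus :: "fm set" where
  "BLTplus = BLT \<union> {sent BLevelsEndless}"

definition BLT_ZF :: "fm set" where
  "BLT_ZF = BLT \<union> {sent InfinityN, sent UnboundedN}"

end

theory Submission
  imports Defs "HOL-Library.Countable_Set"
begin

text \<open>
  Provability is handled through Henkin models: the calculus is complete for structures equipped with
  a class of predicates and a class of functions, both closed under definability. All four theories
  have only infinite models, so countable models over the type of natural numbers suffice, and
  definitional equivalence becomes a statement about pairs of membership relations on one domain.

  Coding. In a model of LT\<open>\<^sup>+\<close> choose a definable bijection \<open>\<sigma>\<close> from the universe onto the nonempty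
  sets, moving ranks by at most one, and read \<open>y\<close> as a boolean set: it is low if \<open>\<emptyset> \<notin> y\<close> and high
  otherwise, and its low part is \<open>{x. \<sigma> x \<in> y}\<close>. Complementation then just toggles \<open>\<emptyset>\<close>. The map \<open>\<sigma>\<close>
  is a Hilbert hotel: it shifts the orbit \<open>0, 0', s 0, (s 0)', s (s 0), ...\<close>, where the dash toggles
  \<open>\<emptyset>\<close> and \<open>s y = {y'}\<close>, and fixes all other sets. On this orbit \<open>{y'}\<close> is the boolean singleton of \<open>y\<close>
  and \<open>y'\<close> is the boolean complement of \<open>y\<close>, so \<open>\<sigma>\<close> can be defined from either membership relation
  and the two translations are mutually inverse.

  Both membership relations have the same small classes of objects and assign ranks that differ only
  by finite amounts between limits. By induction on the levels of one structure every set is caught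
  below a level of the other, the limit levels being exactly the stages at which the finite
  discrepancies are absorbed; hence stratification, endlessness and infinity transfer both ways,
  and replacement and unboundedness become the same statement about small classes.
\<close>

section \<open>Simultaneous substitution\<close>

text \<open>A statement of HOL cannot quantify over carrier types, so all countermodels are put on
  one type; this is why infinity of models is proved, and why it is proved for structures whose
  identity is only a congruence. A boolean set amounts to a low part plus one bit. The bit needs a
  place that no coded member occupies; the empty set is that place, and since the empty set may
  itself be a member, members have to be moved out of its way by \<sigma>. Formulas over either
  relation must define the same \<sigma>, which excludes an arbitrary injection: its orbit is built
  from operations that both relations can name. LT+ offers neither Replacement nor Infinity. The
  orbit may fail to be a set, so belonging to it is expressed by descent to the empty set; and
  images under \<sigma> exist only because they are bounded a fixed number of levels higher.
  Endlessness provides these levels as well as singletons and toggles.\<close>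

primrec sbT :: "(nat \<Rightarrow> trm) \<Rightarrow> (nat \<Rightarrow> nat) \<Rightarrow> trm \<Rightarrow> trm" where
  "sbT \<sigma> \<rho> (V n) = \<sigma> n"
| "sbT \<sigma> \<rho> (Ap f t) = Ap (\<rho> f) (sbT \<sigma> \<rho> t)"

definition upT :: "(nat \<Rightarrow> trm) \<Rightarrow> nat \<Rightarrow> trm" where
  "upT \<sigma> n = (case n of 0 \<Rightarrow> V 0 | Suc k \<Rightarrow> liftT 0 (\<sigma> k))"

definition upN :: "(nat \<Rightarrow> nat) \<Rightarrow> nat \<Rightarrow> nat" where
  "upN \<rho> n = (case n of 0 \<Rightarrow> 0 | Suc k \<Rightarrow> Suc (\<rho> k))"

definition scons :: "'b \<Rightarrow> (nat \<Rightarrow> 'b) \<Rightarrow> nat \<Rightarrow> 'b" where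
  "scons x e n = (case n of 0 \<Rightarrow> x | Suc k \<Rightarrow> e k)"

lemma upT_simps [simp]: "upT \<sigma> 0 = V 0" "upT \<sigma> (Suc k) = liftT 0 (\<sigma> k)"
  by (auto simp: upT_def)

lemma upN_simps [simp]: "upN \<rho> 0 = 0" "upN \<rho> (Suc k) = Suc (\<rho> k)"
  by (auto simp: upN_def)

lemma scons_simps [simp]: "scons x e 0 = x" "scons x e (Suc k) = e k"
  by (auto simp: scons_def)

text \<open>All three sorts of variables are replaced simultaneously, so liftings, substitutions and
  renamings become instances and one composition law covers their interplay. Predicate and function
  variables are only renamed, as in the calculus, where comprehension does the rest. Below a
  function quantifier the substituted terms are lifted because they may contain function
  variables.\<close>

primrec sb :: "(nat \<Rightarrow> trm) \<Rightarrow> (nat \<Rightarrow> nat) \<Rightarrow> (nat \<Rightarrow> nat) \<Rightarrow> fm \<Rightarrow> fm" where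
  "sb \<sigma> \<pi> \<rho> (Mem s t) = Mem (sbT \<sigma> \<rho> s) (sbT \<sigma> \<rho> t)"
| "sb \<sigma> \<pi> \<rho> (Eq s t) = Eq (sbT \<sigma> \<rho> s) (sbT \<sigma> \<rho> t)"
| "sb \<sigma> \<pi> \<rho> (PA p t) = PA (\<pi> p) (sbT \<sigma> \<rho> t)"
| "sb \<sigma> \<pi> \<rho> Bot = Bot"
| "sb \<sigma> \<pi> \<rho> (Imp \<phi> \<psi>) = Imp (sb \<sigma> \<pi> \<rho> \<phi>) (sb \<sigma> \<pi> \<rho> \<psi>)"
| "sb \<sigma> \<pi> \<rho> (All \<phi>) = All (sb (upT \<sigma>) \<pi> \<rho> \<phi>)"
| "sb \<sigma> \<pi> \<rho> (AllP \<phi>) = AllP (sb \<sigma> (upN \<pi>) \<rho> \<phi>)"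
| "sb \<sigma> \<pi> \<rho> (AllF \<phi>) = AllF (sb (\<lambda>n. liftFT 0 (\<sigma> n)) \<pi> (upN \<rho>) \<phi>)"

lemma sb_derived [simp]:
  "sb \<sigma> \<pi> \<rho> (Not \<phi>) = Not (sb \<sigma> \<pi> \<rho> \<phi>)"
  "sb \<sigma> \<pi> \<rho> (And \<phi> \<psi>) = And (sb \<sigma> \<pi> \<rho> \<phi>) (sb \<sigma> \<pi> \<rho> \<psi>)"
  "sb \<sigma> \<pi> \<rho> (Iff \<phi> \<psi>) = Iff (sb \<sigma> \<pi> \<rho> \<phi>) (sb \<sigma> \<pi> \<rho> \<psi>)"
  "sb \<sigma> \<pi> \<rho> (Ex \<phi>) = Ex (sb (upT \<sigma>) \<pi> \<rho> \<phi>)"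
  "sb \<sigma> \<pi> \<rho> (ExP \<phi>) = ExP (sb \<sigma> (upN \<pi>) \<rho> \<phi>)"
  "sb \<sigma> \<pi> \<rho> (ExF \<phi>) = ExF (sb (\<lambda>n. liftFT 0 (\<sigma> n)) \<pi> (upN \<rho>) \<phi>)"
  by (simp_all add: Not_def And_def Iff_def Ex_def ExP_def ExF_def)

lemma sbT_liftT: "sbT \<sigma> \<rho> (liftT 0 t) = sbT (\<lambda>n. \<sigma> (Suc n)) \<rho> t"
  by (induction t) auto

lemma sbT_liftFT: "sbT \<sigma> \<rho> (liftFT 0 t) = sbT \<sigma> (\<lambda>n. \<rho> (Suc n)) t"
  by (induction t) auto

lemma liftT_sbT: "liftT 0 (sbT \<sigma> \<rho> t) = sbT (\<lambda>n. liftT 0 (\<sigma> n)) \<rho> t"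
  by (induction t) auto

lemma liftFT_sbT: "liftFT 0 (sbT \<sigma> \<rho> t) = sbT (\<lambda>n. liftFT 0 (\<sigma> n)) (\<lambda>n. Suc (\<rho> n)) t"
  by (induction t) auto

lemma sbT_comp: "sbT \<sigma>2 \<rho>2 (sbT \<sigma>1 \<rho>1 t) = sbT (\<lambda>n. sbT \<sigma>2 \<rho>2 (\<sigma>1 n)) (\<lambda>n. \<rho>2 (\<rho>1 n)) t"
  by (induction t) auto

lemma upT_comp: "(\<lambda>n. sbT (upT \<sigma>2) \<rho>2 (upT \<sigma>1 n)) = upT (\<lambda>n. sbT \<sigma>2 \<rho>2 (\<sigma>1 n))"
  by (rule ext) (auto simp: upT_def sbT_liftT liftT_sbT split: nat.splits)

lemma upN_comp: "(\<lambda>n. upN \<rho>2 (upN \<rho>1 n)) = upN (\<lambda>n. \<rho>2 (\<rho>1 n))"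
  by (rule ext) (auto simp: upN_def split: nat.splits)

lemma sb_comp: "sb \<sigma>2 \<pi>2 \<rho>2 (sb \<sigma>1 \<pi>1 \<rho>1 \<phi>) =
    sb (\<lambda>n. sbT \<sigma>2 \<rho>2 (\<sigma>1 n)) (\<lambda>n. \<pi>2 (\<pi>1 n)) (\<lambda>n. \<rho>2 (\<rho>1 n)) \<phi>"
  by (induction \<phi> arbitrary: \<sigma>1 \<sigma>2 \<pi>1 \<pi>2 \<rho>1 \<rho>2)
    (simp_all add: sbT_comp upT_comp upN_comp sbT_liftFT liftFT_sbT)

lemma sbT_V: "sbT V (\<lambda>n. n) t = t"
  by (induction t) auto

lemma sb_closed_cong:
  assumes "closed k m j \<phi>" "\<And>n. n < k \<Longrightarrow> \<sigma> n = \<sigma>' n" "\<And>n. n < m \<Longrightarrow> \<pi> n = \<pi>' n"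
    "\<And>n. n < j \<Longrightarrow> \<rho> n = \<rho>' n"
  shows "sb \<sigma> \<pi> \<rho> \<phi> = sb \<sigma>' \<pi>' \<rho>' \<phi>"
proof -
  have T: "sbT \<sigma> \<rho> t = sbT \<sigma>' \<rho>' t" if "clT k t" "noFT j t" "\<And>n. n < k \<Longrightarrow> \<sigma> n = \<sigma>' n"
    "\<And>n. n < j \<Longrightarrow> \<rho> n = \<rho>' n" for k j t and \<sigma> \<sigma>' :: "nat \<Rightarrow> trm" and \<rho> \<rho>'
    using that by (induction t) auto
  show ?thesis
    using assms
  proof (induction \<phi> arbitrary: k m j \<sigma> \<sigma>' \<pi> \<pi>' \<rho> \<rho>')
    case (Mem s t)
    then show ?case using T[of k s j \<sigma> \<sigma>' \<rho> \<rho>'] T[of k t j \<sigma> \<sigma>' \<rho> \<rho>'] by simp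
  next
    case (Eq s t)
    then show ?case using T[of k s j \<sigma> \<sigma>' \<rho> \<rho>'] T[of k t j \<sigma> \<sigma>' \<rho> \<rho>'] by simp
  next
    case (PA p t)
    then show ?case using T[of k t j \<sigma> \<sigma>' \<rho> \<rho>'] by simp
  next
    case Bot
    then show ?case by simp
  next
    case (Imp \<phi> \<psi>)
    then show ?case by (metis sb.simps(5) closed.simps(5))
  next
    case (All \<phi>)
    have "sb (upT \<sigma>) \<pi> \<rho> \<phi> = sb (upT \<sigma>') \<pi>' \<rho>' \<phi>"
      by (rule All.IH[of "Suc k" m j]) (use All.prems in \<open>auto simp: upT_def split: nat.splits\<close>)
    then show ?case by simp
  next
    case (AllP \<phi>)
    have "sb \<sigma> (upN \<pi>) \<rho> \<phi> = sb \<sigma>' (upN \<pi>') \<rho>' \<phi>"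
      by (rule AllP.IH[of k "Suc m" j]) (use AllP.prems in \<open>auto simp: upN_def split: nat.splits\<close>)
    then show ?case by simp
  next
    case (AllF \<phi>)
    have "sb (\<lambda>n. liftFT 0 (\<sigma> n)) \<pi> (upN \<rho>) \<phi> = sb (\<lambda>n. liftFT 0 (\<sigma>' n)) \<pi>' (upN \<rho>') \<phi>"
      by (rule AllF.IH[of k m "Suc j"]) (use AllF.prems in \<open>auto simp: upN_def split: nat.splits\<close>)
    then show ?case by simp
  qed
qed

lemma sb_id: "sb V (\<lambda>n. n) (\<lambda>n. n) \<phi> = \<phi>"
proof -
  have "upT V = V" "upN (\<lambda>n. n) = (\<lambda>n. n)"
    by (auto simp: upT_def upN_def split: nat.splits)
  then show ?thesis
    by (induction \<phi>) (simp_all add: sbT_V)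
qed

lemma sb_closed: "closed 0 0 0 \<phi> \<Longrightarrow> sb \<sigma> \<pi> \<rho> \<phi> = \<phi>"
  using sb_closed_cong[of 0 0 0 \<phi> \<sigma> V \<pi> "\<lambda>n. n" \<rho> "\<lambda>n. n"] sb_id by simp

section \<open>Liftings, substitutions and renamings as instances of simultaneous
  substitution\<close>

definition shiftV :: "nat \<Rightarrow> nat \<Rightarrow> nat" where
  "shiftV k n = (if k \<le> n then Suc n else n)"

definition instN :: "nat \<Rightarrow> nat \<Rightarrow> nat \<Rightarrow> nat" where
  "instN k g n = (if n = k then g else if k < n then n - 1 else n)"

definition instV :: "nat \<Rightarrow> trm \<Rightarrow> nat \<Rightarrow> trm" where
  "instV k u n = (if n = k then u else if k < n then V (n - 1) else V n)"

lemma lift_sb: "lift k \<phi> = sb (\<lambda>n. V (shiftV k n)) (\<lambda>n. n) (\<lambda>n. n) \<phi>"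
proof -
  have T: "liftT k t = sbT (\<lambda>n. V (shiftV k n)) (\<lambda>n. n) t" for k t
    by (induction t) (auto simp: shiftV_def)
  have 1: "upT (\<lambda>n. V (shiftV k n)) = (\<lambda>n. V (shiftV (Suc k) n))" for k
    by (rule ext) (auto simp: upT_def shiftV_def split: nat.splits)
  have 2: "upN (\<lambda>n. n) = (\<lambda>n. n)"
    by (rule ext) (auto simp: upN_def split: nat.splits)
  show ?thesis
    by (induction \<phi> arbitrary: k) (simp_all add: T 1 2)
qed

lemma liftP_sb: "liftP k \<phi> = sb V (shiftV k) (\<lambda>n. n) \<phi>"
proof -
  have 1: "upT V = V" "upN (\<lambda>n. n) = (\<lambda>n. n)"
    by (auto simp: upT_def upN_def split: nat.splits)
  have 2: "upN (shiftV k) = shiftV (Suc k)" for k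
    by (rule ext) (auto simp: upN_def shiftV_def split: nat.splits)
  show ?thesis
    by (induction \<phi> arbitrary: k) (simp_all add: 1 2 sbT_V, simp_all add: shiftV_def)
qed

lemma liftF_sb: "liftF k \<phi> = sb V (\<lambda>n. n) (shiftV k) \<phi>"
proof -
  have T: "liftFT k t = sbT V (shiftV k) t" for k t
    by (induction t) (auto simp: shiftV_def)
  have 1: "upT V = V" "upN (\<lambda>n. n) = (\<lambda>n. n)"
    by (auto simp: upT_def upN_def split: nat.splits)
  have 2: "upN (shiftV k) = shiftV (Suc k)" for k
    by (rule ext) (auto simp: upN_def shiftV_def split: nat.splits)
  show ?thesis
    by (induction \<phi> arbitrary: k) (simp_all add: 1 2 T)
qed

lemma subst_sb: "subst k u \<phi> = sb (instV k u) (\<lambda>n. n) (\<lambda>n. n) \<phi>"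
proof -
  have T: "substT k u t = sbT (instV k u) (\<lambda>n. n) t" for k t u
    by (induction t) (auto simp: instV_def)
  have 1: "upT (instV k u) = instV (Suc k) (liftT 0 u)" for k u
    by (rule ext) (auto simp: upT_def instV_def split: nat.splits)
  have 2: "upN (\<lambda>n. n) = (\<lambda>n. n)"
    by (rule ext) (auto simp: upN_def split: nat.splits)
  have 3: "(\<lambda>n. liftFT 0 (instV k u n)) = instV k (liftFT 0 u)" for k u
    by (rule ext) (auto simp: instV_def)
  show ?thesis
    by (induction \<phi> arbitrary: k u) (simp_all add: T 1 2 3)
qed

lemma renP_sb: "renP k g \<phi> = sb V (instN k g) (\<lambda>n. n) \<phi>"
proof -
  have 1: "upT V = V" "upN (\<lambda>n. n) = (\<lambda>n. n)"
    by (auto simp: upT_def upN_def split: nat.splits)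
  have 2: "upN (instN k g) = instN (Suc k) (Suc g)" for k g
    by (rule ext) (auto simp: upN_def instN_def split: nat.splits)
  show ?thesis
    by (induction \<phi> arbitrary: k g) (simp_all add: 1 2 sbT_V, simp_all add: instN_def)
qed

lemma renF_sb: "renF k g \<phi> = sb V (\<lambda>n. n) (instN k g) \<phi>"
proof -
  have T: "renFT k g t = sbT V (instN k g) t" for k g t
    by (induction t) (auto simp: instN_def)
  have 1: "upT V = V" "upN (\<lambda>n. n) = (\<lambda>n. n)"
    by (auto simp: upT_def upN_def split: nat.splits)
  have 2: "upN (instN k g) = instN (Suc k) (Suc g)" for k g
    by (rule ext) (auto simp: upN_def instN_def split: nat.splits)
  show ?thesis
    by (induction \<phi> arbitrary: k g) (simp_all add: 1 2 T)
qed

lemma inst_0 [simp]: "instV 0 u = scons u V" "instN 0 g = scons g (\<lambda>n. n)" "shiftV 0 = Suc"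
  by (auto simp: instV_def instN_def shiftV_def scons_def fun_eq_iff split: nat.splits)

lemma sb_ext: "\<sigma> = \<sigma>' \<Longrightarrow> \<pi> = \<pi>' \<Longrightarrow> \<rho> = \<rho>' \<Longrightarrow> sb \<sigma> \<pi> \<rho> \<phi> = sb \<sigma>' \<pi>' \<rho>' \<phi>"
  by simp

lemma sb_subst0: "sb \<sigma> \<pi> \<rho> (subst 0 t \<phi>) = subst 0 (sbT \<sigma> \<rho> t) (sb (upT \<sigma>) \<pi> \<rho> \<phi>)"
  unfolding subst_sb sb_comp
  by (rule sb_ext) (auto simp: fun_eq_iff scons_def upT_def sbT_liftT sbT_V split: nat.splits)

lemma subst0_sb_up: "subst 0 t (sb (upT \<sigma>) \<pi> \<rho> \<phi>) = sb (scons t \<sigma>) \<pi> \<rho> \<phi>"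
  unfolding subst_sb sb_comp
  by (rule sb_ext) (auto simp: fun_eq_iff scons_def upT_def sbT_liftT sbT_V split: nat.splits)

lemma renP0_sb_up: "renP 0 g (sb \<sigma> (upN \<pi>) \<rho> \<phi>) = sb \<sigma> (scons g \<pi>) \<rho> \<phi>"
  unfolding renP_sb sb_comp
  by (rule sb_ext) (auto simp: fun_eq_iff scons_def upN_def sbT_V split: nat.splits)

lemma renF0_sb_up: "renF 0 g (sb (\<lambda>n. liftFT 0 (\<sigma> n)) \<pi> (upN \<rho>) \<phi>) = sb \<sigma> \<pi> (scons g \<rho>) \<phi>"
  unfolding renF_sb sb_comp
  by (rule sb_ext) (auto simp: fun_eq_iff scons_def upN_def sbT_V sbT_liftFT split: nat.splits)

lemma sb_renP0: "sb \<sigma> \<pi> \<rho> (renP 0 g \<phi>) = renP 0 (\<pi> g) (sb \<sigma> (upN \<pi>) \<rho> \<phi>)"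
  unfolding renP0_sb_up unfolding renP_sb sb_comp
  by (rule sb_ext) (auto simp: fun_eq_iff scons_def split: nat.splits)

lemma sb_renF0: "sb \<sigma> \<pi> \<rho> (renF 0 g \<phi>) = renF 0 (\<rho> g) (sb (\<lambda>n. liftFT 0 (\<sigma> n)) \<pi> (upN \<rho>) \<phi>)"
  unfolding renF0_sb_up unfolding renF_sb sb_comp
  by (rule sb_ext) (auto simp: fun_eq_iff scons_def split: nat.splits)

lemma sb_lift0: "sb (upT \<sigma>) \<pi> \<rho> (lift 0 \<phi>) = lift 0 (sb \<sigma> \<pi> \<rho> \<phi>)"
proof -
  have T: "liftT 0 t = sbT (\<lambda>n. V (Suc n)) (\<lambda>n. n) t" for t
    by (induction t) auto
  show ?thesis
    unfolding lift_sb sb_comp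
    by (rule sb_ext) (auto simp: fun_eq_iff T)
qed

lemma sb_lift1: "sb (upT (upT \<sigma>)) \<pi> \<rho> (lift 1 \<phi>) = lift 1 (sb (upT \<sigma>) \<pi> \<rho> \<phi>)"
proof -
  have T: "liftT 0 t = sbT (\<lambda>n. V (Suc n)) (\<lambda>n. n) t" for t
    by (induction t) auto
  show ?thesis
    unfolding lift_sb sb_comp
    by (rule sb_ext) (auto simp: fun_eq_iff T shiftV_def upT_def sbT_comp split: nat.splits)
qed

lemma sb_liftP0: "sb \<sigma> (upN \<pi>) \<rho> (liftP 0 \<phi>) = liftP 0 (sb \<sigma> \<pi> \<rho> \<phi>)"
  unfolding liftP_sb sb_comp
  by (rule sb_ext) (auto simp: fun_eq_iff sbT_V)

lemma sb_liftF0: "sb (\<lambda>n. liftFT 0 (\<sigma> n)) \<pi> (upN \<rho>) (liftF 0 \<phi>) = liftF 0 (sb \<sigma> \<pi> \<rho> \<phi>)"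
proof -
  have T: "liftFT 0 t = sbT V Suc t" for t
    by (induction t) auto
  show ?thesis
    unfolding liftF_sb sb_comp
    by (rule sb_ext) (auto simp: fun_eq_iff T)
qed

lemma upT_liftFT: "upT (\<lambda>n. liftFT 0 (\<sigma> n)) = (\<lambda>n. liftFT 0 (upT \<sigma> n))"
proof -
  have "liftT 0 (liftFT 0 t) = liftFT 0 (liftT 0 t)" for t
    by (induction t) auto
  then show ?thesis
    by (auto simp: fun_eq_iff upT_def split: nat.splits)
qed

text \<open>Closed axioms are fixed by \<open>sb\<close>, and each axiom scheme is carried to
  another instance of itself. This allows eigenvariables to be renamed in a given
  derivation.\<close>

theorem prv_sb:
  assumes "prv \<Gamma> \<phi>" "\<And>\<gamma>. \<gamma> \<in> \<Gamma> \<Longrightarrow> closed 0 0 0 \<gamma>"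
  shows "prv \<Gamma> (sb \<sigma> \<pi> \<rho> \<phi>)"
  using assms(1)
proof (induction arbitrary: \<sigma> \<pi> \<rho>)
  case (ax \<phi>)
  then show ?case using assms(2) by (simp add: sb_closed prv.ax)
next
  case (MP \<phi> \<psi>)
  then show ?case by (metis prv.MP sb.simps(5))
next
  case (Leib t u \<phi>)
  show ?case by (simp add: sb_subst0 prv.Leib)
next
  case (CompP \<phi>)
  show ?case using prv.CompP[of \<Gamma> "sb (upT \<sigma>) \<pi> \<rho> \<phi>"] by (simp add: sb_liftP0)
next
  case (CompF \<phi>)
  show ?case
    using prv.CompF[of \<Gamma> "sb (upT (upT \<sigma>)) \<pi> \<rho> \<phi>"]
    by (simp add: sb_lift1 sb_liftF0 sb_subst0 upT_liftFT sb_lift1[unfolded One_nat_def])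
qed (auto simp: sb_subst0 sb_renP0 sb_renF0 sb_lift0 sb_liftP0 sb_liftF0 intro: prv.intros)

text \<open>\<open>interp\<close> leaves no free variables in \<open>I\<close> except the two
  argument places, so a substitution reaches only the arguments of a translated membership
  atom.\<close>

lemma tr_sb:
  assumes "interp I"
  shows "tr I (sb \<sigma> \<pi> \<rho> \<phi>) = sb \<sigma> \<pi> \<rho> (tr I \<phi>)"
proof (induction \<phi> arbitrary: \<sigma> \<pi> \<rho>)
  case (Mem s t)
  have *: "inst2 I u v = sb (scons u (scons v V)) (\<lambda>n. n) (\<lambda>n. n) I" for u v
    unfolding inst2_def subst_sb sb_comp
    by (rule sb_ext) (auto simp: fun_eq_iff instV_def scons_def sbT_liftT sbT_V split: nat.splits)
  have "inst2 I (sbT \<sigma> \<rho> s) (sbT \<sigma> \<rho> t) = sb \<sigma> \<pi> \<rho> (inst2 I s t)"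
    unfolding * sb_comp
    by (rule sb_closed_cong[of 2 0 0])
      (use assms in \<open>auto simp: interp_def scons_def split: nat.splits\<close>)
  then show ?case by simp
qed auto

text \<open>Because the translation commutes with every substitution, it maps instances of a scheme,
  including Leibniz and comprehension, to instances of the same scheme; only the proper axioms of
  \<open>S\<close> remain to be checked.\<close>

lemma prv_tr:
  assumes "prv S \<phi>" "interp I" "\<And>\<alpha>. \<alpha> \<in> S \<Longrightarrow> prv T (tr I \<alpha>)"
  shows "prv T (tr I \<phi>)"
proof -
  note c = tr_sb[OF assms(2)]
  have d: "tr I (Not \<phi>) = Not (tr I \<phi>)" "tr I (And \<phi> \<psi>) = And (tr I \<phi>) (tr I \<psi>)"
    "tr I (Iff \<phi> \<psi>) = Iff (tr I \<phi>) (tr I \<psi>)" "tr I (Ex \<phi>) = Ex (tr I \<phi>)"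
    "tr I (ExP \<phi>) = ExP (tr I \<phi>)" "tr I (ExF \<phi>) = ExF (tr I \<phi>)" for \<phi> \<psi>
    by (simp_all add: Not_def And_def Iff_def Ex_def ExP_def ExF_def)
  have e: "tr I (lift k \<phi>) = lift k (tr I \<phi>)" "tr I (subst k t \<phi>) = subst k t (tr I \<phi>)"
    "tr I (liftP k \<phi>) = liftP k (tr I \<phi>)" "tr I (liftF k \<phi>) = liftF k (tr I \<phi>)"
    "tr I (renP k g \<phi>) = renP k g (tr I \<phi>)" "tr I (renF k g \<phi>) = renF k g (tr I \<phi>)" for k g t \<phi>
    by (simp_all add: lift_sb subst_sb liftP_sb liftF_sb renP_sb renF_sb c)
  show ?thesis
    using assms(1)
  proof (induction)
    case (ax \<phi>)
    then show ?case by (rule assms(3))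
  next
    case (MP \<phi> \<psi>)
    then show ?case by (metis prv.MP tr.simps(5))
  qed (simp only: d e tr.simps; blast intro: prv.intros)+
qed

section \<open>Henkin sets\<close>

text \<open>Generalisation in \<open>prv\<close> is unrestricted, so an open formula added to
  \<open>\<Gamma>\<close> would act like its universal closure. Temporary hypotheses with free
  variables are therefore stacked as antecedents, and the deduction theorem becomes a reordering of
  the list.\<close>

definition entails :: "fm set \<Rightarrow> fm list \<Rightarrow> fm \<Rightarrow> bool" where
  "entails \<Gamma> \<Delta> \<chi> \<longleftrightarrow> prv \<Gamma> (foldr Imp \<Delta> \<chi>)"

lemma prv_trans: "prv \<Gamma> (Imp a b) \<Longrightarrow> prv \<Gamma> (Imp b c) \<Longrightarrow> prv \<Gamma> (Imp a c)"
  by (meson prv.K prv.S prv.MP)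

lemma prv_imp_mono: "prv \<Gamma> (Imp a b) \<Longrightarrow> prv \<Gamma> (Imp (Imp d a) (Imp d b))"
  by (meson prv.K prv.S prv.MP)

lemma entails_prv: "prv \<Gamma> \<chi> \<Longrightarrow> entails \<Gamma> \<Delta> \<chi>"
  unfolding entails_def by (induction \<Delta>) (auto intro: prv.K prv.MP)

lemma entails_MP: "entails \<Gamma> \<Delta> (Imp a b) \<Longrightarrow> entails \<Gamma> \<Delta> a \<Longrightarrow> entails \<Gamma> \<Delta> b"
proof -
  have "prv \<Gamma> (Imp (foldr Imp \<Delta> (Imp a b)) (Imp (foldr Imp \<Delta> a) (foldr Imp \<Delta> b)))"
  proof (induction \<Delta>)
    case Nil
    have "prv \<Gamma> (Imp (Imp a b) (Imp a b))" by (meson prv.K prv.S prv.MP)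
    then show ?case by simp
  next
    case (Cons d \<Delta>)
    then show ?case by simp (meson prv_imp_mono prv_trans prv.S)
  qed
  then show "entails \<Gamma> \<Delta> (Imp a b) \<Longrightarrow> entails \<Gamma> \<Delta> a \<Longrightarrow> entails \<Gamma> \<Delta> b"
    unfolding entails_def by (meson prv.MP)
qed

lemma entails_assm: "\<chi> \<in> set \<Delta> \<Longrightarrow> entails \<Gamma> \<Delta> \<chi>"
proof (induction \<Delta>)
  case (Cons d \<Delta>)
  have "prv \<Gamma> (Imp d (foldr Imp \<Delta> d))"
  proof (induction \<Delta>)
    case Nil
    show ?case by simp (meson prv.K prv.S prv.MP)
  next
    case (Cons c \<Delta>)
    then show ?case by simp (meson prv.K prv_trans)
  qed
  then show ?case
    using Cons by (auto simp: entails_def intro: prv.K prv.MP)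
qed simp

lemma entails_mono:
  assumes "entails \<Gamma> \<Delta> \<chi>" "set \<Delta> \<subseteq> set \<Delta>'"
  shows "entails \<Gamma> \<Delta>' \<chi>"
proof -
  have "entails \<Gamma> \<Delta>' (foldr Imp \<Delta> \<chi>)" using assms(1) entails_prv unfolding entails_def by blast
  then show ?thesis
    using assms(2)
  proof (induction \<Delta>)
    case (Cons d \<Delta>)
    then show ?case using entails_MP[of \<Gamma> \<Delta>' d] entails_assm[of d \<Delta>' \<Gamma>] by auto
  qed simp
qed

lemma entails_impI: "entails \<Gamma> (a # \<Delta>) b \<Longrightarrow> entails \<Gamma> \<Delta> (Imp a b)"
  using entails_mono[of \<Gamma> "a # \<Delta>" b "\<Delta> @ [a]"] by (simp add: entails_def)

lemma entails_contr:
  assumes "entails \<Gamma> (Not a # \<Delta>) Bot"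
  shows "entails \<Gamma> \<Delta> a"
  using entails_MP[OF entails_prv[OF prv.DN] ] entails_impI[OF assms] unfolding Not_def by blast

lemma entails_absurd: "entails \<Gamma> \<Delta> a \<Longrightarrow> entails \<Gamma> \<Delta> (Not a) \<Longrightarrow> entails \<Gamma> \<Delta> b"
proof -
  assume "entails \<Gamma> \<Delta> a" "entails \<Gamma> \<Delta> (Not a)"
  then have "entails \<Gamma> \<Delta> Bot" unfolding Not_def by (metis entails_MP)
  then have "entails \<Gamma> (Not b # \<Delta>) Bot" using entails_mono by (metis set_subset_Cons)
  then show ?thesis by (rule entails_contr)
qed

lemma prv_refl: "prv \<Gamma> (Imp a a)"
  by (meson prv.K prv.S prv.MP)

text \<open>Stated for any quantifier \<open>B\<close> with lifting \<open>l\<close>: the quantifier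
  is pulled through a stack of lifted hypotheses. All three sorts use it.\<close>

lemma entails_distrib:
  assumes B: "\<And>\<phi> \<psi>. prv \<Gamma> (Imp (B (Imp (l \<phi>) \<psi>)) (Imp \<phi> (B \<psi>)))"
  shows "prv \<Gamma> (Imp (B (foldr Imp (map l \<Delta>) \<psi>)) (foldr Imp \<Delta> (B \<psi>)))"
proof (induction \<Delta>)
  case Nil
  show ?case by (simp add: prv_refl)
next
  case (Cons d \<Delta>)
  show ?case using prv_trans[OF B prv_imp_mono[OF Cons.IH], of d] by simp
qed

text \<open>Eigenvariable rule: the index \<open>c\<close> lies beyond everything free in
  \<open>\<Delta>\<close> and \<open>\<psi>\<close>. Renaming \<open>c\<close> to 0 and shifting all
  else turns the hypotheses into their liftings and the instance at \<open>c\<close> back into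
  \<open>\<psi>\<close>, so that \<open>Gen\<close> and \<open>entails_distrib\<close>
  apply.\<close>

lemma entails_AllI:
  assumes "\<And>\<gamma>. \<gamma> \<in> \<Gamma> \<Longrightarrow> closed 0 0 0 \<gamma>" "\<And>\<delta>. \<delta> \<in> set \<Delta> \<Longrightarrow> closed c c c \<delta>"
    "closed (Suc c) c c \<psi>" "entails \<Gamma> \<Delta> (subst 0 (V c) \<psi>)"
  shows "entails \<Gamma> \<Delta> (All \<psi>)"
proof -
  let ?\<sigma> = "\<lambda>n. if n = c then V 0 else V (Suc n)"
  let ?s = "sb ?\<sigma> (\<lambda>n. n) (\<lambda>n. n)"
  have 1: "?s \<delta> = lift 0 \<delta>" if "closed c c c \<delta>" for \<delta>
    unfolding lift_sb by (rule sb_closed_cong[OF that]) auto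
  have "?s (subst 0 (V c) \<psi>) = sb V (\<lambda>n. n) (\<lambda>n. n) \<psi>"
    unfolding subst_sb sb_comp
    by (rule sb_closed_cong[OF assms(3)]) (auto simp: scons_def split: nat.splits)
  then have 2: "?s (subst 0 (V c) \<psi>) = \<psi>" by (simp add: sb_id)
  have "?s (foldr Imp \<Delta> \<chi>) = foldr Imp (map (lift 0) \<Delta>) (?s \<chi>)" for \<chi>
    using assms(2) by (induction \<Delta>) (auto simp: 1)
  then have 3: "prv \<Gamma> (All (foldr Imp (map (lift 0) \<Delta>) \<psi>))"
    using prv_sb[OF assms(4)[unfolded entails_def] assms(1), of ?\<sigma> "\<lambda>n. n" "\<lambda>n. n"] 2
    by (auto intro: prv.Gen)
  show ?thesis using entails_distrib[of \<Gamma> All "lift 0", OF prv.AllD] 3 unfolding entails_def by (rule prv.MP)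
qed

lemma entails_AllPI:
  assumes "\<And>\<gamma>. \<gamma> \<in> \<Gamma> \<Longrightarrow> closed 0 0 0 \<gamma>" "\<And>\<delta>. \<delta> \<in> set \<Delta> \<Longrightarrow> closed c c c \<delta>"
    "closed c (Suc c) c \<psi>" "entails \<Gamma> \<Delta> (renP 0 c \<psi>)"
  shows "entails \<Gamma> \<Delta> (AllP \<psi>)"
proof -
  let ?\<pi> = "\<lambda>n. if n = c then 0 else Suc n"
  let ?s = "sb V ?\<pi> (\<lambda>n. n)"
  have 1: "?s \<delta> = liftP 0 \<delta>" if "closed c c c \<delta>" for \<delta>
    unfolding liftP_sb by (rule sb_closed_cong[OF that]) auto
  have "?s (renP 0 c \<psi>) = sb V (\<lambda>n. n) (\<lambda>n. n) \<psi>"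
    unfolding renP_sb sb_comp
    by (rule sb_closed_cong[OF assms(3)]) (auto simp: scons_def split: nat.splits)
  then have 2: "?s (renP 0 c \<psi>) = \<psi>" by (simp add: sb_id)
  have "?s (foldr Imp \<Delta> \<chi>) = foldr Imp (map (liftP 0) \<Delta>) (?s \<chi>)" for \<chi>
    using assms(2) by (induction \<Delta>) (auto simp: 1)
  then have 3: "prv \<Gamma> (AllP (foldr Imp (map (liftP 0) \<Delta>) \<psi>))"
    using prv_sb[OF assms(4)[unfolded entails_def] assms(1), of V ?\<pi> "\<lambda>n. n"] 2
    by (auto intro: prv.GenP)
  show ?thesis using entails_distrib[of \<Gamma> AllP "liftP 0", OF prv.AllPD] 3 unfolding entails_def by (rule prv.MP)
qed

lemma entails_AllFI:
  assumes "\<And>\<gamma>. \<gamma> \<in> \<Gamma> \<Longrightarrow> closed 0 0 0 \<gamma>" "\<And>\<delta>. \<delta> \<in> set \<Delta> \<Longrightarrow> closed c c c \<delta>"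
    "closed c c (Suc c) \<psi>" "entails \<Gamma> \<Delta> (renF 0 c \<psi>)"
  shows "entails \<Gamma> \<Delta> (AllF \<psi>)"
proof -
  let ?\<rho> = "\<lambda>n. if n = c then 0 else Suc n"
  let ?s = "sb V (\<lambda>n. n) ?\<rho>"
  have 1: "?s \<delta> = liftF 0 \<delta>" if "closed c c c \<delta>" for \<delta>
    unfolding liftF_sb by (rule sb_closed_cong[OF that]) auto
  have "?s (renF 0 c \<psi>) = sb V (\<lambda>n. n) (\<lambda>n. n) \<psi>"
    unfolding renF_sb sb_comp
    by (rule sb_closed_cong[OF assms(3)]) (auto simp: scons_def split: nat.splits)
  then have 2: "?s (renF 0 c \<psi>) = \<psi>" by (simp add: sb_id)
  have "?s (foldr Imp \<Delta> \<chi>) = foldr Imp (map (liftF 0) \<Delta>) (?s \<chi>)" for \<chi>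
    using assms(2) by (induction \<Delta>) (auto simp: 1)
  then have 3: "prv \<Gamma> (AllF (foldr Imp (map (liftF 0) \<Delta>) \<psi>))"
    using prv_sb[OF assms(4)[unfolded entails_def] assms(1), of V "\<lambda>n. n" ?\<rho>] 2
    by (auto intro: prv.GenF)
  show ?thesis using entails_distrib[of \<Gamma> AllF "liftF 0", OF prv.AllFD] 3 unfolding entails_def by (rule prv.MP)
qed

section \<open>Fresh indices for finitely many formulas\<close>

lemma clT_mono: "clT k t \<Longrightarrow> k \<le> k' \<Longrightarrow> clT k' t"
  by (induction t) auto

lemma noFT_mono: "noFT j t \<Longrightarrow> j \<le> j' \<Longrightarrow> noFT j' t"
  by (induction t) auto

lemma closed_mono: "closed k m j \<phi> \<Longrightarrow> k \<le> k' \<Longrightarrow> m \<le> m' \<Longrightarrow> j \<le> j' \<Longrightarrow> closed k' m' j' \<phi>"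
proof (induction \<phi> arbitrary: k k' m m' j j')
  case (Imp \<phi> \<psi>)
  then show ?case by simp blast
next
  case (All \<phi>)
  then show ?case using All.IH[of "Suc k" m j "Suc k'" m' j'] by simp
next
  case (AllP \<phi>)
  then show ?case using AllP.IH[of k "Suc m" j k' "Suc m'" j'] by simp
next
  case (AllF \<phi>)
  then show ?case using AllF.IH[of k m "Suc j" k' m' "Suc j'"] by simp
qed (auto intro: clT_mono noFT_mono)

lemma clT_noFT_bound: "\<exists>N. clT N t \<and> noFT N t"
proof (induction t)
  case (V n)
  show ?case by (intro exI[of _ "Suc n"]) simp
next
  case (Ap f t)
  then obtain N where N: "clT N t" "noFT N t" by blast
  have "clT (max N (Suc f)) (Ap f t) \<and> noFT (max N (Suc f)) (Ap f t)"
    using clT_mono[OF N(1)] noFT_mono[OF N(2)] by (auto simp: less_max_iff_disj)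
  then show ?case by blast
qed

lemma closed_bound: "\<exists>N. closed N N N \<phi>"
proof -
  have A: "\<exists>N. closed N N N (Eq s t)" for s t
  proof -
    obtain N M where N: "clT N s" "noFT N s" "clT M t" "noFT M t" using clT_noFT_bound by blast
    then have "closed (max N M) (max N M) (max N M) (Eq s t)"
      using clT_mono noFT_mono by (metis closed.simps(2) max.cobounded1 max.cobounded2)
    then show ?thesis by blast
  qed
  show ?thesis
  proof (induction \<phi>)
    case (Mem s t)
    then show ?case using A[of s t] by simp
  next
    case (Eq s t)
    then show ?case using A by blast
  next
    case (PA p t)
    obtain N where N: "closed N N N (Eq t t)" using A by blast
    then have "closed (max N (Suc p)) (max N (Suc p)) (max N (Suc p)) (Eq t t)"
      using closed_mono by (meson max.cobounded1)
    then show ?case by (intro exI[of _ "max N (Suc p)"]) auto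
  next
    case Bot
    show ?case by simp
  next
    case (Imp \<phi> \<psi>)
    then obtain N M where "closed N N N \<phi>" "closed M M M \<psi>" by blast
    then have "closed (max N M) (max N M) (max N M) (Imp \<phi> \<psi>)"
      using closed_mono by (metis closed.simps(5) max.cobounded1 max.cobounded2)
    then show ?case by blast
  next
    case (All \<phi>)
    then show ?case using closed_mono by (metis closed.simps(6) lessI less_imp_le order_refl)
  next
    case (AllP \<phi>)
    then show ?case using closed_mono by (metis closed.simps(7) lessI less_imp_le order_refl)
  next
    case (AllF \<phi>)
    then show ?case using closed_mono by (metis closed.simps(8) lessI less_imp_le order_refl)
  qed
qed

lemma closed_bound_list: "\<exists>N. \<forall>\<delta>\<in>set \<Delta>. closed N N N \<delta>"
proof (induction \<Delta>)
  case (Cons d \<Delta>)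
  then obtain N M where "\<forall>\<delta>\<in>set \<Delta>. closed N N N \<delta>" "closed M M M d"
    using closed_bound by blast
  then have "\<forall>\<delta>\<in>set (d # \<Delta>). closed (max N M) (max N M) (max N M) \<delta>"
    using closed_mono by (metis max.cobounded1 max.cobounded2 set_ConsD)
  then show ?case by blast
qed simp

text \<open>The clauses are those of a truth definition. No Henkin constants occur: there are
  infinitely many variables of each sort, and fresh variables serve as witnesses.\<close>

definition henkin_set :: "fm set \<Rightarrow> fm set \<Rightarrow> bool" where
  "henkin_set \<Gamma> H \<longleftrightarrow> (\<forall>\<phi>. prv \<Gamma> \<phi> \<longrightarrow> \<phi> \<in> H) \<and> Bot \<notin> H
    \<and> (\<forall>a b. Imp a b \<in> H \<longleftrightarrow> (a \<in> H \<longrightarrow> b \<in> H))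
    \<and> (\<forall>\<phi>. All \<phi> \<in> H \<longleftrightarrow> (\<forall>t. subst 0 t \<phi> \<in> H))
    \<and> (\<forall>\<phi>. AllP \<phi> \<in> H \<longleftrightarrow> (\<forall>g. renP 0 g \<phi> \<in> H))
    \<and> (\<forall>\<phi>. AllF \<phi> \<in> H \<longleftrightarrow> (\<forall>g. renF 0 g \<phi> \<in> H))"

section \<open>Construction of a Henkin set by deciding all formulas in turn\<close>

instance trm :: countable by countable_datatype
instance fm :: countable by countable_datatype

definition decides :: "fm set \<Rightarrow> fm list \<Rightarrow> fm \<Rightarrow> bool" where
  "decides \<Gamma> \<Delta> \<chi> \<longleftrightarrow> (entails \<Gamma> \<Delta> \<chi> \<or> entails \<Gamma> \<Delta> (Not \<chi>))
    \<and> (\<forall>\<psi>. \<chi> = All \<psi> \<longrightarrow> entails \<Gamma> \<Delta> \<chi> \<or> (\<exists>t. entails \<Gamma> \<Delta> (Not (subst 0 t \<psi>))))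
    \<and> (\<forall>\<psi>. \<chi> = AllP \<psi> \<longrightarrow> entails \<Gamma> \<Delta> \<chi> \<or> (\<exists>g. entails \<Gamma> \<Delta> (Not (renP 0 g \<psi>))))
    \<and> (\<forall>\<psi>. \<chi> = AllF \<psi> \<longrightarrow> entails \<Gamma> \<Delta> \<chi> \<or> (\<exists>g. entails \<Gamma> \<Delta> (Not (renF 0 g \<psi>))))"

text \<open>If \<open>\<chi>\<close> is not derivable, one underivable consequence of it is negated:
  \<open>\<chi>\<close> itself, or its instance at a fresh variable when \<open>\<chi>\<close> is a
  quantification. This single hypothesis refutes \<open>\<chi>\<close>, provides the counterexample
  and keeps the list consistent.\<close>

lemma decide_step:
  assumes cl: "\<And>\<gamma>. \<gamma> \<in> \<Gamma> \<Longrightarrow> closed 0 0 0 \<gamma>" and con: "\<not> entails \<Gamma> \<Delta> Bot"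
  shows "\<exists>\<Delta>'. \<not> entails \<Gamma> \<Delta>' Bot \<and> set \<Delta> \<subseteq> set \<Delta>' \<and> decides \<Gamma> \<Delta>' \<chi>"
proof (cases "entails \<Gamma> \<Delta> \<chi>")
  case True
  then show ?thesis using con by (auto simp: decides_def)
next
  case False
  obtain c where c: "\<forall>\<delta>\<in>set (\<chi> # \<Delta>). closed c c c \<delta>" using closed_bound_list by blast
  have *: ?thesis
    if \<theta>: "\<not> entails \<Gamma> \<Delta> \<theta>" "entails \<Gamma> [\<chi>] \<theta>"
      "\<forall>\<psi>. \<chi> = All \<psi> \<longrightarrow> (\<exists>t. \<theta> = subst 0 t \<psi>)" "\<forall>\<psi>. \<chi> = AllP \<psi> \<longrightarrow> (\<exists>t. \<theta> = renP 0 t \<psi>)"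
      "\<forall>\<psi>. \<chi> = AllF \<psi> \<longrightarrow> (\<exists>t. \<theta> = renF 0 t \<psi>)" for \<theta>
  proof (intro exI conjI)
    let ?\<Delta> = "Not \<theta> # \<Delta>"
    show "\<not> entails \<Gamma> ?\<Delta> Bot" using \<theta>(1) entails_contr by blast
    show "set \<Delta> \<subseteq> set ?\<Delta>" by auto
    have n: "entails \<Gamma> ?\<Delta> (Not \<theta>)" by (simp add: entails_assm)
    have "entails \<Gamma> (\<chi> # ?\<Delta>) \<theta>" using entails_mono[OF \<theta>(2)] by simp
    moreover have "entails \<Gamma> (\<chi> # ?\<Delta>) (Not \<theta>)" by (simp add: entails_assm)
    ultimately have "entails \<Gamma> ?\<Delta> (Not \<chi>)" unfolding Not_def[of \<chi>] by (metis entails_absurd entails_impI)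
    then show "decides \<Gamma> ?\<Delta> \<chi>" using n \<theta>(3-5) unfolding decides_def by blast
  qed
  have 1: "entails \<Gamma> [\<chi>] \<chi>" by (simp add: entails_assm)
  note E = prv.AllE prv.AllPE prv.AllFE
  show ?thesis
  proof (cases \<chi>)
    case (All \<psi>)
    then have "\<not> entails \<Gamma> \<Delta> (subst 0 (V c) \<psi>)" using entails_AllI[of \<Gamma> \<Delta> c \<psi>] cl c False by auto
    moreover have "entails \<Gamma> [\<chi>] (subst 0 (V c) \<psi>)"
      using entails_MP[OF entails_prv[OF prv.AllE]] 1 All by blast
    ultimately show ?thesis using * All by blast
  next
    case (AllP \<psi>)
    then have "\<not> entails \<Gamma> \<Delta> (renP 0 c \<psi>)" using entails_AllPI[of \<Gamma> \<Delta> c \<psi>] cl c False by auto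
    moreover have "entails \<Gamma> [\<chi>] (renP 0 c \<psi>)"
      using entails_MP[OF entails_prv[OF prv.AllPE]] 1 AllP by blast
    ultimately show ?thesis using * AllP by blast
  next
    case (AllF \<psi>)
    then have "\<not> entails \<Gamma> \<Delta> (renF 0 c \<psi>)" using entails_AllFI[of \<Gamma> \<Delta> c \<psi>] cl c False by auto
    moreover have "entails \<Gamma> [\<chi>] (renF 0 c \<psi>)"
      using entails_MP[OF entails_prv[OF prv.AllFE]] 1 AllF by blast
    ultimately show ?thesis using * AllF by blast
  qed (use *[OF False 1] in auto)
qed

theorem henkin_set_exists:
  assumes cl: "\<And>\<gamma>. \<gamma> \<in> \<Gamma> \<Longrightarrow> closed 0 0 0 \<gamma>" and np: "\<not> prv \<Gamma> \<phi>"
  shows "\<exists>H. henkin_set \<Gamma> H \<and> \<phi> \<notin> H"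
proof -
  have con0: "\<not> entails \<Gamma> [Not \<phi>] Bot"
    using np entails_contr[of \<Gamma> \<phi> "[]"] by (auto simp: entails_def)
  have "\<exists>F. \<forall>n. (\<not> entails \<Gamma> (F n) Bot \<and> Not \<phi> \<in> set (F n)) \<and>
      (set (F n) \<subseteq> set (F (Suc n)) \<and> decides \<Gamma> (F (Suc n)) (from_nat n))"
  proof (rule dependent_nat_choice)
    show "\<exists>\<Delta>. \<not> entails \<Gamma> \<Delta> Bot \<and> Not \<phi> \<in> set \<Delta>"
      by (rule exI[of _ "[Not \<phi>]"]) (use con0 in auto)
    show "\<exists>\<Delta>'. (\<not> entails \<Gamma> \<Delta>' Bot \<and> Not \<phi> \<in> set \<Delta>') \<and> set \<Delta> \<subseteq> set \<Delta>' \<and> decides \<Gamma> \<Delta>' (from_nat n)"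
      if "\<not> entails \<Gamma> \<Delta> Bot \<and> Not \<phi> \<in> set \<Delta>" for \<Delta> n
      using decide_step[of \<Gamma> \<Delta> "from_nat n"] cl that by blast
  qed
  then obtain F where F: "\<And>n. \<not> entails \<Gamma> (F n) Bot" "\<And>n. Not \<phi> \<in> set (F n)"
    "\<And>n. set (F n) \<subseteq> set (F (Suc n))" "\<And>n. decides \<Gamma> (F (Suc n)) (from_nat n)" by blast
  define H where "H = {\<chi>. \<exists>n. entails \<Gamma> (F n) \<chi>}"
  have mono: "set (F n) \<subseteq> set (F m)" if "n \<le> m" for n m
    using that F(3) by (rule lift_Suc_mono_le[rotated])
  have dec: "\<exists>n. decides \<Gamma> (F n) \<chi>" for \<chi>
    using F(4)[of "to_nat \<chi>"] by auto
  have MP: "b \<in> H" if "Imp a b \<in> H" "a \<in> H" for a b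
  proof -
    obtain n m where "entails \<Gamma> (F n) (Imp a b)" "entails \<Gamma> (F m) a" using \<open>Imp a b \<in> H\<close> \<open>a \<in> H\<close> H_def by blast
    then have "entails \<Gamma> (F (max n m)) (Imp a b)" "entails \<Gamma> (F (max n m)) a"
      using mono entails_mono by (meson max.cobounded1 max.cobounded2)+
    then show ?thesis using entails_MP H_def by blast
  qed
  have prvH: "\<chi> \<in> H" if "prv \<Gamma> \<chi>" for \<chi>
    using that entails_prv H_def by blast
  have Bot: "Bot \<notin> H" using F(1) H_def by blast
  have neg: "Not \<chi> \<in> H \<longleftrightarrow> \<chi> \<notin> H" for \<chi>
    using dec[of \<chi>] MP[of \<chi> Bot] Bot unfolding decides_def Not_def[symmetric] H_def by blast
  have imp: "Imp a b \<in> H \<longleftrightarrow> (a \<in> H \<longrightarrow> b \<in> H)" for a b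
  proof
    assume R: "a \<in> H \<longrightarrow> b \<in> H"
    show "Imp a b \<in> H"
    proof (cases "a \<in> H")
      case True
      then show ?thesis using R MP prvH prv.K by metis
    next
      case False
      then have "Not a \<in> H" using neg by blast
      moreover have "entails \<Gamma> [Not a] (Imp a b)"
        by (rule entails_impI, rule entails_absurd[of _ _ a]) (auto intro: entails_assm)
      ultimately show ?thesis using MP prvH by (simp add: entails_def) blast
    qed
  qed (use MP in blast)
  have all: "All \<psi> \<in> H \<longleftrightarrow> (\<forall>t. subst 0 t \<psi> \<in> H)" for \<psi>
  proof
    assume "All \<psi> \<in> H"
    then show "\<forall>t. subst 0 t \<psi> \<in> H" using MP prvH prv.AllE by metis
  next
    assume "\<forall>t. subst 0 t \<psi> \<in> H"
    then have "\<not> (\<exists>n t. entails \<Gamma> (F n) (Not (subst 0 t \<psi>)))" using neg H_def by blast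
    then show "All \<psi> \<in> H" using dec[of "All \<psi>"] unfolding decides_def H_def by blast
  qed
  have allP: "AllP \<psi> \<in> H \<longleftrightarrow> (\<forall>t. renP 0 t \<psi> \<in> H)" for \<psi>
  proof
    assume "AllP \<psi> \<in> H"
    then show "\<forall>t. renP 0 t \<psi> \<in> H" using MP prvH prv.AllPE by metis
  next
    assume "\<forall>t. renP 0 t \<psi> \<in> H"
    then have "\<not> (\<exists>n t. entails \<Gamma> (F n) (Not (renP 0 t \<psi>)))" using neg H_def by blast
    then show "AllP \<psi> \<in> H" using dec[of "AllP \<psi>"] unfolding decides_def H_def by blast
  qed
  have allF: "AllF \<psi> \<in> H \<longleftrightarrow> (\<forall>t. renF 0 t \<psi> \<in> H)" for \<psi>
  proof
    assume "AllF \<psi> \<in> H"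
    then show "\<forall>t. renF 0 t \<psi> \<in> H" using MP prvH prv.AllFE by metis
  next
    assume "\<forall>t. renF 0 t \<psi> \<in> H"
    then have "\<not> (\<exists>n t. entails \<Gamma> (F n) (Not (renF 0 t \<psi>)))" using neg H_def by blast
    then show "AllF \<psi> \<in> H" using dec[of "AllF \<psi>"] unfolding decides_def H_def by blast
  qed
  have "\<phi> \<notin> H" using neg[of \<phi>] F(2)[of 0] entails_assm H_def by blast
  then show ?thesis
    unfolding henkin_set_def using prvH Bot imp all allP allF by blast
qed

section \<open>Henkin semantics and completeness\<close>

primrec tv :: "(nat \<Rightarrow> 'a) \<Rightarrow> (nat \<Rightarrow> 'a \<Rightarrow> 'a) \<Rightarrow> trm \<Rightarrow> 'a" where
  "tv e f (V n) = e n"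
| "tv e f (Ap g t) = f g (tv e f t)"

text \<open>Identity is interpreted by an arbitrary relation \<open>Q\<close>, so that the term model can be used before
  passing to the quotient: there one shows that the quotient is infinite, hence in bijection with
  the natural numbers.\<close>

primrec sat :: "('a \<Rightarrow> 'a \<Rightarrow> bool) \<Rightarrow> ('a \<Rightarrow> 'a \<Rightarrow> bool) \<Rightarrow> ('a \<Rightarrow> bool) set \<Rightarrow> ('a \<Rightarrow> 'a) set \<Rightarrow>
    (nat \<Rightarrow> 'a) \<Rightarrow> (nat \<Rightarrow> 'a \<Rightarrow> bool) \<Rightarrow> (nat \<Rightarrow> 'a \<Rightarrow> 'a) \<Rightarrow> fm \<Rightarrow> bool" where
  "sat Q E PP FF e p f (Mem s t) = E (tv e f s) (tv e f t)"
| "sat Q E PP FF e p f (Eq s t) = Q (tv e f s) (tv e f t)"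
| "sat Q E PP FF e p f (PA i t) = p i (tv e f t)"
| "sat Q E PP FF e p f Bot = False"
| "sat Q E PP FF e p f (Imp \<phi> \<psi>) = (sat Q E PP FF e p f \<phi> \<longrightarrow> sat Q E PP FF e p f \<psi>)"
| "sat Q E PP FF e p f (All \<phi>) = (\<forall>x. sat Q E PP FF (scons x e) p f \<phi>)"
| "sat Q E PP FF e p f (AllP \<phi>) = (\<forall>X\<in>PP. sat Q E PP FF e (scons X p) f \<phi>)"
| "sat Q E PP FF e p f (AllF \<phi>) = (\<forall>g\<in>FF. sat Q E PP FF e p (scons g f) \<phi>)"

lemma sat_derived [simp]:
  "sat Q E PP FF e p f (Not \<phi>) = (\<not> sat Q E PP FF e p f \<phi>)"
  "sat Q E PP FF e p f (And \<phi> \<psi>) = (sat Q E PP FF e p f \<phi> \<and> sat Q E PP FF e p f \<psi>)"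
  "sat Q E PP FF e p f (Iff \<phi> \<psi>) = (sat Q E PP FF e p f \<phi> \<longleftrightarrow> sat Q E PP FF e p f \<psi>)"
  "sat Q E PP FF e p f (Ex \<phi>) = (\<exists>x. sat Q E PP FF (scons x e) p f \<phi>)"
  "sat Q E PP FF e p f (ExP \<phi>) = (\<exists>X\<in>PP. sat Q E PP FF e (scons X p) f \<phi>)"
  "sat Q E PP FF e p f (ExF \<phi>) = (\<exists>g\<in>FF. sat Q E PP FF e p (scons g f) \<phi>)"
  by (auto simp: Not_def And_def Iff_def Ex_def ExP_def ExF_def)

lemma tv_sbT: "tv e f (sbT \<sigma> \<rho> t) = tv (\<lambda>n. tv e f (\<sigma> n)) (\<lambda>n. f (\<rho> n)) t"
  by (induction t) auto

lemma tv_liftT: "tv (scons x e) f (liftT 0 t) = tv e f t"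
  by (induction t) auto

lemma tv_liftFT: "tv e (scons g f) (liftFT 0 t) = tv e f t"
  by (induction t) auto

lemma scons_upT: "(\<lambda>n. tv (scons x e) f (upT \<sigma> n)) = scons x (\<lambda>n. tv e f (\<sigma> n))"
  by (rule ext) (simp add: upT_def tv_liftT split: nat.split)

lemma scons_upN: "(\<lambda>n. scons x e (upN \<rho> n)) = scons x (\<lambda>n. e (\<rho> n))"
  by (auto simp: fun_eq_iff upN_def scons_def split: nat.splits)

lemma sat_sb: "sat Q E PP FF e p f (sb \<sigma> \<pi> \<rho> \<phi>) =
    sat Q E PP FF (\<lambda>n. tv e f (\<sigma> n)) (\<lambda>n. p (\<pi> n)) (\<lambda>n. f (\<rho> n)) \<phi>"
  by (induction \<phi> arbitrary: e p f \<sigma> \<pi> \<rho>) (simp_all add: tv_sbT scons_upT scons_upN tv_liftFT)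

lemma sat_subst0: "sat Q E PP FF e p f (subst 0 t \<phi>) = sat Q E PP FF (scons (tv e f t) e) p f \<phi>"
proof -
  have "(\<lambda>n. tv e f (scons t V n)) = scons (tv e f t) e"
    by (auto simp: fun_eq_iff scons_def split: nat.splits)
  then show ?thesis by (simp add: subst_sb sat_sb)
qed

lemma sat_liftP0: "sat Q E PP FF e (scons X p) f (liftP 0 \<phi>) = sat Q E PP FF e p f \<phi>"
  by (simp add: liftP_sb sat_sb)

lemma sat_liftF0: "sat Q E PP FF e p (scons g f) (liftF 0 \<phi>) = sat Q E PP FF e p f \<phi>"
  by (simp add: liftF_sb sat_sb)

lemma sat_lift1: "sat Q E PP FF (scons x (scons y e)) p f (lift 1 \<phi>) = sat Q E PP FF (scons x e) p f \<phi>"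
proof -
  have "(\<lambda>n. tv (scons x (scons y e)) f (V (shiftV (Suc 0) n))) = scons x e"
    by (auto simp: fun_eq_iff scons_def shiftV_def split: nat.splits)
  then show ?thesis by (simp add: lift_sb sat_sb)
qed

text \<open>Being a model means truth of all theorems in all environments drawn from
  \<open>PP\<close> and \<open>FF\<close>. Closure of \<open>PP\<close> and \<open>FF\<close> under
  definability is contained in this, as the truth of the comprehension axioms.\<close>

definition hmodel :: "fm set \<Rightarrow> ('a \<Rightarrow> 'a \<Rightarrow> bool) \<Rightarrow> ('a \<Rightarrow> 'a \<Rightarrow> bool) \<Rightarrow> ('a \<Rightarrow> bool) set \<Rightarrow> ('a \<Rightarrow> 'a) set \<Rightarrow> bool" where
  "hmodel \<Gamma> Q E PP FF \<longleftrightarrow> PP \<noteq> {} \<and> FF \<noteq> {} \<and>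
    (\<forall>\<phi> e p f. prv \<Gamma> \<phi> \<longrightarrow> range p \<subseteq> PP \<longrightarrow> range f \<subseteq> FF \<longrightarrow> sat Q E PP FF e p f \<phi>)"

lemma scons_o: "scons (k t) (\<lambda>n. k (s n)) = (\<lambda>n. k (scons t s n))"
  by (rule ext) (simp add: scons_def split: nat.split)

text \<open>The map \<open>cls\<close> is left abstract so that one induction serves both the term
  model, where it is the identity, and the model on numbers, where it numbers the classes of terms
  that \<open>H\<close> equates.\<close>

lemma truth:
  fixes cls :: "trm \<Rightarrow> 'a"
  assumes H: "henkin_set \<Gamma> H" and sj: "surj cls"
    and Q: "\<And>t u. Q (cls t) (cls u) \<longleftrightarrow> Eq t u \<in> H"
    and E: "\<And>t u. E (cls t) (cls u) \<longleftrightarrow> Mem t u \<in> H"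
    and pv: "\<And>(g :: nat) t. pv g (cls t) \<longleftrightarrow> PA g t \<in> H"
    and fv: "\<And>(g :: nat) t. fv g (cls t) = cls (Ap g t)"
  shows "sat Q E (range pv) (range fv) (\<lambda>n. cls (\<sigma> n)) (\<lambda>n. pv (\<pi> n)) (\<lambda>n. fv (\<rho> n)) \<phi> \<longleftrightarrow> sb \<sigma> \<pi> \<rho> \<phi> \<in> H"
proof -
  have T: "tv (\<lambda>n. cls (\<sigma> n)) (\<lambda>n. fv (\<rho> n)) t = cls (sbT \<sigma> \<rho> t)" for t and \<sigma> :: "nat \<Rightarrow> trm" and \<rho> :: "nat \<Rightarrow> nat"
    by (induction t) (auto simp: fv)
  have ex: "(\<forall>x. P x) \<longleftrightarrow> (\<forall>t. P (cls t))" for P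
    using sj by (metis surjD)
  show ?thesis
  proof (induction \<phi> arbitrary: \<sigma> \<pi> \<rho>)
    case Bot
    show ?case using H by (simp add: henkin_set_def)
  next
    case (Imp a b)
    then show ?case using H by (simp add: henkin_set_def)
  next
    case (All \<phi>)
    have "(All (sb (upT \<sigma>) \<pi> \<rho> \<phi>) \<in> H) = (\<forall>t. sb (scons t \<sigma>) \<pi> \<rho> \<phi> \<in> H)"
      using H by (simp add: henkin_set_def subst0_sb_up)
    then show ?case by (simp add: ex scons_o[of cls] All)
  next
    case (AllP \<phi>)
    have "(AllP (sb \<sigma> (upN \<pi>) \<rho> \<phi>) \<in> H) = (\<forall>t. sb \<sigma> (scons t \<pi>) \<rho> \<phi> \<in> H)"
      using H by (simp add: henkin_set_def renP0_sb_up)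
    then show ?case by (simp add: scons_o[of pv] AllP)
  next
    case (AllF \<phi>)
    have "(AllF (sb (\<lambda>n. liftFT 0 (\<sigma> n)) \<pi> (upN \<rho>) \<phi>) \<in> H) = (\<forall>t. sb \<sigma> \<pi> (scons t \<rho>) \<phi> \<in> H)"
      using H by (simp add: henkin_set_def renF0_sb_up)
    then show ?case by (simp add: scons_o[of fv] AllF)
  qed (simp_all add: T Q E pv)
qed

text \<open>Surjectivity writes every environment as a substitution, and a Henkin set contains the
  substitution instances of a theorem because they are theorems.\<close>

lemma truth_hmodel:
  fixes cls :: "trm \<Rightarrow> 'a" and pv :: "nat \<Rightarrow> 'a \<Rightarrow> bool" and fv :: "nat \<Rightarrow> 'a \<Rightarrow> 'a"
  assumes cl: "\<And>\<gamma>. \<gamma> \<in> \<Gamma> \<Longrightarrow> closed 0 0 0 \<gamma>" and H: "henkin_set \<Gamma> H" and sj: "surj cls"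
    and tr: "\<And>\<sigma> (\<pi> :: nat \<Rightarrow> nat) (\<rho> :: nat \<Rightarrow> nat) \<phi>. sat Q E (range pv) (range fv) (\<lambda>n. cls (\<sigma> n)) (\<lambda>n. pv (\<pi> n)) (\<lambda>n. fv (\<rho> n)) \<phi> \<longleftrightarrow> sb \<sigma> \<pi> \<rho> \<phi> \<in> H"
  shows "hmodel \<Gamma> Q E (range pv) (range fv)"
  unfolding hmodel_def
proof (intro conjI allI impI)
  fix \<phi> and e :: "nat \<Rightarrow> 'a" and p :: "nat \<Rightarrow> 'a \<Rightarrow> bool" and f :: "nat \<Rightarrow> 'a \<Rightarrow> 'a"
  assume pr: "prv \<Gamma> \<phi>" and p: "range p \<subseteq> range pv" and f: "range f \<subseteq> range fv"
  have "\<exists>\<sigma>. e = (\<lambda>n. cls (\<sigma> n))" using sj by (intro exI[of _ "\<lambda>n. inv cls (e n)"]) (simp add: surj_f_inv_f)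
  moreover have "\<exists>\<pi>. p = (\<lambda>n. pv (\<pi> n))" using p by (intro exI[of _ "\<lambda>n. inv pv (p n)"]) (auto simp: f_inv_into_f image_subset_iff)
  moreover have "\<exists>\<rho>. f = (\<lambda>n. fv (\<rho> n))" using f by (intro exI[of _ "\<lambda>n. inv fv (f n)"]) (auto simp: f_inv_into_f image_subset_iff)
  ultimately obtain \<sigma> \<pi> \<rho> where "e = (\<lambda>n. cls (\<sigma> n))" "p = (\<lambda>n. pv (\<pi> n))" "f = (\<lambda>n. fv (\<rho> n))" by blast
  moreover have "sb \<sigma> \<pi> \<rho> \<phi> \<in> H" using prv_sb[OF pr] cl H unfolding henkin_set_def by meson
  ultimately show "sat Q E (range pv) (range fv) e p f \<phi>" using tr by blast
qed auto

lemma henkin_set_eq: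
  assumes "henkin_set \<Gamma> H" "Eq t u \<in> H" "subst 0 t \<phi> \<in> H"
  shows "subst 0 u \<phi> \<in> H"
  using assms prv.Leib[of \<Gamma> t u \<phi>] unfolding henkin_set_def by metis

lemma substT_liftT [simp]: "substT 0 u (liftT 0 t) = t"
  by (induction t) auto

text \<open>A finite model would not fit on \<open>nat\<close>. Hence \<open>inf\<close> is applied
  to the term model with identity read as \<open>Eq t u \<in> H\<close>: there are infinitely many
  classes, and only countably many terms, so the quotient can be numbered.\<close>

theorem completeness:
  assumes cl: "\<And>\<gamma>. \<gamma> \<in> \<Gamma> \<Longrightarrow> closed 0 0 0 \<gamma>"
    and inf: "\<And>Q E PP FF. hmodel \<Gamma> Q E PP FF \<Longrightarrow> \<exists>s :: nat \<Rightarrow> trm. \<forall>j. \<forall>i<j. \<not> Q (s i) (s j)"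
    and val: "\<And>(E :: nat \<Rightarrow> nat \<Rightarrow> bool) PP FF e p f. hmodel \<Gamma> (=) E PP FF \<Longrightarrow>
      range p \<subseteq> PP \<Longrightarrow> range f \<subseteq> FF \<Longrightarrow> sat (=) E PP FF e p f \<phi>"
  shows "prv \<Gamma> \<phi>"
proof (rule ccontr)
  assume "\<not> prv \<Gamma> \<phi>"
  then obtain H where H: "henkin_set \<Gamma> H" "\<phi> \<notin> H" using henkin_set_exists[of \<Gamma> \<phi>] cl by blast
  note eq = henkin_set_eq[OF H(1)]
  have refl: "Eq t t \<in> H" for t using H(1) prv.Refl[of \<Gamma> t] by (simp add: henkin_set_def)
  have sym: "Eq u t \<in> H" if "Eq t u \<in> H" for t u
    using eq[OF that, of "Eq (V 0) (liftT 0 t)"] refl by simp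
  have trans: "Eq t v \<in> H" if "Eq t u \<in> H" "Eq u v \<in> H" for t u v
    using eq[OF that(2), of "Eq (liftT 0 t) (V 0)"] that(1) by simp
  have m1: "Mem u v \<in> H" if "Eq t u \<in> H" "Mem t v \<in> H" for t u v
    using eq[OF that(1), of "Mem (V 0) (liftT 0 v)"] that(2) by simp
  have m2: "Mem v u \<in> H" if "Eq t u \<in> H" "Mem v t \<in> H" for t u v
    using eq[OF that(1), of "Mem (liftT 0 v) (V 0)"] that(2) by simp
  have pa: "PA g u \<in> H" if "Eq t u \<in> H" "PA g t \<in> H" for t u g
    using eq[OF that(1), of "PA g (V 0)"] that(2) by simp
  have ap: "Eq (Ap g t) (Ap g u) \<in> H" if "Eq t u \<in> H" for t u g
    using eq[OF that(1), of "Eq (liftT 0 (Ap g t)) (Ap g (V 0))"] refl by simp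
  let ?Q = "\<lambda>t u. Eq t u \<in> H"
  let ?E = "\<lambda>t u. Mem t u \<in> H" and ?p = "\<lambda>g t. PA g t \<in> H"
  have tr0: "sat ?Q ?E (range ?p) (range Ap) (\<lambda>n. id (\<sigma> n)) (\<lambda>n. ?p (\<pi> n)) (\<lambda>n. Ap (\<rho> n)) \<phi> \<longleftrightarrow> sb \<sigma> \<pi> \<rho> \<phi> \<in> H" for \<sigma> :: "nat \<Rightarrow> trm" and \<pi> \<rho> \<phi>
    by (rule truth[OF H(1), of id]) auto
  have "hmodel \<Gamma> ?Q ?E (range ?p) (range Ap)"
    by (rule truth_hmodel[OF cl H(1) _ tr0]) auto
  then have "\<exists>s :: nat \<Rightarrow> trm. \<forall>j. \<forall>i<j. Eq (s i) (s j) \<notin> H" by (rule inf)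
  then obtain s :: "nat \<Rightarrow> trm" where s': "\<forall>j. \<forall>i<j. Eq (s i) (s j) \<notin> H" ..
  then have s: "Eq (s i) (s j) \<notin> H" if "i < j" for i j using that by simp
  define R where "R = {(t, u). Eq t u \<in> H}"
  have R: "equiv UNIV R"
  proof (rule equivI)
    show "refl R" using refl by (simp add: refl_on_def R_def)
    show "Relation.sym R" using sym by (simp add: sym_def R_def)
    show "Relation.trans R" using trans unfolding trans_def R_def by fast
  qed simp
  have "inj (\<lambda>i. R `` {s i})"
  proof (rule injI)
    fix i j assume "R `` {s i} = R `` {s j}"
    then have "(s i, s j) \<in> R" using eq_equiv_class[OF _ R] by blast
    then show "i = j" using s sym unfolding R_def by (metis case_prodD linorder_neqE_nat mem_Collect_eq)
  qed
  then have "infinite (range (\<lambda>i. R `` {s i}))" using finite_imageD by blast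
  moreover have "range (\<lambda>i. R `` {s i}) \<subseteq> UNIV // R" by (auto intro: quotientI)
  ultimately have inf': "infinite (UNIV // R)" using infinite_super by blast
  have "UNIV // R = range (\<lambda>t. R `` {t})" by (auto simp: quotient_def)
  then have "countable (UNIV // R)" by simp
  then have bij: "bij_betw (to_nat_on (UNIV // R)) (UNIV // R) UNIV" using inf' by (rule to_nat_on_infinite)
  define cls where "cls t = to_nat_on (UNIV // R) (R `` {t})" for t
  have cls_eq: "cls t = cls u \<longleftrightarrow> Eq t u \<in> H" for t u
  proof -
    have "cls t = cls u \<longleftrightarrow> R `` {t} = R `` {u}"
      unfolding cls_def using bij_betw_imp_inj_on[OF bij] by (metis UNIV_I inj_onD quotientI)
    also have "\<dots> \<longleftrightarrow> (t, u) \<in> R" using eq_equiv_class_iff[OF R] by blast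
    finally show ?thesis by (simp add: R_def)
  qed
  have sj: "surj cls"
  proof (rule surjI)
    fix n
    have "to_nat_on (UNIV // R) (inv_into (UNIV // R) (to_nat_on (UNIV // R)) n) = n"
      "inv_into (UNIV // R) (to_nat_on (UNIV // R)) n \<in> UNIV // R"
      using bij by (auto simp: bij_betw_def f_inv_into_f inv_into_into)
    then show "cls (SOME t. cls t = n) = n"
      by (intro someI_ex[of "\<lambda>t. cls t = n"]) (auto simp: cls_def quotient_def)
  qed
  define r where "r = inv cls"
  have r: "Eq (r (cls t)) t \<in> H" for t
    using cls_eq sj unfolding r_def by (metis surj_f_inv_f)
  define E where "E m n \<longleftrightarrow> Mem (r m) (r n) \<in> H" for m n
  define pv where "pv g m \<longleftrightarrow> PA g (r m) \<in> H" for g m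
  define fv where "fv g m = cls (Ap g (r m))" for g m
  have tr: "sat (=) E (range pv) (range fv) (\<lambda>n. cls (\<sigma> n)) (\<lambda>n. pv (\<pi> n)) (\<lambda>n. fv (\<rho> n)) \<phi> \<longleftrightarrow> sb \<sigma> \<pi> \<rho> \<phi> \<in> H" for \<sigma> :: "nat \<Rightarrow> trm" and \<pi> \<rho> \<phi>
  proof (rule truth[OF H(1) sj cls_eq])
    show "E (cls t) (cls u) \<longleftrightarrow> Mem t u \<in> H" for t u
      unfolding E_def using r[of t] r[of u] m1 m2 sym by blast
    show "pv g (cls t) \<longleftrightarrow> PA g t \<in> H" for g t
      unfolding pv_def using r[of t] pa sym by blast
    show "fv g (cls t) = cls (Ap g t)" for g t
      unfolding fv_def cls_eq using ap r by blast
  qed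
  have "hmodel \<Gamma> (=) E (range pv) (range fv)"
    by (rule truth_hmodel[OF cl H(1) sj tr]) auto
  then have "sat (=) E (range pv) (range fv) (\<lambda>n. cls (V n)) (\<lambda>n. pv n) (\<lambda>n. fv n) \<phi>"
    by (rule val) auto
  then have "sb V (\<lambda>n. n) (\<lambda>n. n) \<phi> \<in> H"
    using tr[of V "\<lambda>n. n" "\<lambda>n. n" \<phi>] by simp
  then show False using H(2) by (simp add: sb_id)
qed

text \<open>Objects, predicates and functions are the same before and after, so a translation is
  true in \<open>E\<close> iff the original is true of the relation that the translating formula
  defines from \<open>E\<close>.\<close>

lemma sat_tr:
  assumes J: "\<And>E e p f. sat (=) E PP FF e p f J = j E (e 0) (e 1)"
  shows "sat (=) E PP FF e p f (tr J \<phi>) = sat (=) (j E) PP FF e p f \<phi>"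
proof (induction \<phi> arbitrary: e p f)
  case (Mem s t)
  have *: "inst2 J u v = sb (scons u (scons v V)) (\<lambda>n. n) (\<lambda>n. n) J" for u v
    unfolding inst2_def subst_sb sb_comp
    by (rule sb_ext) (auto simp: fun_eq_iff instV_def scons_def sbT_liftT sbT_V split: nat.splits)
  then show ?case by (simp add: sat_sb J)
qed auto

text \<open>By completeness everything reduces to normal models on the numbers. The two
  biconditionals become literal equalities of relations, \<open>i (j E) = E\<close> and
  \<open>j (i E) = E\<close>, over unchanged classes of predicates and functions.\<close>

theorem defeq_semantic:
  assumes cS: "\<And>\<gamma>. \<gamma> \<in> S \<Longrightarrow> closed 0 0 0 \<gamma>" and cT: "\<And>\<gamma>. \<gamma> \<in> T \<Longrightarrow> closed 0 0 0 \<gamma>"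
    and iS: "\<And>Q E PP FF. hmodel S Q E PP FF \<Longrightarrow> \<exists>s :: nat \<Rightarrow> trm. \<forall>j. \<forall>i<j. \<not> Q (s i) (s j)"
    and iT: "\<And>Q E PP FF. hmodel T Q E PP FF \<Longrightarrow> \<exists>s :: nat \<Rightarrow> trm. \<forall>j. \<forall>i<j. \<not> Q (s i) (s j)"
    and I: "interp I" "\<And>(E :: nat \<Rightarrow> nat \<Rightarrow> bool) PP FF e p f. sat (=) E PP FF e p f I = i E (e 0) (e 1)"
    and J: "interp J" "\<And>(E :: nat \<Rightarrow> nat \<Rightarrow> bool) PP FF e p f. sat (=) E PP FF e p f J = j E (e 0) (e 1)"
    and TS: "\<And>(E :: nat \<Rightarrow> nat \<Rightarrow> bool) PP FF e p f \<alpha>. hmodel T (=) E PP FF \<Longrightarrow> \<alpha> \<in> S \<Longrightarrow> sat (=) (i E) PP FF e p f \<alpha>"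
    and ST: "\<And>(E :: nat \<Rightarrow> nat \<Rightarrow> bool) PP FF e p f \<alpha>. hmodel S (=) E PP FF \<Longrightarrow> \<alpha> \<in> T \<Longrightarrow> sat (=) (j E) PP FF e p f \<alpha>"
    and ij: "\<And>(E :: nat \<Rightarrow> nat \<Rightarrow> bool) PP FF. hmodel S (=) E PP FF \<Longrightarrow> i (j E) = E"
    and ji: "\<And>(E :: nat \<Rightarrow> nat \<Rightarrow> bool) PP FF. hmodel T (=) E PP FF \<Longrightarrow> j (i E) = E"
  shows "defeq S T"
  unfolding defeq_def
proof (rule exI[of _ I], rule exI[of _ J], intro conjI allI impI)
  note trI = sat_tr[of _ _ I i, OF I(2)] and trJ = sat_tr[of _ _ J j, OF J(2)]
  show "interp I" "interp J" by fact+
  have 1: "prv T (tr I \<alpha>)" if "\<alpha> \<in> S" for \<alpha>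
  proof (rule completeness)
    show "sat (=) E PP FF e p f (tr I \<alpha>)" if "hmodel T (=) E PP FF" for E :: "nat \<Rightarrow> nat \<Rightarrow> bool" and PP FF e p f
      unfolding trI by (rule TS) fact+
  qed (use cT iT in auto)
  have 2: "prv S (tr J \<alpha>)" if "\<alpha> \<in> T" for \<alpha>
  proof (rule completeness)
    show "sat (=) E PP FF e p f (tr J \<alpha>)" if "hmodel S (=) E PP FF" for E :: "nat \<Rightarrow> nat \<Rightarrow> bool" and PP FF e p f
      unfolding trJ by (rule ST) fact+
  qed (use cS iS in auto)
  show "prv T (tr I \<phi>)" if "prv S \<phi>" for \<phi>
    using prv_tr[OF that I(1) 1] .
  show "prv S (tr J \<phi>)" if "prv T \<phi>" for \<phi>
    using prv_tr[OF that J(1) 2] .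
  show "prv S (Iff \<phi> (tr J (tr I \<phi>)))" for \<phi>
  proof (rule completeness)
    show "sat (=) E PP FF e p f (Iff \<phi> (tr J (tr I \<phi>)))" if "hmodel S (=) E PP FF" for E :: "nat \<Rightarrow> nat \<Rightarrow> bool" and PP FF e p f
      using ij[OF that] by (simp add: trI trJ)
  qed (use cS iS in auto)
  show "prv T (Iff \<phi> (tr I (tr J \<phi>)))" for \<phi>
  proof (rule completeness)
    show "sat (=) E PP FF e p f (Iff \<phi> (tr I (tr J \<phi>)))" if "hmodel T (=) E PP FF" for E :: "nat \<Rightarrow> nat \<Rightarrow> bool" and PP FF e p f
      using ji[OF that] by (simp add: trI trJ)
  qed (use cT iT in auto)
qed

section \<open>Abstract level theory\<close>

text \<open>Ordinary level theory is the case where \<open>m\<close> is membership and \<open>lo\<close> is always true. In boolean level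
  theory \<open>lo y\<close> means \<open>y \<notin> y\<close>, and \<open>m x y\<close> means membership of \<open>x\<close> in the low one of \<open>y\<close> and its
  complement; then \<open>x \<subseteq> c\<close> or \<open>-x \<subseteq> c\<close>, for low \<open>c\<close>, is \<open>gsub m x c\<close>.\<close>

definition gsub :: "('a \<Rightarrow> 'a \<Rightarrow> bool) \<Rightarrow> 'a \<Rightarrow> 'a \<Rightarrow> bool" where
  "gsub m x y \<longleftrightarrow> (\<forall>z. m z x \<longrightarrow> m z y)"

text \<open>Lowness of the members is built in here. The definition of boolean histories does not
  demand it, and there it has to be derived, in \<open>bhistS_low\<close>.\<close>

definition ghist :: "('a \<Rightarrow> 'a \<Rightarrow> bool) \<Rightarrow> ('a \<Rightarrow> bool) \<Rightarrow> 'a \<Rightarrow> bool" where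
  "ghist m lo h \<longleftrightarrow> lo h \<and> (\<forall>x. m x h \<longrightarrow> lo x \<and>
     (\<forall>y. m y x \<longleftrightarrow> (\<exists>z. lo z \<and> gsub m y z \<and> m z x \<and> m z h)))"

definition glev :: "('a \<Rightarrow> 'a \<Rightarrow> bool) \<Rightarrow> ('a \<Rightarrow> bool) \<Rightarrow> 'a \<Rightarrow> bool" where
  "glev m lo s \<longleftrightarrow> lo s \<and> (\<exists>h. ghist m lo h \<and> (\<forall>y. m y s \<longleftrightarrow> (\<exists>c. lo c \<and> gsub m y c \<and> m c h)))"

text \<open>Vacuously true of the lowest level, which is therefore treated together with the limits;
  statements about infinity add the existence of a level inside.\<close>

definition glim :: "('a \<Rightarrow> 'a \<Rightarrow> bool) \<Rightarrow> ('a \<Rightarrow> bool) \<Rightarrow> 'a \<Rightarrow> bool" where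
  "glim m lo s \<longleftrightarrow> glev m lo s \<and> (\<forall>r. glev m lo r \<and> m r s \<longrightarrow> (\<exists>t. glev m lo t \<and> m r t \<and> m t s))"

lemma gsub_refl [simp]: "gsub m x x"
  by (simp add: gsub_def)

lemma gsub_trans: "gsub m x y \<Longrightarrow> gsub m y z \<Longrightarrow> gsub m x z"
  by (simp add: gsub_def)

lemma gsubD: "gsub m x y \<Longrightarrow> m z x \<Longrightarrow> m z y"
  by (simp add: gsub_def)

text \<open>\<open>DD R\<close>: the relation \<open>R\<close> of an environment is definable with parameters. \<open>TT t\<close>: so is the term \<open>t\<close>.
  Quantification is expressed through de Bruijn environments, which lets \<open>intro\<close> prove definability.\<close>

locale definability =
  fixes DD :: "((nat \<Rightarrow> 'a) \<Rightarrow> bool) \<Rightarrow> bool" and TT :: "((nat \<Rightarrow> 'a) \<Rightarrow> 'a) \<Rightarrow> bool"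
  assumes TT_var: "TT (\<lambda>e. e i)"
    and TT_const: "TT (\<lambda>e. c)"
    and TT_shift: "TT t \<Longrightarrow> TT (\<lambda>e. t (\<lambda>i. e (Suc i)))"
    and DD_eq: "TT t \<Longrightarrow> TT u \<Longrightarrow> DD (\<lambda>e. t e = u e)"
    and DD_not: "DD R \<Longrightarrow> DD (\<lambda>e. \<not> R e)"
    and DD_imp: "DD R \<Longrightarrow> DD R' \<Longrightarrow> DD (\<lambda>e. R e \<longrightarrow> R' e)"
    and DD_all: "DD (\<lambda>e. Q (e 0) (\<lambda>i. e (Suc i))) \<Longrightarrow> DD (\<lambda>e. \<forall>x. Q x e)"
begin

lemma DD_conj: "DD R \<Longrightarrow> DD R' \<Longrightarrow> DD (\<lambda>e. R e \<and> R' e)"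
  using DD_not[OF DD_imp[OF _ DD_not]] by force

lemma DD_disj: "DD R \<Longrightarrow> DD R' \<Longrightarrow> DD (\<lambda>e. R e \<or> R' e)"
  using DD_imp[OF DD_not] by (simp add: imp_conv_disj)

lemma DD_iff: "DD R \<Longrightarrow> DD R' \<Longrightarrow> DD (\<lambda>e. R e = R' e)"
  using DD_conj[OF DD_imp DD_imp, of R R' R' R] by (simp add: iff_conv_conj_imp)

lemma DD_ex: "DD (\<lambda>e. Q (e 0) (\<lambda>i. e (Suc i))) \<Longrightarrow> DD (\<lambda>e. \<exists>x. Q x e)"
  using DD_not[OF DD_all[of "\<lambda>x e. \<not> Q x e"], OF DD_not] by simp

text \<open>Closure under substitution of a term is derived from an existential quantifier and an
  equation.\<close>

lemma DD_sub1: "DD (\<lambda>e. Q (e 0)) \<Longrightarrow> TT t \<Longrightarrow> DD (\<lambda>e. Q (t e))"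
proof -
  assume D: "DD (\<lambda>e. Q (e 0))" and t: "TT t"
  have "DD (\<lambda>e. \<exists>x. x = t e \<and> Q x)"
    by (intro DD_ex DD_conj DD_eq TT_var D TT_shift[OF t])
  then show ?thesis by simp
qed

lemma DD_sub2: "DD (\<lambda>e. Q (e 0) (e (Suc 0))) \<Longrightarrow> TT t \<Longrightarrow> TT u \<Longrightarrow> DD (\<lambda>e. Q (t e) (u e))"
proof -
  assume D: "DD (\<lambda>e. Q (e 0) (e (Suc 0)))" and t: "TT t" and u: "TT u"
  have "DD (\<lambda>e. \<exists>y. y = u e \<and> (\<exists>x. x = t e \<and> Q x y))"
    by (intro DD_ex DD_conj DD_eq TT_var D TT_shift[OF u] TT_shift[OF TT_shift[OF t]])
  then show ?thesis by simp
qed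

lemmas dd = DD_eq DD_not DD_imp DD_all DD_conj DD_disj DD_iff DD_ex TT_var TT_const

end

locale level_theory = definability DD TT for DD :: "((nat \<Rightarrow> 'a) \<Rightarrow> bool) \<Rightarrow> bool" and TT +
  fixes m :: "'a \<Rightarrow> 'a \<Rightarrow> bool" and lo :: "'a \<Rightarrow> bool"
  assumes DD_m: "TT t \<Longrightarrow> TT u \<Longrightarrow> DD (\<lambda>e. m (t e) (u e))"
    and DD_lo: "TT t \<Longrightarrow> DD (\<lambda>e. lo (t e))"
    and ext: "lo x \<Longrightarrow> lo y \<Longrightarrow> (\<And>z. m z x = m z y) \<Longrightarrow> x = y"
    and sep: "DD (\<lambda>e. Q (e 0)) \<Longrightarrow> \<exists>b. lo b \<and> (\<forall>x. m x b \<longleftrightarrow> m x a \<and> Q x)"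
begin

abbreviation "sub \<equiv> gsub m"
abbreviation "histo \<equiv> ghist m lo"
abbreviation "levl \<equiv> glev m lo"

lemma DD_sub: "TT t \<Longrightarrow> TT u \<Longrightarrow> DD (\<lambda>e. sub (t e) (u e))"
  by (rule DD_sub2) (unfold gsub_def, intro dd DD_m)

lemma DD_histo: "TT t \<Longrightarrow> DD (\<lambda>e. histo (t e))"
  by (rule DD_sub1) (unfold ghist_def, intro dd DD_m DD_lo DD_sub)

lemma DD_levl: "TT t \<Longrightarrow> DD (\<lambda>e. levl (t e))"
  by (rule DD_sub1) (unfold glev_def, intro dd DD_m DD_lo DD_sub DD_histo)

lemmas ddl = dd DD_m DD_lo DD_sub DD_levl

lemma DD_glim: "TT t \<Longrightarrow> DD (\<lambda>e. glim m lo (t e))"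
  by (rule DD_sub1) (unfold glim_def, intro ddl)

lemma hist_lo: "histo h \<Longrightarrow> m c h \<Longrightarrow> lo c"
  unfolding ghist_def by blast

lemma hist_mem: "histo h \<Longrightarrow> m c h \<Longrightarrow> m y c \<longleftrightarrow> (\<exists>z. lo z \<and> sub y z \<and> m z c \<and> m z h)"
  unfolding ghist_def by blast

lemma hist_memD: "histo h \<Longrightarrow> m c h \<Longrightarrow> m y c \<Longrightarrow> \<exists>z. lo z \<and> sub y z \<and> m z c \<and> m z h"
  using hist_mem by metis

lemma hist_memI: "histo h \<Longrightarrow> m c h \<Longrightarrow> sub y z \<Longrightarrow> m z c \<Longrightarrow> m z h \<Longrightarrow> m y c"
  using hist_mem hist_lo by metis

text \<open>A Russell argument: without a minimal element, the non-self-membered part of the intersection of the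
  class would belong to every member of the class, and hence to itself.\<close>

lemma hist_found:
  assumes h: "histo h" and DQ: "DD (\<lambda>e. Q (e 0))" and c: "m c h" "Q c"
  shows "\<exists>c. m c h \<and> Q c \<and> (\<forall>d. m d h \<and> Q d \<longrightarrow> \<not> m d c)"
proof (rule ccontr)
  assume "\<not> ?thesis"
  then have N: "\<exists>d. m d h \<and> Q d \<and> m d c" if "m c h" "Q c" for c using that by blast
  have "DD (\<lambda>e. (\<forall>r. m r h \<and> Q r \<longrightarrow> m (e 0) r) \<and> \<not> m (e 0) (e 0))"
    by (intro ddl DD_sub1[OF DQ])
  from sep[OF this, of c] obtain d where
    d: "\<And>x. m x d \<longleftrightarrow> m x c \<and> (\<forall>r. m r h \<and> Q r \<longrightarrow> m x r) \<and> \<not> m x x" by blast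
  have "m d r" if r: "m r h" "Q r" for r
  proof -
    obtain r' where r': "m r' h" "Q r'" "m r' r" using N[OF r] by blast
    then have "sub d r'" by (auto simp: gsub_def d)
    then show ?thesis using hist_memI[OF h r(1) _ r'(3,1)] by blast
  qed
  then show False using d[of d] c by meson
qed

text \<open>Let \<open>c\<close> be minimal with a member \<open>x\<close> not included in it. Some
  \<open>z\<close> in \<open>c\<close> and \<open>h\<close> includes \<open>x\<close>, and by
  minimality \<open>z\<close> includes its own members; so every member of \<open>x\<close> is a
  subset of \<open>z\<close> and thus belongs to \<open>c\<close>.\<close>

lemma hist_trans:
  assumes h: "histo h" and c: "m c h" and x: "m x c"
  shows "sub x c"
proof (rule ccontr)
  let ?Q = "\<lambda>d. \<exists>x. m x d \<and> \<not> sub x d"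
  assume "\<not> sub x c"
  then have "?Q c" using x by blast
  moreover have "DD (\<lambda>e. ?Q (e 0))" by (intro ddl)
  ultimately obtain c where c: "m c h" "?Q c" and min: "\<And>d. m d h \<Longrightarrow> m d c \<Longrightarrow> \<not> ?Q d"
    using hist_found[OF h, of ?Q, OF _ assms(2)] by meson
  then obtain x where x: "m x c" "\<not> sub x c" by blast
  then obtain z where z: "lo z" "sub x z" "m z c" "m z h" using hist_memD[OF h c(1)] by blast
  have "m y c" if "m y x" for y
  proof -
    have "m y z" using that z(2) by (rule gsubD[rotated])
    then obtain w where w: "sub y w" "m w z" using hist_memD[OF h z(4)] by blast
    then have "sub w z" using min[OF z(4,3)] by blast
    then have "sub y z" using gsub_trans[OF w(1)] by blast
    then show ?thesis using hist_memI[OF h c(1) _ z(3,4)] by blast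
  qed
  then show False using x(2) by (simp add: gsub_def)
qed

text \<open>\<open>c\<close> is generated by its intersection with \<open>h\<close>, and this
  intersection is again a history: by transitivity, restricting to \<open>c\<close> loses no
  witness.\<close>

lemma hist_levl:
  assumes h: "histo h" and c: "m c h"
  shows "levl c"
proof -
  have "DD (\<lambda>e. m (e 0) h)" by (intro ddl)
  from sep[OF this, of c] obtain g where g: "lo g" "\<And>x. m x g \<longleftrightarrow> m x c \<and> m x h" by blast
  have "histo g"
    unfolding ghist_def
  proof (intro conjI allI impI)
    show "lo b" if "m b g" for b using that g(2) hist_lo[OF h] by blast
    show "m y b \<longleftrightarrow> (\<exists>z. lo z \<and> sub y z \<and> m z b \<and> m z g)" if b: "m b g" for b y
    proof -
      have b': "m b c" "m b h" using b g(2) by auto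
      show ?thesis
        using hist_mem[OF h b'(2), of y] g(2) gsubD[OF hist_trans[OF h c b'(1)]] by metis
    qed
  qed (rule g)
  then show ?thesis
    unfolding glev_def using hist_lo[OF h c] hist_mem[OF h c] g(2) by metis
qed

section \<open>Levels and their well-ordering\<close>

lemma levl_lo: "levl s \<Longrightarrow> lo s"
  unfolding glev_def by blast

lemma levlE:
  assumes "levl s"
  obtains h where "histo h" "\<And>y. m y s \<Longrightarrow> \<exists>c. sub y c \<and> m c h" "\<And>y c. sub y c \<Longrightarrow> m c h \<Longrightarrow> m y s"
  using assms hist_lo unfolding glev_def by metis

lemma levl_potent:
  assumes "levl s" "m x s" "sub y x"
  shows "m y s"
proof -
  obtain h where h: "histo h" "\<And>y. m y s \<Longrightarrow> \<exists>c. sub y c \<and> m c h" "\<And>y c. sub y c \<Longrightarrow> m c h \<Longrightarrow> m y s"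
    using assms(1) by (rule levlE) metis
  obtain c where "sub x c" "m c h" using h(2)[OF assms(2)] by blast
  then show ?thesis using h(3) gsub_trans[OF assms(3)] by metis
qed

lemma levl_trans:
  assumes "levl s" "m y s"
  shows "sub y s"
proof -
  obtain h where h: "histo h" "\<And>y. m y s \<Longrightarrow> \<exists>c. sub y c \<and> m c h" "\<And>y c. sub y c \<Longrightarrow> m c h \<Longrightarrow> m y s"
    using assms(1) by (rule levlE) metis
  obtain c where c: "sub y c" "m c h" using h(2)[OF assms(2)] by blast
  have "m x s" if "m x y" for x
    using hist_memD[OF h(1) c(2) gsubD[OF c(1) that]] h(3) by metis
  then show ?thesis by (simp add: gsub_def)
qed

lemma levl_transD: "levl s \<Longrightarrow> m y s \<Longrightarrow> m x y \<Longrightarrow> m x s"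
  using levl_trans gsubD by metis

text \<open>The members of a generating history are levels by \<open>hist_levl\<close>, and each
  belongs to \<open>s\<close> as a subset of itself. So a level is determined by the levels in
  it.\<close>

lemma levl_mem:
  assumes "levl s"
  shows "m y s \<longleftrightarrow> (\<exists>r. levl r \<and> m r s \<and> sub y r)"
proof
  assume "m y s"
  obtain h where h: "histo h" "\<And>y. m y s \<Longrightarrow> \<exists>c. sub y c \<and> m c h" "\<And>y c. sub y c \<Longrightarrow> m c h \<Longrightarrow> m y s"
    using assms by (rule levlE) metis
  obtain c where c: "sub y c" "m c h" using h(2)[OF \<open>m y s\<close>] by blast
  have "m c s" by (rule h(3)[OF gsub_refl c(2)])
  then show "\<exists>r. levl r \<and> m r s \<and> sub y r" using hist_levl[OF h(1) c(2)] c(1) by blast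
next
  assume "\<exists>r. levl r \<and> m r s \<and> sub y r"
  then show "m y s" using levl_potent[OF assms] by blast
qed

lemma levl_memD: "levl s \<Longrightarrow> m y s \<Longrightarrow> \<exists>r. levl r \<and> m r s \<and> sub y r"
  using levl_mem by metis

text \<open>If \<open>s\<close> belonged to itself, the Russell set of \<open>s\<close>, being
  included in \<open>s\<close>, would belong to \<open>s\<close>.\<close>

lemma levl_irrefl:
  assumes s: "levl s"
  shows "\<not> m s s"
proof
  assume ss: "m s s"
  have "DD (\<lambda>e. \<not> m (e 0) (e 0))" by (intro ddl)
  from sep[OF this, of s] obtain d where d: "\<And>x. m x d \<longleftrightarrow> m x s \<and> \<not> m x x" by blast
  then have "m d s" using levl_potent[OF s ss] by (auto simp: gsub_def)
  then show False using d[of d] by meson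
qed

text \<open>The Russell argument of \<open>hist_found\<close>, with closure of levels under subsets
  in place of the history condition.\<close>

lemma levl_min:
  assumes DQ: "DD (\<lambda>e. Q (e 0))" and s: "levl s" "Q s"
  shows "\<exists>s. levl s \<and> Q s \<and> (\<forall>t. levl t \<and> Q t \<longrightarrow> \<not> m t s)"
proof (rule ccontr)
  assume "\<not> ?thesis"
  then have N: "\<exists>t. levl t \<and> Q t \<and> m t s" if "levl s" "Q s" for s using that by blast
  have "DD (\<lambda>e. (\<forall>r. levl r \<and> Q r \<longrightarrow> m (e 0) r) \<and> \<not> m (e 0) (e 0))"
    by (intro ddl DD_sub1[OF DQ])
  from sep[OF this, of s] obtain d where
    d: "\<And>x. m x d \<longleftrightarrow> m x s \<and> (\<forall>r. levl r \<and> Q r \<longrightarrow> m x r) \<and> \<not> m x x" by blast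
  have "m d r" if r: "levl r" "Q r" for r
  proof -
    obtain r' where r': "levl r'" "Q r'" "m r' r" using N[OF r] by blast
    then have "sub d r'" by (auto simp: gsub_def d)
    then show ?thesis using levl_potent[OF r(1) r'(3)] by blast
  qed
  then show False using d[of d] s by meson
qed

text \<open>Take \<open>s\<close> minimal among levels with an incomparable partner, and
  \<open>t\<close> minimal among the partners of \<open>s\<close>. Every level in one of them lies
  in the other, so they coincide by \<open>levl_mem\<close>.\<close>

lemma levl_linear:
  assumes "levl s" "levl t"
  shows "m s t \<or> s = t \<or> m t s"
proof (rule ccontr)
  let ?C = "\<lambda>s t. m s t \<or> s = t \<or> m t s"
  assume N: "\<not> ?C s t"
  have "DD (\<lambda>e. \<exists>t. levl t \<and> \<not> ?C (e 0) t)" by (intro ddl)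
  from levl_min[OF this, of s] obtain s where s: "levl s" "\<exists>t. levl t \<and> \<not> ?C s t"
    and mins: "\<And>r t. levl r \<Longrightarrow> m r s \<Longrightarrow> levl t \<Longrightarrow> ?C r t" using assms N by blast
  have "DD (\<lambda>e. \<not> ?C s (e 0))" by (intro ddl)
  from levl_min[OF this] obtain t where t: "levl t" "\<not> ?C s t"
    and mint: "\<And>r. levl r \<Longrightarrow> m r t \<Longrightarrow> ?C s r" using s by blast
  have 1: "m r t" if "levl r" "m r s" for r
    using mins[OF that t(1)] t(2) that levl_transD[OF s(1) that(2)] by blast
  have 2: "m r s" if "levl r" "m r t" for r
    using mint[OF that] t(2) that levl_transD[OF t(1) that(2)] by blast
  have "s = t"
  proof (rule ext)
    show "m y s = m y t" for y
      using levl_mem[OF s(1), of y] levl_mem[OF t(1), of y] 1 2 by metis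
  qed (use s t levl_lo in metis)+
  then show False using t(2) by blast
qed

lemma levl_asym: "levl s \<Longrightarrow> levl t \<Longrightarrow> m s t \<Longrightarrow> \<not> m t s"
  using levl_irrefl levl_transD by blast

lemma levl_sub_linear: "levl s \<Longrightarrow> levl t \<Longrightarrow> sub s t \<or> m t s"
  using levl_linear levl_trans by fastforce

lemma levl_least:
  assumes "DD (\<lambda>e. Q (e 0))" "levl s" "Q s"
  shows "\<exists>s. levl s \<and> Q s \<and> (\<forall>t. levl t \<and> Q t \<longrightarrow> s = t \<or> m s t)"
  using levl_min[OF assms] levl_linear by blast

lemma levl_least_sub:
  assumes "DD (\<lambda>e. Q (e 0))" "levl s" "Q s"
  shows "\<exists>s. levl s \<and> Q s \<and> (\<forall>t. levl t \<and> Q t \<longrightarrow> sub s t)"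
  using levl_least[OF assms] levl_trans by (metis gsub_refl)

text \<open>The hypothesis \<open>R\<close> says that members of \<open>w\<close> rank no higher
  than \<open>v\<close> itself; such members lie in every level above one that includes
  \<open>v\<close>. All finite rank discrepancies are controlled by this.\<close>

lemma sub_shift:
  assumes R: "\<And>u. m u w \<Longrightarrow> m u v \<or> sub u v \<or> (\<exists>x. m x v \<and> m u x)"
    and s: "levl s" "levl s'" "m s s'" and v: "sub v s"
  shows "sub w s'"
  unfolding gsub_def
proof (intro allI impI)
  fix u assume "m u w"
  then consider "m u v" | "sub u v" | x where "m x v" "m u x" using R by blast
  then show "m u s'"
  proof cases
    case 2
    then show ?thesis using gsub_trans[OF _ v] levl_potent[OF s(2,3)] by metis
  qed (use gsubD[OF v] levl_transD[OF s(1)] levl_transD[OF s(2,3)] in metis)+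
qed

end

locale strat_level_theory = level_theory DD TT m lo for DD :: "((nat \<Rightarrow> 'a) \<Rightarrow> bool) \<Rightarrow> bool" and TT m lo +
  assumes strat: "\<exists>s. levl s \<and> sub a s"
    and endless: "levl s \<Longrightarrow> \<exists>t. levl t \<and> m s t"
begin

lemma in_levl: "\<exists>s. levl s \<and> m a s"
  using strat[of a] endless levl_potent by blast

lemma in_levl2: "\<exists>s. levl s \<and> m a s \<and> m b s"
  using in_levl[of a] in_levl[of b] levl_linear levl_transD by metis

section \<open>Successor levels and foundation\<close>

lemma next_ex:
  assumes "levl r"
  shows "\<exists>t. levl t \<and> m r t \<and> (\<forall>u. levl u \<and> m r u \<longrightarrow> t = u \<or> m t u)"
proof -
  have "DD (\<lambda>e. m r (e 0))" by (intro ddl)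
  then show ?thesis using levl_least[of "\<lambda>u. m r u"] endless[OF assms] by blast
qed

definition nx :: "'a \<Rightarrow> 'a" where
  "nx r = (SOME t. levl t \<and> m r t \<and> (\<forall>u. levl u \<and> m r u \<longrightarrow> t = u \<or> m t u))"

lemma nx:
  assumes "levl r"
  shows "levl (nx r)" "m r (nx r)" "\<And>u. levl u \<Longrightarrow> m r u \<Longrightarrow> nx r = u \<or> m (nx r) u"
  using someI_ex[OF next_ex[OF assms]] unfolding nx_def by blast+

text \<open>A level inside \<open>nx r\<close> cannot lie above \<open>r\<close>, so it is included
  in \<open>r\<close>.\<close>

lemma nx_mem: "levl r \<Longrightarrow> m y (nx r) \<longleftrightarrow> sub y r"
proof
  assume r: "levl r" and "m y (nx r)"
  then obtain u where u: "levl u" "m u (nx r)" "sub y u" using levl_memD nx(1) by metis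
  then have "sub u r"
    using levl_sub_linear[OF u(1) r] nx(3)[OF r u(1)] levl_irrefl levl_asym[OF nx(1)[OF r] u(1)] by blast
  then show "sub y r" using u(3) by (rule gsub_trans[rotated])
qed (use nx levl_potent in metis)

definition nxs :: "nat \<Rightarrow> 'a \<Rightarrow> 'a" where
  "nxs n r = (nx ^^ n) r"

lemma nxs_simps [simp]: "nxs 0 r = r" "nxs (Suc n) r = nx (nxs n r)" "nxs n (nxs k r) = nxs (n + k) r"
  by (simp_all add: nxs_def funpow_add)

lemma nxs_levl [simp]: "levl r \<Longrightarrow> levl (nxs n r)"
  by (induction n) (simp_all add: nx)

lemma glim_nx: "glim m lo s \<Longrightarrow> levl r \<Longrightarrow> m r s \<Longrightarrow> m (nx r) s"
  unfolding glim_def using nx(3) levl_transD by metis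

lemma glim_nxs: "glim m lo s \<Longrightarrow> levl r \<Longrightarrow> m r s \<Longrightarrow> m (nxs n r) s"
  by (induction n) (simp_all add: glim_nx)

lemma bounded_set:
  assumes "DD (\<lambda>e. Q (e 0))" "\<And>x. Q x \<Longrightarrow> m x s"
  shows "\<exists>b. lo b \<and> (\<forall>x. m x b \<longleftrightarrow> Q x)"
  using sep[OF assms(1), of s] assms(2) by blast

text \<open>Among the levels that include some \<open>a\<close> with \<open>Q a\<close>, take a
  minimal one: each member of that \<open>a\<close> is included in a lower level.\<close>

lemma m_min:
  assumes DQ: "DD (\<lambda>e. Q (e 0))" and a: "Q a"
  shows "\<exists>a. Q a \<and> (\<forall>x. m x a \<longrightarrow> \<not> Q x)"
proof -
  have "DD (\<lambda>e. \<exists>a. Q a \<and> sub a (e 0))" by (intro ddl DD_sub1[OF DQ])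
  moreover obtain s where "levl s" "sub a s" using strat by blast
  ultimately obtain s where s: "levl s" "\<exists>a. Q a \<and> sub a s"
    and min: "\<And>t. levl t \<Longrightarrow> \<exists>a. Q a \<and> sub a t \<Longrightarrow> \<not> m t s"
    using levl_min[of "\<lambda>s. \<exists>a. Q a \<and> sub a s" s] a by blast
  then obtain a where a: "Q a" "sub a s" by blast
  have "\<not> Q x" if "m x a" for x
    using levl_memD[OF s(1) gsubD[OF a(2) that]] min by metis
  then show ?thesis using a by blast
qed

lemma m_asym: "m x y \<Longrightarrow> \<not> m y x"
proof
  assume xy: "m x y" "m y x"
  have "DD (\<lambda>e. e 0 = x \<or> e 0 = y)" by (intro ddl)
  then show False using m_min[of "\<lambda>z. z = x \<or> z = y" x] xy by blast
qed

lemma m_irrefl: "\<not> m x x"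
  using m_asym by blast

end

section \<open>Transfer of stratification\<close>

text \<open>\<open>RR\<close> relates objects whose ranks differ by at most one in both structures.\<close>

locale two_structures = A: strat_level_theory DD TT m1 lo1 + B: level_theory DD TT m2 lo2
  for DD :: "((nat \<Rightarrow> 'a) \<Rightarrow> bool) \<Rightarrow> bool" and TT m1 lo1 m2 lo2 +
  fixes z :: 'a and RR :: "'a \<Rightarrow> 'a \<Rightarrow> bool"
  assumes z1: "\<not> m1 x z" and z2: "\<not> m2 x z"
    and mem1_mem2: "m1 v y \<Longrightarrow> v = z \<or> (\<exists>w. m2 w y \<and> RR v w)"
    and mem2_mem1: "m2 w y \<Longrightarrow> w = z \<or> (\<exists>v. m1 v y \<and> RR v w)"
    and RR_sym: "RR v w \<Longrightarrow> RR w v"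
    and RR_mem1: "RR v w \<Longrightarrow> m1 u w \<Longrightarrow> m1 u v \<or> gsub m1 u v \<or> (\<exists>x. m1 x v \<and> m1 u x)"
    and RR_mem2: "RR v w \<Longrightarrow> m2 u w \<Longrightarrow> m2 u v \<or> gsub m2 u v \<or> (\<exists>x. m2 x v \<and> m2 u x)"
    and same12: "\<exists>b. lo2 b \<and> (\<forall>x. m2 x b \<longleftrightarrow> m1 x a)"
begin

abbreviation "sub1 \<equiv> gsub m1"
abbreviation "sub2 \<equiv> gsub m2"
abbreviation "lev1 \<equiv> glev m1 lo1"
abbreviation "lev2 \<equiv> glev m2 lo2"

lemmas ddt = A.ddl B.DD_m B.DD_lo B.DD_sub B.DD_levl

lemma shift1: "RR v w \<Longrightarrow> lev1 s \<Longrightarrow> lev1 s' \<Longrightarrow> m1 s s' \<Longrightarrow> sub1 v s \<Longrightarrow> sub1 w s'"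
  by (rule A.sub_shift[OF RR_mem1])

lemma shift1n: "RR v w \<Longrightarrow> lev1 s \<Longrightarrow> sub1 v s \<Longrightarrow> sub1 w (A.nx s)"
  using shift1 A.nx by blast

lemma shift2: "RR v w \<Longrightarrow> lev2 s \<Longrightarrow> lev2 s' \<Longrightarrow> m2 s s' \<Longrightarrow> sub2 v s \<Longrightarrow> sub2 w s'"
  by (rule B.sub_shift[OF RR_mem2])

lemma z_sub: "sub1 z x" "sub2 z x"
  using z1 z2 by (auto simp: gsub_def)

lemma in1: "lev1 t \<Longrightarrow> m1 q t \<Longrightarrow> m2 w q \<Longrightarrow> sub1 w (A.nx t)"
proof -
  assume t: "lev1 t" and q: "m1 q t" "m2 w q"
  consider "w = z" | v where "m1 v q" "RR v w" using mem2_mem1 q(2) by blast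
  then show ?thesis
  proof cases
    case (2 v)
    then have "sub1 v t" using A.levl_trans[OF t] A.levl_transD[OF t q(1)] by blast
    then show ?thesis using shift1n[OF 2(2) t] by blast
  qed (use z_sub in blast)
qed

text \<open>One level pays for passing along \<open>RR\<close> to the members in the first sense,
  one for turning their inclusion in a level into membership, and one for doing the same with
  \<open>y\<close>.\<close>

lemma in1_sub: "lev1 t \<Longrightarrow> (\<And>w. m2 w y \<Longrightarrow> sub1 w t) \<Longrightarrow> m1 y (A.nxs 3 t)"
proof -
  assume t: "lev1 t" and w: "\<And>w. m2 w y \<Longrightarrow> sub1 w t"
  have "m1 v (A.nxs 2 t)" if v: "m1 v y" for v
  proof -
    consider "v = z" | w where "m2 w y" "RR v w" using mem1_mem2 v by blast
    then have "sub1 v (A.nx t)"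
    proof cases
      case (2 x)
      then show ?thesis using shift1n[OF RR_sym[OF 2(2)] t] w by blast
    qed (use z_sub in blast)
    then show ?thesis using A.nx_mem[OF A.nx(1)[OF t]] by (simp add: numeral_2_eq_2)
  qed
  then have "sub1 y (A.nxs 2 t)" by (simp add: gsub_def)
  then show ?thesis using A.nx_mem[OF A.nxs_levl[OF t, of 2]] by (simp add: numeral_3_eq_3 numeral_2_eq_2)
qed

text \<open>\<open>p\<close> is the level of the second structure generated by those of its levels
  that lie in \<open>t\<close>. It and its history are separated in the first structure, where
  bounds are known, and carried over by \<open>same12\<close>. The bound 4 is one level from
  \<open>in1\<close> plus three from \<open>in1_sub\<close>; 7 adds three more for \<open>p\<close>
  itself.\<close>

lemma pot_ex:
  assumes t: "lev1 t"
  shows "\<exists>p. lev2 p \<and> m1 p (A.nxs 7 t) \<and> (\<forall>y. m2 y p \<longleftrightarrow> (\<exists>q. lev2 q \<and> m1 q t \<and> sub2 y q))"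
proof -
  have b: "m1 y (A.nxs 4 t)" if "m1 q t" "sub2 y q" for y q
  proof -
    have "sub1 w (A.nx t)" if "m2 w y" for w
      using in1[OF t \<open>m1 q t\<close>] gsubD[OF \<open>sub2 y q\<close> that] by blast
    from in1_sub[OF A.nx(1)[OF t] this] show ?thesis
      using A.nxs_simps(3)[of 3 1 t] by simp
  qed
  \<comment> \<open>Downward closure is imposed explicitly: a second-structure level below one that
    lies in \<open>t\<close> need not lie in \<open>t\<close> in the first sense.\<close>
  let ?H = "\<lambda>q. lev2 q \<and> (\<exists>q'. lev2 q' \<and> m1 q' t \<and> (q = q' \<or> m2 q q'))"
  have Hs: "\<exists>q'. lev2 q' \<and> m1 q' t \<and> sub2 q q'" if "?H q" for q
    using that B.levl_trans gsub_refl by metis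
  have "DD (\<lambda>e. ?H (e 0))" by (intro ddt)
  moreover have "m1 q (A.nxs 4 t)" if "?H q" for q
    using Hs[OF that] b by blast
  ultimately have "\<exists>b. lo1 b \<and> (\<forall>x. m1 x b \<longleftrightarrow> ?H x)"
    by (rule A.bounded_set)
  then obtain h where h: "lo2 h" "\<And>q. m2 q h \<longleftrightarrow> ?H q" using same12 by metis
  have "DD (\<lambda>e. \<exists>q. lev2 q \<and> m1 q t \<and> sub2 (e 0) q)" by (intro ddt)
  then have "\<exists>b. lo1 b \<and> (\<forall>y. m1 y b \<longleftrightarrow> (\<exists>q. lev2 q \<and> m1 q t \<and> sub2 y q))"
    by (rule A.bounded_set) (use b in blast)
  then obtain p where p: "lo2 p" "\<And>y. m2 y p \<longleftrightarrow> (\<exists>q. lev2 q \<and> m1 q t \<and> sub2 y q)" using same12 by metis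
  have "ghist m2 lo2 h"
    unfolding ghist_def
  proof (intro conjI allI impI)
    show "lo2 x" if "m2 x h" for x using that h(2) B.levl_lo by blast
    show "m2 y q \<longleftrightarrow> (\<exists>r. lo2 r \<and> sub2 y r \<and> m2 r q \<and> m2 r h)" if q: "m2 q h" for q y
    proof -
      have 1: "lev2 q" using q h(2) by blast
      have "m2 r h" if r: "lev2 r" "m2 r q" for r
        using q r h(2) B.levl_transD by metis
      then show ?thesis
        using B.levl_mem[OF 1, of y] B.levl_lo B.levl_potent[OF 1] by metis
    qed
  qed (rule h)
  moreover have "m2 y p \<longleftrightarrow> (\<exists>c. lo2 c \<and> sub2 y c \<and> m2 c h)" for y
    unfolding p(2) h(2) using Hs gsub_trans B.levl_lo by metis
  ultimately have "lev2 p" unfolding glev_def using p(1) by metis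
  moreover have "sub1 w (A.nxs 4 t)" if "m2 w p" for w
    using that p(2) b A.levl_trans[OF A.nxs_levl[OF t]] by metis
  then have "m1 p (A.nxs 7 t)"
    using in1_sub[OF A.nxs_levl[OF t], of p 4] by simp
  ultimately show ?thesis using p(2) by blast
qed

definition caught :: "'a \<Rightarrow> 'a \<Rightarrow> bool" where
  "caught r t \<longleftrightarrow> (\<forall>x. m1 x r \<longrightarrow> (\<exists>q. lev2 q \<and> m1 q t \<and> sub2 x q))"

text \<open>Two applications of \<open>pot_ex\<close> give 7 + 7. A member of \<open>x\<close> is
  displaced by \<open>RR\<close> from a set included in a member of \<open>p\<close>, which makes it
  a subset of \<open>p\<close>; subsets of \<open>p\<close> belong to \<open>p2\<close>.\<close>

lemma caught_next:
  assumes r: "lev1 r" and t: "lev1 t" and c: "caught r t"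
  shows "caught (A.nx r) (A.nxs 14 t)"
  unfolding caught_def
proof (intro allI impI)
  fix x assume "m1 x (A.nx r)"
  then have x: "sub1 x r" using A.nx_mem[OF r] by blast
  obtain p where p: "lev2 p" "m1 p (A.nxs 7 t)" "\<And>y. m2 y p \<longleftrightarrow> (\<exists>q. lev2 q \<and> m1 q t \<and> sub2 y q)"
    using pot_ex[OF t] by blast
  obtain p2 where p2: "lev2 p2" "m1 p2 (A.nxs 7 (A.nxs 7 t))"
    "\<And>y. m2 y p2 \<longleftrightarrow> (\<exists>q. lev2 q \<and> m1 q (A.nxs 7 t) \<and> sub2 y q)"
    using pot_ex[OF A.nxs_levl[OF t]] by blast
  have "m2 w p2" if w: "m2 w x" for w
  proof -
    consider "w = z" | v where "m1 v x" "RR v w" using mem2_mem1 w by blast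
    then have "sub2 w p"
    proof cases
      case (2 v)
      then obtain q where q: "lev2 q" "m1 q t" "sub2 v q"
        using c gsubD[OF x] unfolding caught_def by blast
      then have "m2 q p" using p(3) gsub_refl by metis
      then show ?thesis using shift2[OF 2(2) q(1) p(1) _ q(3)] by simp
    qed (use z_sub in blast)
    then show ?thesis using p2(3) p by metis
  qed
  then show "\<exists>q. lev2 q \<and> m1 q (A.nxs 14 t) \<and> sub2 x q"
    using p2 by (intro exI[of _ p2]) (simp add: gsub_def)
qed

text \<open>The catching levels stay strictly below \<open>r\<close>, so transitivity keeps their
  witnesses in \<open>r\<close>.\<close>

lemma caught_limit:
  assumes r: "glim m1 lo1 r" and c: "\<And>r0. lev1 r0 \<Longrightarrow> m1 r0 r \<Longrightarrow> \<exists>t. lev1 t \<and> m1 t r \<and> caught r0 t"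
  shows "caught r r"
  unfolding caught_def
proof (intro allI impI)
  have rl: "lev1 r" using r by (simp add: glim_def)
  fix x assume "m1 x r"
  then obtain r0 where r0: "lev1 r0" "m1 r0 r" "sub1 x r0" using A.levl_memD[OF rl] by metis
  then have "m1 x (A.nx r0)" "lev1 (A.nx r0)" "m1 (A.nx r0) r"
    using A.nx_mem[OF r0(1)] A.nx(1) A.glim_nx[OF r] by blast+
  then obtain t q where "m1 t r" "m1 q t" "lev2 q" "sub2 x q"
    using c unfolding caught_def by meson
  then show "\<exists>q. lev2 q \<and> m1 q r \<and> sub2 x q" using A.levl_transD[OF rl] by metis
qed

text \<open>The second conjunct bounds the catching level strictly below the next limit; it is what makes the
  limit case work without replacement.\<close>

lemma caught_all:
  assumes "lev1 r"
  shows "(\<exists>t. lev1 t \<and> caught r t) \<and> (\<forall>s. glim m1 lo1 s \<and> m1 r s \<longrightarrow> (\<exists>t. lev1 t \<and> m1 t s \<and> caught r t))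
    \<and> (glim m1 lo1 r \<longrightarrow> caught r r)"
proof (rule ccontr)
  define P where "P r \<longleftrightarrow> (\<exists>t. lev1 t \<and> caught r t) \<and> (\<forall>s. glim m1 lo1 s \<and> m1 r s \<longrightarrow> (\<exists>t. lev1 t \<and> m1 t s \<and> caught r t))
    \<and> (glim m1 lo1 r \<longrightarrow> caught r r)" for r
  assume "\<not> ?thesis"
  then have np: "\<not> P r" unfolding P_def .
  have "DD (\<lambda>e. \<not> P (e 0))"
    unfolding P_def caught_def by (intro ddt A.DD_glim)
  from A.levl_min[of "\<lambda>r. \<not> P r", OF this assms np] obtain r where r: "lev1 r" "\<not> P r"
    and min: "\<And>r0. lev1 r0 \<Longrightarrow> m1 r0 r \<Longrightarrow> P r0" by blast
  have min1: "\<exists>t. lev1 t \<and> caught r0 t" if "lev1 r0" "m1 r0 r" for r0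
    using min[OF that] unfolding P_def by simp
  have min2: "\<exists>t. lev1 t \<and> m1 t s \<and> caught r0 t" if "lev1 r0" "m1 r0 r" "glim m1 lo1 s" "m1 r0 s" for r0 s
    using min[OF that(1,2)] that unfolding P_def by simp
  show False
  proof (cases "\<exists>r0. lev1 r0 \<and> m1 r0 r \<and> A.nx r0 = r")
    case True
    then obtain r0 where r0: "lev1 r0" "m1 r0 r" "A.nx r0 = r" by blast
    have nl: "\<not> glim m1 lo1 r" using A.glim_nx[of r r0] r0 A.levl_irrefl[OF r(1)] by auto
    have 1: "\<exists>t. lev1 t \<and> caught r t"
      using min1[OF r0(1,2)] caught_next[OF r0(1)] r0(3) A.nxs_levl by metis
    have "\<exists>t. lev1 t \<and> m1 t s \<and> caught r t" if s: "glim m1 lo1 s" "m1 r s" for s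
    proof -
      have "m1 r0 s" using A.levl_transD s r0(2) unfolding glim_def by metis
      then obtain t where t: "lev1 t" "m1 t s" "caught r0 t" using min2[OF r0(1,2) s(1)] by blast
      \<comment> \<open>A limit above absorbs the 14 further levels.\<close>
      then show ?thesis
        using caught_next[OF r0(1) t(1,3)] r0(3) A.glim_nxs[OF s(1) t(1,2)] A.nxs_levl by metis
    qed
    then show False using r(2) nl 1 unfolding P_def by blast
  next
    case False
    \<comment> \<open>With no immediate predecessor, \<open>nx r0\<close> stays below
      \<open>r\<close>. The lowest level falls under this case too.\<close>
    have lim: "glim m1 lo1 r"
      unfolding glim_def using r(1) False A.nx by metis
    then have "caught r r"
      by (rule caught_limit) (rule min2[OF _ _ lim])
    \<comment> \<open>Here \<open>r\<close> catches itself, and so it is the required level in the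
      first two conjuncts of \<open>P r\<close>.\<close>
    then show False using r min2 lim unfolding P_def by blast
  qed
qed

theorem strat2: "\<exists>s. lev2 s \<and> sub2 a s"
proof -
  obtain r where r: "lev1 r" "m1 a r" using A.in_levl by blast
  then show ?thesis using caught_all[OF r(1)] unfolding caught_def by metis
qed

theorem endless2:
  assumes "lev2 s"
  shows "\<exists>t. lev2 t \<and> m2 s t"
proof -
  obtain r where r: "lev1 r" "m1 s r" using A.in_levl by blast
  then show ?thesis using pot_ex[OF r(1)] assms gsub_refl by metis
qed

text \<open>The level generated by the second-structure levels in a limit is again a limit: each of
  these is found in some level below \<open>s\<close>, and the seven extra levels of
  \<open>pot_ex\<close> still fit below \<open>s\<close>.\<close>

theorem limit2:
  assumes s: "glim m1 lo1 s" and r: "lev1 r" "m1 r s"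
  shows "\<exists>s r. glim m2 lo2 s \<and> lev2 r \<and> m2 r s"
proof -
  have sl: "lev1 s" using s by (simp add: glim_def)
  have c: "caught s s" using caught_all[OF sl] s by blast
  obtain p where p: "lev2 p" "\<And>y. m2 y p \<longleftrightarrow> (\<exists>q. lev2 q \<and> m1 q s \<and> sub2 y q)"
    using pot_ex[OF sl] by blast
  have *: "\<exists>q. lev2 q \<and> m2 q p \<and> (\<forall>y. m2 y q \<longleftrightarrow> (\<exists>q. lev2 q \<and> m1 q t \<and> sub2 y q))" if t: "lev1 t" "m1 t s" for t
  proof -
    obtain q where q: "lev2 q" "m1 q (A.nxs 7 t)" "\<forall>y. m2 y q \<longleftrightarrow> (\<exists>q. lev2 q \<and> m1 q t \<and> sub2 y q)"
      using pot_ex[OF t(1)] by blast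
    then have "m1 q s" using A.glim_nxs[OF s t] A.levl_transD[OF sl] by blast
    then show ?thesis using q p(2) gsub_refl by metis
  qed
  have "glim m2 lo2 p"
    unfolding glim_def
  proof (intro conjI allI impI)
    fix q assume "lev2 q \<and> m2 q p"
    then obtain q' where q': "lev2 q'" "m1 q' s" "sub2 q q'" using p(2) by metis
    then obtain t where t: "lev1 t" "m1 t s" "sub1 q' t" using A.levl_memD[OF sl] by metis
    then have "m1 q' (A.nx t)" "m1 (A.nx t) s" "lev1 (A.nx t)"
      using A.nx_mem[OF t(1)] A.glim_nx[OF s] A.nx by blast+
    then show "\<exists>t. lev2 t \<and> m2 q t \<and> m2 t p" using *[of "A.nx t"] q' by metis
  qed (rule p)
  then show ?thesis using *[OF r] by blast
qed

end

section \<open>Boolean levels\<close>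

definition bhistS :: "('a \<Rightarrow> 'a \<Rightarrow> bool) \<Rightarrow> 'a \<Rightarrow> bool" where
  "bhistS E h \<longleftrightarrow> \<not> E h h \<and> (\<forall>x. E x h \<longrightarrow> (\<forall>y. E y x \<longleftrightarrow>
     (\<exists>z. (E z x \<and> E z h) \<and> \<not> E z z \<and> ((\<forall>w. E w y \<longrightarrow> E w z) \<or> (\<forall>w. \<not> E w y \<longrightarrow> E w z)))))"

definition blevS :: "('a \<Rightarrow> 'a \<Rightarrow> bool) \<Rightarrow> 'a \<Rightarrow> bool" where
  "blevS E s \<longleftrightarrow> (\<exists>h. bhistS E h \<and> (\<forall>y. E y s \<longleftrightarrow>
     (\<exists>z. E z h \<and> \<not> E z z \<and> ((\<forall>w. E w y \<longrightarrow> E w z) \<or> (\<forall>w. \<not> E w y \<longrightarrow> E w z)))))"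

text \<open>Membership in whichever of \<open>y\<close> and its complement is low.\<close>

definition bmem :: "('a \<Rightarrow> 'a \<Rightarrow> bool) \<Rightarrow> 'a \<Rightarrow> 'a \<Rightarrow> bool" where
  "bmem E x y \<longleftrightarrow> E x y \<noteq> E y y"

definition low :: "('a \<Rightarrow> 'a \<Rightarrow> bool) \<Rightarrow> 'a \<Rightarrow> bool" where
  "low E y \<longleftrightarrow> \<not> E y y"

text \<open>Extensionality is only needed in the form \<open>coext\<close>, which also holds in term models, where identity
  need not be interpreted by equality.\<close>

locale boolean_sets =
  fixes E :: "'a \<Rightarrow> 'a \<Rightarrow> bool"
  assumes coext: "(\<And>z. E z x = E z y) \<Longrightarrow> E x x = E y y"
    and compB: "\<exists>c. (\<forall>x. E x c \<longleftrightarrow> \<not> E x a) \<and> (\<not> E a a \<longleftrightarrow> E c c)"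
    and sepB1: "\<not> E a a \<Longrightarrow> \<exists>b. \<not> E b b \<and> (\<forall>x. E x b \<longleftrightarrow> E x y \<and> E x a)"
    and sepB2: "\<not> E a a \<Longrightarrow> \<exists>b. \<not> E b b \<and> (\<forall>x. E x b \<longleftrightarrow> (E x y \<and> \<not> E x x) \<and> E x a)"
begin

abbreviation "bsub \<equiv> gsub (bmem E)"

lemma bmem_of_low: "\<not> E y y \<Longrightarrow> bmem E x y \<longleftrightarrow> E x y"
  by (simp add: bmem_def)

text \<open>Separating from \<open>c\<close> gives a low set with the members of \<open>y\<close>,
  and \<open>coext\<close> transfers lowness.\<close>

lemma low_sub: "\<not> E c c \<Longrightarrow> (\<And>w. E w y \<Longrightarrow> E w c) \<Longrightarrow> \<not> E y y"
proof -
  assume c: "\<not> E c c" and s: "\<And>w. E w y \<Longrightarrow> E w c"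
  obtain b where b: "\<not> E b b" "\<And>x. E x b \<longleftrightarrow> E x y \<and> E x c" using sepB1[OF c] by metis
  then have "E b b = E y y" using s by (intro coext) blast
  then show ?thesis using b(1) by simp
qed

text \<open>A subset of a low set is low, so a disjunct can only hold for the low one of
  \<open>y\<close> and its complement; it then says that this low one is included in
  \<open>c\<close>.\<close>

lemma pot_B:
  assumes c: "\<not> E c c"
  shows "(\<forall>w. E w y \<longrightarrow> E w c) \<or> (\<forall>w. \<not> E w y \<longrightarrow> E w c) \<longleftrightarrow> bsub y c"
proof -
  obtain y' where y': "\<And>x. E x y' \<longleftrightarrow> \<not> E x y" "\<not> E y y \<longleftrightarrow> E y' y'" using compB[of y] by metis
  show ?thesis
    unfolding gsub_def using low_sub[OF c, of y] low_sub[OF c, of y'] c y' by (auto simp: bmem_def)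
qed

lemma pot_B': "\<not> E c c \<and> ((\<forall>w. E w y \<longrightarrow> E w c) \<or> (\<forall>w. \<not> E w y \<longrightarrow> E w c)) \<longleftrightarrow> \<not> E c c \<and> bsub y c"
  using pot_B[of c y] by metis

lemma bhistS_iff: "bhistS E h \<longleftrightarrow> \<not> E h h \<and> (\<forall>x. E x h \<longrightarrow> (\<forall>y. E y x \<longleftrightarrow>
     (\<exists>z. E z x \<and> E z h \<and> \<not> E z z \<and> bsub y z)))"
  unfolding bhistS_def pot_B' conj_assoc by (rule refl)

lemma blevS_iff: "blevS E s \<longleftrightarrow> (\<exists>h. bhistS E h \<and> (\<forall>y. E y s \<longleftrightarrow> (\<exists>z. E z h \<and> \<not> E z z \<and> bsub y z)))"
  unfolding blevS_def pot_B' by (rule refl)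

text \<open>A high member \<open>x\<close> would yield two low members of \<open>h\<close> belonging
  to each other. The common part \<open>e\<close> of \<open>x\<close> and \<open>h\<close> is not in
  \<open>x\<close>, hence in its low complement, hence in the low \<open>d\<close> that bounds this
  complement. Bounding \<open>e\<close> in turn by a member \<open>d'\<close> of \<open>d\<close>
  puts \<open>d\<close> into \<open>d'\<close>.\<close>

lemma bhistS_low:
  assumes h: "bhistS E h" and x: "E x h"
  shows "\<not> E x x"
proof
  assume xx: "E x x"
  have hl: "\<not> E h h" using h bhistS_iff by metis
  have D: "\<exists>z. E z x \<and> E z h \<and> \<not> E z z \<and> bsub y z" if "E x h" "E y x" for x y
    using h that bhistS_iff by metis
  have I: "E y x" if "E x h" "E z x" "E z h" "\<not> E z z" "bsub y z" for x y z
    using h that bhistS_iff by metis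
  have F: False if d: "E d h" "\<not> E d d" "E d' h" "\<not> E d' d'" "E d d'" "E d' d" for d d'
  proof -
    \<comment> \<open>Russell set of the intersection: included in \<open>d\<close> and in
      \<open>d'\<close>, it belongs to both and therefore to itself.\<close>
    obtain r where r: "\<not> E r r" "\<And>x. E x r \<longleftrightarrow> (E x d' \<and> \<not> E x x) \<and> E x d"
      using sepB2[OF d(2)] by metis
    have s: "bsub r d" "bsub r d'"
      unfolding gsub_def bmem_of_low[OF r(1)] bmem_of_low[OF d(2)] bmem_of_low[OF d(4)] using r(2) by metis+
    have "E r d" by (rule I[OF d(1,6,3,4) s(2)])
    moreover have "E r d'" by (rule I[OF d(3,5,1,2) s(1)])
    ultimately show False using r by blast
  qed
  obtain d where d: "E d x" "E d h" "\<not> E d d" "bsub x d" using D[OF x xx] by metis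
  obtain e where e: "\<not> E e e" "\<And>w. E w e \<longleftrightarrow> E w x \<and> E w h" using sepB1[OF hl] by metis
  \<comment> \<open>Otherwise \<open>e\<close> is included in a low \<open>d'\<close> from
    \<open>x\<close> and \<open>h\<close>; but such a \<open>d'\<close> is a member of
    \<open>e\<close> and would belong to itself.\<close>
  have "\<not> E e x"
  proof
    assume "E e x"
    then obtain d' where "E d' x" "E d' h" "\<not> E d' d'" "bsub e d'" using D[OF x] by metis
    then show False using e gsubD[of "bmem E" e d' d'] by (simp add: bmem_def)
  qed
  then have "E e d" using gsubD[OF d(4), of e] xx d(3) by (simp add: bmem_def)
  then obtain d' where d': "E d' d" "E d' h" "\<not> E d' d'" "bsub e d'" using D[OF d(2)] by metis
  then have "E d d'" using gsubD[OF d'(4), of d] e d by (simp add: bmem_def)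
  then show False using F[of d d'] d d' by metis
qed

lemma bhistS_ghist: "bhistS E h \<longleftrightarrow> ghist (bmem E) (low E) h"
proof
  assume h: "bhistS E h"
  note l = bhistS_low[OF h]
  have hl: "\<not> E h h" using h bhistS_iff by metis
  show "ghist (bmem E) (low E) h"
    unfolding ghist_def bmem_of_low[OF hl]
  proof (intro conjI allI impI)
    show "low E h" using hl by (simp add: low_def)
    show "low E x" if "E x h" for x using l[OF that] by (simp add: low_def)
    show "bmem E y x \<longleftrightarrow> (\<exists>z. low E z \<and> bsub y z \<and> bmem E z x \<and> E z h)" if x: "E x h" for x y
      using h[unfolded bhistS_iff] bmem_of_low[OF l[OF x]] x unfolding low_def by metis
  qed
next
  assume h: "ghist (bmem E) (low E) h"
  have hl: "\<not> E h h" using h unfolding ghist_def low_def by metis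
  have l: "\<not> E x x" if "E x h" for x
    using h that bmem_of_low[OF hl] unfolding ghist_def low_def by metis
  have "E y x \<longleftrightarrow> (\<exists>z. E z x \<and> E z h \<and> \<not> E z z \<and> bsub y z)" if x: "E x h" for x y
    using h[unfolded ghist_def] bmem_of_low[OF l[OF x]] bmem_of_low[OF hl] x unfolding low_def by metis
  then show "bhistS E h" using hl unfolding bhistS_iff by metis
qed

lemma blevS_glev: "blevS E s \<longleftrightarrow> glev (bmem E) (low E) s"
proof
  assume "blevS E s"
  then obtain h where h: "bhistS E h" and s: "\<And>y. E y s \<longleftrightarrow> (\<exists>z. E z h \<and> \<not> E z z \<and> bsub y z)"
    using blevS_iff by metis
  note l = bhistS_low[OF h]
  have hl: "\<not> E h h" using h bhistS_iff by metis
  \<comment> \<open>If \<open>s\<close> contained itself, its complement would be included in some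
    low \<open>c\<close> from \<open>h\<close>, and \<open>c\<close> is included in
    \<open>s\<close>. So \<open>s\<close> would be universal and contain \<open>h\<close>, which
    forces a low member of \<open>h\<close> to contain itself.\<close>
  have sl: "\<not> E s s"
  proof
    assume ss: "E s s"
    then obtain c where c: "E c h" "\<not> E c c" "bsub s c" using s by metis
    have cs: "E w s" if "E w c" for w
      using h[unfolded bhistS_iff] c(1) that s by metis
    have "E y s" for y
      using gsubD[OF c(3), of y] ss c(2) cs[of y] by (auto simp: bmem_def)
    then obtain c where c: "E c h" "\<not> E c c" "bsub h c" using s by metis
    then show False using gsubD[OF c(3), of c] hl by (simp add: bmem_def)
  qed
  then show "glev (bmem E) (low E) s"
    unfolding glev_def low_def bmem_of_low[OF sl]
    using h[unfolded bhistS_ghist low_def] s bmem_of_low[OF hl] l by metis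
next
  assume s: "glev (bmem E) (low E) s"
  then have sl: "\<not> E s s" unfolding glev_def low_def by metis
  obtain h where h: "ghist (bmem E) (low E) h" and hs: "\<And>y. bmem E y s \<longleftrightarrow> (\<exists>c. low E c \<and> bsub y c \<and> bmem E c h)"
    using s unfolding glev_def by metis
  have hl: "\<not> E h h" using h unfolding ghist_def low_def by metis
  show "blevS E s"
    unfolding blevS_iff using h[folded bhistS_ghist] hs[unfolded bmem_of_low[OF sl] bmem_of_low[OF hl] low_def] by metis
qed

lemma blevS_low: "blevS E s \<Longrightarrow> \<not> E s s"
  unfolding blevS_glev glev_def low_def by metis

lemma blevS_trans:
  assumes s: "blevS E s" and t: "blevS E t" and st: "E s t" and r: "E r s"
  shows "E r t"
proof -
  obtain h where h: "bhistS E h" and ht: "\<And>y. E y t \<longleftrightarrow> (\<exists>z. E z h \<and> \<not> E z z \<and> bsub y z)"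
    using t blevS_iff by metis
  obtain c where c: "E c h" "\<not> E c c" "bsub s c" using ht st by metis
  then have "E r c" using gsubD[OF c(3), of r] r blevS_low[OF s] by (simp add: bmem_def)
  then obtain d where "E d h" "\<not> E d d" "bsub r d" using h[unfolded bhistS_iff] c(1) by metis
  then show ?thesis using ht by metis
qed

end

locale definable_boolean_sets = definability DD TT for DD :: "((nat \<Rightarrow> 'a) \<Rightarrow> bool) \<Rightarrow> bool" and TT +
  fixes E :: "'a \<Rightarrow> 'a \<Rightarrow> bool"
  assumes DD_E: "TT t \<Longrightarrow> TT u \<Longrightarrow> DD (\<lambda>e. E (t e) (u e))"
    and extB: "(\<And>z. E z x = E z y) \<Longrightarrow> x = y"
    and compB: "\<exists>c. (\<forall>x. E x c \<longleftrightarrow> \<not> E x a) \<and> (\<not> E a a \<longleftrightarrow> E c c)"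
    and sepB: "DD (\<lambda>e. Q (e 0)) \<Longrightarrow> \<not> E a a \<Longrightarrow> \<exists>b. \<not> E b b \<and> (\<forall>x. E x b \<longleftrightarrow> Q x \<and> E x a)"
begin

sublocale boolean_sets E
proof
  show "\<exists>b. \<not> E b b \<and> (\<forall>x. E x b \<longleftrightarrow> E x y \<and> E x a)" if "\<not> E a a" for a y
    by (rule sepB[OF _ that]) (intro dd DD_E)
  show "\<exists>b. \<not> E b b \<and> (\<forall>x. E x b \<longleftrightarrow> (E x y \<and> \<not> E x x) \<and> E x a)" if "\<not> E a a" for a y
    by (rule sepB[OF _ that]) (intro dd DD_E)
  show "E x x = E y y" if "\<And>z. E z x = E z y" for x y
    using extB[OF that] by simp
qed (rule compB)

text \<open>The low part of \<open>a\<close> is given by a low set, \<open>a\<close> or its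
  complement. Separation from low sets therefore gives separation for \<open>bmem\<close> from any
  \<open>a\<close>.\<close>

lemma lev_B: "level_theory DD TT (bmem E) (low E)"
proof
  show "DD (\<lambda>e. bmem E (t e) (u e))" if "TT t" "TT u" for t u
    unfolding bmem_def by (intro dd DD_E that)
  show "DD (\<lambda>e. low E (t e))" if "TT t" for t
    unfolding low_def by (intro dd DD_E that)
  show "x = y" if "low E x" "low E y" "\<And>z. bmem E z x = bmem E z y" for x y
    using that by (intro extB) (simp add: bmem_def low_def)
  show "\<exists>b. low E b \<and> (\<forall>x. bmem E x b \<longleftrightarrow> bmem E x a \<and> Q x)" if Q: "DD (\<lambda>e. Q (e 0))" for Q a
  proof -
    have "\<exists>c. \<not> E c c \<and> (\<forall>x. E x c \<longleftrightarrow> bmem E x a)"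
    proof (cases "E a a")
      case True
      then show ?thesis using compB[of a] by (auto simp: bmem_def)
    qed (auto simp: bmem_def)
    then obtain c where c: "\<not> E c c" "\<And>x. E x c \<longleftrightarrow> bmem E x a" by metis
    obtain b where "\<not> E b b" "\<And>x. E x b \<longleftrightarrow> Q x \<and> E x c" using sepB[OF Q c(1)] by metis
    then show ?thesis using c by (intro exI[of _ b]) (auto simp: bmem_def low_def)
  qed
qed

end

section \<open>The coding bijection\<close>

text \<open>Instantiated twice. On the ordinary side \<open>L\<close> is not containing the empty
  set, \<open>t\<close> adjoins it, and \<open>s\<close> takes the singleton of the toggled set; on
  the boolean side \<open>L\<close> is lowness, \<open>t\<close> is complementation and
  \<open>s\<close> is the singleton.\<close>

locale coding = strat_level_theory DD TT m lo
  for DD :: "((nat \<Rightarrow> 'a) \<Rightarrow> bool) \<Rightarrow> bool" and TT m lo +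
  fixes L :: "'a \<Rightarrow> bool" and z :: 'a and t s :: "'a \<Rightarrow> 'a"
  assumes DD_L: "DD (\<lambda>e. L (e 0))"
    and DD_t: "DD (\<lambda>e. e (Suc 0) = t (e 0))"
    and DD_s: "DD (\<lambda>e. e (Suc 0) = s (e 0))"
    and mz: "\<not> m x z" and Lz: "L z"
    and tL: "L x \<Longrightarrow> \<not> L (t x)"
    and t_inj: "L x \<Longrightarrow> L y \<Longrightarrow> t x = t y \<Longrightarrow> x = y"
    and sL: "L x \<Longrightarrow> L (s x)"
    and s_inj: "L x \<Longrightarrow> L y \<Longrightarrow> s x = s y \<Longrightarrow> x = y"
    and sz: "L x \<Longrightarrow> s x \<noteq> z"
begin

text \<open>The numbers \<open>z\<close>, \<open>s z\<close>, \<open>s (s z)\<close> and so on.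
  Closing upwards under \<open>s\<close> would require an infinite set; closing downwards from
  \<open>x\<close> gives a condition that sets of bounded rank can test.\<close>

definition N :: "'a \<Rightarrow> bool" where
  "N x \<longleftrightarrow> (\<forall>u. lo u \<and> m x u \<and> (\<forall>y. L y \<and> m (s y) u \<longrightarrow> m y u) \<longrightarrow> m z u)"

lemma ND: "N x \<Longrightarrow> lo u \<Longrightarrow> m x u \<Longrightarrow> (\<And>y. L y \<Longrightarrow> m (s y) u \<Longrightarrow> m y u) \<Longrightarrow> m z u"
  unfolding N_def by blast

lemma DD_N: "DD (\<lambda>e. N (e 0))"
proof -
  \<comment> \<open>\<open>s\<close> is definable only through its graph and is not a term, so its
    value gets a quantified name \<open>w\<close>.\<close>
  have "N = (\<lambda>x. \<forall>u. lo u \<and> m x u \<and> (\<forall>y w. L y \<and> w = s y \<and> m w u \<longrightarrow> m y u) \<longrightarrow> m z u)"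
    unfolding N_def by (intro HOL.ext) blast
  moreover have "DD (\<lambda>e. \<forall>u. lo u \<and> m (e 0) u \<and> (\<forall>y w. L y \<and> w = s y \<and> m w u \<longrightarrow> m y u) \<longrightarrow> m z u)"
    by (intro ddl DD_sub1[OF DD_L] DD_sub2[of "\<lambda>y w. w = s y", OF DD_s])
  ultimately show ?thesis by simp
qed

lemma single: "\<exists>b. lo b \<and> (\<forall>x. m x b \<longleftrightarrow> x = a)"
proof -
  obtain r where "m a r" using in_levl by blast
  moreover have "DD (\<lambda>e. e 0 = a)" by (intro ddl)
  ultimately show ?thesis using bounded_set[of "\<lambda>x. x = a" r] by blast
qed

lemma adjoin: "\<exists>b. lo b \<and> (\<forall>x. m x b \<longleftrightarrow> m x u \<or> x = a)"
proof -
  obtain r where r: "levl r" "m a r" "m u r" using in_levl2 by blast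
  have "DD (\<lambda>e. m (e 0) u \<or> e 0 = a)" by (intro ddl)
  moreover have "m x r" if "m x u \<or> x = a" for x using that r levl_transD[OF r(1,3)] by blast
  ultimately show ?thesis using bounded_set[of "\<lambda>x. m x u \<or> x = a" r] by blast
qed

lemma N_z: "N z"
  unfolding N_def by blast

text \<open>Otherwise the singleton of \<open>x\<close> would be vacuously closed under predecessors
  without containing \<open>z\<close>.\<close>

lemma N_cases:
  assumes "N x"
  shows "x = z \<or> (\<exists>y. L y \<and> x = s y)"
proof (rule ccontr)
  assume n: "\<not> ?thesis"
  obtain b where "lo b" "\<And>y. m y b \<longleftrightarrow> y = x" using single by metis
  then show False using ND[OF assms, of b] n by metis
qed

lemma N_L: "N x \<Longrightarrow> L x"
  using N_cases Lz sL by metis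

lemma N_step: "N y \<Longrightarrow> N (s y)"
  using N_L ND unfolding N_def[of "s y"] by metis

text \<open>A set that tests \<open>y\<close> becomes one that tests \<open>s y\<close> by adjoining
  \<open>s y\<close>: injectivity of \<open>s\<close> keeps it closed, and the adjoined element is
  not \<open>z\<close>.\<close>

lemma N_back:
  assumes y: "L y" and N: "N (s y)"
  shows "N y"
  unfolding N_def
proof (intro allI impI)
  fix u assume u: "lo u \<and> m y u \<and> (\<forall>y. L y \<and> m (s y) u \<longrightarrow> m y u)"
  obtain v where v: "lo v" "\<And>x. m x v \<longleftrightarrow> m x u \<or> x = s y" using adjoin by metis
  have "m z v"
    by (rule ND[OF N v(1)]) (use u v(2) s_inj[OF y] in metis)+
  then show "m z u" using v(2) sz[OF y] by metis
qed

definition T :: "'a \<Rightarrow> bool" where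
  "T x \<longleftrightarrow> (\<exists>x0. N x0 \<and> x = t x0)"

definition \<sigma> :: "'a \<Rightarrow> 'a" where
  "\<sigma> x = (if N x then t x else if T x then s (THE x0. N x0 \<and> x = t x0) else x)"

lemma \<sigma>_N: "N x \<Longrightarrow> \<sigma> x = t x"
  by (simp add: \<sigma>_def)

lemma T_not_N: "N x \<Longrightarrow> \<not> N (t x)"
  using N_L tL by blast

lemma \<sigma>_T: "N x \<Longrightarrow> \<sigma> (t x) = s x"
proof -
  assume x: "N x"
  then have "(THE x0. N x0 \<and> t x = t x0) = x"
    using t_inj N_L by (intro the_equality) auto
  then show ?thesis using T_not_N[OF x] x by (auto simp: \<sigma>_def T_def)
qed

lemma \<sigma>_other: "\<not> N x \<Longrightarrow> \<not> T x \<Longrightarrow> \<sigma> x = x"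
  by (simp add: \<sigma>_def)

lemma \<sigma>_cases:
  obtains "N x" "\<sigma> x = t x" | y where "N y" "x = t y" "\<sigma> x = s y" | "\<not> N x" "\<not> T x" "\<sigma> x = x"
proof -
  consider "N x" | "T x" | "\<not> N x" "\<not> T x" by blast
  then show ?thesis
  proof cases
    case 2
    then obtain y where "N y" "x = t y" unfolding T_def by blast
    then show ?thesis using that(2) \<sigma>_T by metis
  qed (use that \<sigma>_N \<sigma>_other in metis)+
qed

text \<open>Graph of \<open>\<sigma>\<close> without the description operator, the form that is
  definable and that the translating formulas spell out.\<close>

lemma \<sigma>_iff: "w = \<sigma> x \<longleftrightarrow> N x \<and> w = t x \<or> (\<exists>y. N y \<and> x = t y \<and> w = s y) \<or> \<not> N x \<and> \<not> (\<exists>y. N y \<and> x = t y) \<and> w = x"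
  by (rule \<sigma>_cases[of x]) (use T_not_N t_inj N_L in \<open>auto simp: T_def\<close>)

lemma \<sigma>_z: "\<sigma> x \<noteq> z"
  by (rule \<sigma>_cases[of x]) (use tL N_L sz Lz N_z in metis)+

text \<open>Toggled values lie outside \<open>L\<close>, values of \<open>s\<close> on the orbit lie
  in \<open>N\<close>, and fixed points lie neither in \<open>N\<close> nor in \<open>T\<close>; the
  three branches have disjoint ranges.\<close>

lemma \<sigma>_inj: "\<sigma> x = \<sigma> y \<Longrightarrow> x = y"
proof -
  have *: False if "N x" "\<sigma> x = t x" "\<sigma> y = \<sigma> x" "\<not> N y" for x y
  proof (rule \<sigma>_cases[of y])
    show False if "N u" "y = t u" "\<sigma> y = s u" for u
      using that \<open>N x\<close> \<open>\<sigma> x = t x\<close> \<open>\<sigma> y = \<sigma> x\<close> N_L sL tL by metis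
  qed (use that T_def in metis)+
  have **: "x = y" if "N u" "x = t u" "\<sigma> x = s u" "\<sigma> y = \<sigma> x" "\<not> N y" for x y u
  proof (rule \<sigma>_cases[of y])
    show "x = y" if "N v" "y = t v" "\<sigma> y = s v" for v
      using that \<open>N u\<close> \<open>x = t u\<close> \<open>\<sigma> x = s u\<close> \<open>\<sigma> y = \<sigma> x\<close> s_inj N_L by metis
  qed (use that N_step in metis)+
  assume eq: "\<sigma> x = \<sigma> y"
  show ?thesis
  proof (cases "N x \<or> N y")
    case True
    then show ?thesis using * eq \<sigma>_N t_inj N_L by metis
  next
    case False
    then show ?thesis
      by (metis ** eq T_def \<sigma>_T \<sigma>_other)
  qed
qed

text \<open>The orbit has no gaps: by \<open>N_back\<close>, a \<open>w\<close> in \<open>N\<close>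
  other than \<open>z\<close> is \<open>s y\<close> with \<open>y\<close> in \<open>N\<close>, hence
  the value at \<open>t y\<close>.\<close>

lemma \<sigma>_surj: "w \<noteq> z \<Longrightarrow> \<exists>x. w = \<sigma> x"
  using N_cases[of w] N_back \<sigma>_T \<sigma>_N \<sigma>_other unfolding T_def by metis

lemma DD_\<sigma>: "TT a \<Longrightarrow> TT b \<Longrightarrow> DD (\<lambda>e. b e = \<sigma> (a e))"
proof (rule DD_sub2[of "\<lambda>x w. w = \<sigma> x"])
  show "DD (\<lambda>e. e (Suc 0) = \<sigma> (e 0))"
    unfolding \<sigma>_iff
    by (intro ddl DD_sub1[OF DD_N] DD_sub2[of "\<lambda>y w. w = s y", OF DD_s] DD_sub2[of "\<lambda>y w. w = t y", OF DD_t])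
qed

text \<open>The orbit does not change if \<open>s\<close> is altered outside of it, as long as the new function does not lower
  ranks. This is why both membership relations define the same orbit.\<close>

lemma N_agree:
  assumes s': "\<And>y. N y \<Longrightarrow> s' y = s y"
    and down: "\<And>y r. L y \<Longrightarrow> levl r \<Longrightarrow> m (s' y) r \<Longrightarrow> m y r"
  shows "(\<forall>u. lo u \<and> m x u \<and> (\<forall>y. L y \<and> m (s' y) u \<longrightarrow> m y u) \<longrightarrow> m z u) \<longleftrightarrow> N x"
proof
  assume x: "N x"
  show "\<forall>u. lo u \<and> m x u \<and> (\<forall>y. L y \<and> m (s' y) u \<longrightarrow> m y u) \<longrightarrow> m z u"
  proof (intro allI impI)
    fix u assume u: "lo u \<and> m x u \<and> (\<forall>y. L y \<and> m (s' y) u \<longrightarrow> m y u)"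
    \<comment> \<open>On the orbit \<open>s\<close> and \<open>s'\<close> agree, so cutting
      \<open>u\<close> down to it converts closure under the one into closure under the
      other.\<close>
    obtain v where v: "lo v" "\<And>x. m x v \<longleftrightarrow> m x u \<and> N x" using sep[of N u, OF DD_N] by metis
    have "m z v"
      by (rule ND[OF x v(1)]) (use u v(2) x N_back s' in metis)+
    then show "m z u" using v(2) by metis
  qed
next
  assume x: "\<forall>u. lo u \<and> m x u \<and> (\<forall>y. L y \<and> m (s' y) u \<longrightarrow> m y u) \<longrightarrow> m z u"
  show "N x"
  proof (rule ccontr)
    assume nx: "\<not> N x"
    obtain r where r: "levl r" "m x r" using in_levl by blast
    \<comment> \<open>The part of a level outside the orbit contains \<open>x\<close> but not
      \<open>z\<close>. It is closed under predecessors along \<open>s'\<close>: \<open>down\<close>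
      keeps these in the level, and \<open>s'\<close> maps the orbit into itself.\<close>
    obtain u where u: "lo u" "\<And>x. m x u \<longleftrightarrow> m x r \<and> \<not> N x" using sep[of "\<lambda>x. \<not> N x" r, OF DD_not[OF DD_N]] by metis
    have "m y u" if "L y" "m (s' y) u" for y
      using that u(2) down[OF _ r(1)] s' N_step by metis
    then have "m z u" using x u r(2) nx by metis
    then show False using u(2) N_z by metis
  qed
qed

end

section \<open>The two translations\<close>

definition is_empty :: "('a \<Rightarrow> 'a \<Rightarrow> bool) \<Rightarrow> 'a \<Rightarrow> bool" where
  "is_empty E w \<longleftrightarrow> (\<forall>u. \<not> E u w)"

definition is_toggle :: "('a \<Rightarrow> 'a \<Rightarrow> bool) \<Rightarrow> 'a \<Rightarrow> 'a \<Rightarrow> bool" where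
  "is_toggle E x y \<longleftrightarrow> (\<forall>u. E u y \<longleftrightarrow> E u x \<or> is_empty E u)"

definition is_singleton :: "('a \<Rightarrow> 'a \<Rightarrow> bool) \<Rightarrow> 'a \<Rightarrow> 'a \<Rightarrow> bool" where
  "is_singleton E x y \<longleftrightarrow> (\<forall>u. E u y \<longleftrightarrow> u = x)"

definition is_complement :: "('a \<Rightarrow> 'a \<Rightarrow> bool) \<Rightarrow> 'a \<Rightarrow> 'a \<Rightarrow> bool" where
  "is_complement E x y \<longleftrightarrow> (\<forall>u. E u y \<longleftrightarrow> \<not> E u x)"

text \<open>The orbit of \<open>coding\<close>, spelled out in membership alone because it has to
  become a formula; clauses with \<open>is_empty\<close> stand in for a constant.\<close>

definition NL :: "('a \<Rightarrow> 'a \<Rightarrow> bool) \<Rightarrow> 'a \<Rightarrow> bool" where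
  "NL E x \<longleftrightarrow> (\<forall>u. E x u \<and> (\<forall>y y1 y2. (\<forall>w. is_empty E w \<longrightarrow> \<not> E w y) \<and> is_toggle E y y1 \<and> is_singleton E y1 y2 \<and> E y2 u \<longrightarrow> E y u)
     \<longrightarrow> (\<forall>w. is_empty E w \<longrightarrow> E w u))"

definition NB :: "('a \<Rightarrow> 'a \<Rightarrow> bool) \<Rightarrow> 'a \<Rightarrow> bool" where
  "NB E x \<longleftrightarrow> (\<forall>u. \<not> E u u \<and> E x u \<and> (\<forall>y y2. \<not> E y y \<and> is_singleton E y y2 \<and> E y2 u \<longrightarrow> E y u)
     \<longrightarrow> (\<forall>w. is_empty E w \<longrightarrow> E w u))"

definition sgL :: "('a \<Rightarrow> 'a \<Rightarrow> bool) \<Rightarrow> 'a \<Rightarrow> 'a \<Rightarrow> bool" where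
  "sgL E x w \<longleftrightarrow> NL E x \<and> is_toggle E x w \<or> (\<exists>y. NL E y \<and> is_toggle E y x) \<and> is_singleton E x w
     \<or> \<not> NL E x \<and> \<not> (\<exists>y. NL E y \<and> is_toggle E y x) \<and> w = x"

definition sgB :: "('a \<Rightarrow> 'a \<Rightarrow> bool) \<Rightarrow> 'a \<Rightarrow> 'a \<Rightarrow> bool" where
  "sgB E x w \<longleftrightarrow> NB E x \<and> is_complement E x w \<or> (\<exists>y. NB E y \<and> is_complement E y x \<and> is_singleton E y w)
     \<or> \<not> NB E x \<and> \<not> (\<exists>y. NB E y \<and> is_complement E y x) \<and> w = x"

text \<open>Exclusive or: without the empty set, \<open>y\<close> stands for the class of preimages
  of its members under \<sigma>; with it, for the complement of that class.\<close>

definition bool_mem :: "('a \<Rightarrow> 'a \<Rightarrow> bool) \<Rightarrow> 'a \<Rightarrow> 'a \<Rightarrow> bool" where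
  "bool_mem E x y \<longleftrightarrow> (\<exists>w. sgL E x w \<and> \<not> (E w y \<longleftrightarrow> (\<exists>u. is_empty E u \<and> E u y)))"

text \<open>The inverse reading: the empty set belongs to \<open>y\<close> iff \<open>y\<close> is
  high, and every other object is a value of \<sigma>.\<close>

definition ord_mem :: "('a \<Rightarrow> 'a \<Rightarrow> bool) \<Rightarrow> 'a \<Rightarrow> 'a \<Rightarrow> bool" where
  "ord_mem E w y \<longleftrightarrow> is_empty E w \<and> E y y \<or> (\<exists>x. sgB E x w \<and> \<not> (E x y \<longleftrightarrow> E y y))"

text \<open>Both constructions fit this frame, with given and defined relation in opposite roles.
  \<open>j4\<close> lists the shapes of a value of \<open>\<sigma>\<close>: unchanged, toggled, or
  the singleton of a toggled set.\<close>

locale linked =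
  fixes EL EB :: "'a \<Rightarrow> 'a \<Rightarrow> bool" and \<sigma> :: "'a \<Rightarrow> 'a" and z :: 'a
  assumes j1: "EB x y \<longleftrightarrow> EL (\<sigma> x) y \<noteq> EL z y"
    and j2: "EB y y \<longleftrightarrow> EL z y"
    and \<sigma>z: "\<sigma> x \<noteq> z"
    and \<sigma>inj: "\<sigma> x = \<sigma> y \<Longrightarrow> x = y"
    and \<sigma>surj: "w \<noteq> z \<Longrightarrow> \<exists>x. w = \<sigma> x"
    and ELz: "\<not> EL u z"
    and j4: "\<sigma> v = v \<or> (\<forall>u. EL u (\<sigma> v) \<longleftrightarrow> EL u v \<or> u = z) \<or>
      ((\<forall>u. EL u (\<sigma> v) \<longleftrightarrow> u = v) \<and> (\<exists>x0. v = \<sigma> x0 \<and> (\<forall>u. EL u v \<longleftrightarrow> EL u x0 \<or> u = z)))"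
begin

definition RR :: "'a \<Rightarrow> 'a \<Rightarrow> bool" where
  "RR v w \<longleftrightarrow> w = \<sigma> v \<or> v = \<sigma> w"

lemma bmem_iff: "bmem EB x y \<longleftrightarrow> EL (\<sigma> x) y"
  using j1[of x y] j2[of y] by (auto simp: bmem_def)

lemma low_iff: "low EB y \<longleftrightarrow> \<not> EL z y"
  using j2 by (simp add: low_def)

lemma EL_bmem: "EL v y \<Longrightarrow> v = z \<or> (\<exists>w. v = \<sigma> w \<and> bmem EB w y)"
  using \<sigma>surj[of v] bmem_iff by metis

lemma A_L: "EL v y \<Longrightarrow> v = z \<or> (\<exists>w. bmem EB w y \<and> RR v w)"
  using EL_bmem unfolding RR_def by metis

lemma A_B: "bmem EB w y \<Longrightarrow> w = z \<or> (\<exists>v. EL v y \<and> RR v w)"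
  using bmem_iff unfolding RR_def by metis

lemma RR_sym: "RR v w \<Longrightarrow> RR w v"
  unfolding RR_def by blast

lemma A_B': "bmem EB v y \<Longrightarrow> v = z \<or> (\<exists>w. EL w y \<and> RR v w)"
  using A_B RR_sym by blast

lemma A_L': "EL w y \<Longrightarrow> w = z \<or> (\<exists>v. bmem EB v y \<and> RR v w)"
  using A_L RR_sym by blast

lemma R_L:
  assumes "RR v w" "EL u w"
  shows "EL u v \<or> gsub EL u v \<or> (\<exists>x. EL x v \<and> EL u x)"
proof -
  have z: "gsub EL z v" using ELz by (simp add: gsub_def)
  consider "w = \<sigma> v" | "v = \<sigma> w" using assms(1) RR_def by blast
  then show ?thesis
  proof cases
    case 1
    then show ?thesis using j4[of v] assms(2) z gsub_refl by metis
  next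
    case 2
    then show ?thesis using j4[of w] assms(2) by metis
  qed
qed

text \<open>In the singleton case \<open>x0\<close> is the only \<open>bmem\<close>-member of
  \<open>\<sigma> v\<close>, and \<open>v\<close> is \<open>x0\<close> with \<open>z\<close>
  adjoined; since \<open>\<sigma>\<close> omits \<open>z\<close>, the adjunction is invisible to
  \<open>bmem\<close>.\<close>

lemma R_B:
  assumes "RR v w" "bmem EB u w"
  shows "bmem EB u v \<or> gsub (bmem EB) u v \<or> (\<exists>x. bmem EB x v \<and> bmem EB u x)"
proof -
  consider "w = \<sigma> v" | "v = \<sigma> w" using assms(1) RR_def by blast
  then show ?thesis
  proof cases
    case 1
    from j4[of v] consider "\<sigma> v = v" | "\<forall>u. EL u (\<sigma> v) \<longleftrightarrow> EL u v \<or> u = z"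
      | x0 where "\<forall>u. EL u (\<sigma> v) \<longleftrightarrow> u = v" "v = \<sigma> x0" "\<forall>u. EL u v \<longleftrightarrow> EL u x0 \<or> u = z" by blast
    then show ?thesis
    proof cases
      case (3 x0)
      then have "u = x0" using assms(2) 1 \<sigma>inj unfolding bmem_iff by metis
      moreover have "gsub (bmem EB) x0 v" using 3(3) unfolding gsub_def bmem_iff by blast
      ultimately show ?thesis by blast
    qed (use 1 assms(2) \<sigma>z bmem_iff in metis)+
  next
    case 2
    from j4[of w] consider "\<sigma> w = w" | "\<forall>u. EL u (\<sigma> w) \<longleftrightarrow> EL u w \<or> u = z"
      | x0 where "\<forall>u. EL u (\<sigma> w) \<longleftrightarrow> u = w" "w = \<sigma> x0" "\<forall>u. EL u w \<longleftrightarrow> EL u x0 \<or> u = z" by blast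
    then show ?thesis
    proof cases
      case (3 x0)
      then have "bmem EB x0 v" "bmem EB u x0" using 2 assms(2) \<sigma>z unfolding bmem_iff by metis+
      then show ?thesis by blast
    qed (use 2 assms(2) \<sigma>z bmem_iff in metis)+
  qed
qed

lemma bmem_z: "\<not> bmem EB u z"
  using ELz bmem_iff by blast

end

section \<open>From ordinary to boolean sets\<close>

locale LTplus_structure = strat_level_theory DD TT E "\<lambda>_. True" for DD :: "((nat \<Rightarrow> 'a) \<Rightarrow> bool) \<Rightarrow> bool" and TT E
begin

lemma extL: "(\<And>u. E u x = E u y) \<Longrightarrow> x = y"
  using ext by blast

definition z :: 'a where "z = (SOME w. \<forall>u. \<not> E u w)"
definition tg :: "'a \<Rightarrow> 'a" where "tg x = (SOME y. \<forall>u. E u y \<longleftrightarrow> E u x \<or> u = z)"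
definition sn :: "'a \<Rightarrow> 'a" where "sn x = (SOME y. \<forall>u. E u y \<longleftrightarrow> u = x)"

lemma z: "\<not> E u z"
proof -
  have "DD (\<lambda>e. e 0 \<noteq> e 0)" by (intro ddl)
  from sep[of "\<lambda>x. x \<noteq> x", OF this] have "\<exists>w. \<forall>u. \<not> E u w" by blast
  from someI_ex[OF this] show ?thesis unfolding z_def by blast
qed

lemma adj_ex: "\<exists>b. \<forall>u. E u b \<longleftrightarrow> E u x \<or> u = y"
proof -
  obtain r where r: "levl r" "E x r" "E y r" using in_levl2 by blast
  have "DD (\<lambda>e. E (e 0) x \<or> e 0 = y)" by (intro ddl)
  moreover have "E u r" if "E u x \<or> u = y" for u using that r levl_transD[OF r(1,2)] by blast
  ultimately show ?thesis using bounded_set[of "\<lambda>u. E u x \<or> u = y" r] by blast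
qed

lemma tg: "E u (tg x) \<longleftrightarrow> E u x \<or> u = z"
  using someI_ex[OF adj_ex[of x z]] unfolding tg_def by blast

lemma sn: "E u (sn x) \<longleftrightarrow> u = x"
proof -
  have "\<exists>b. \<forall>u. E u b \<longleftrightarrow> u = x" using adj_ex[of z x] z by blast
  from someI_ex[OF this] show ?thesis unfolding sn_def by blast
qed

lemma tg_iff: "y = tg x \<longleftrightarrow> (\<forall>u. E u y \<longleftrightarrow> E u x \<or> u = z)"
  using tg extL[of y "tg x"] by metis

lemma sn_iff: "y = sn x \<longleftrightarrow> (\<forall>u. E u y \<longleftrightarrow> u = x)"
  using sn extL[of y "sn x"] by metis

lemma z_iff: "w = z \<longleftrightarrow> (\<forall>u. \<not> E u w)"
  using z extL[of w z] by metis

sublocale H: coding DD TT E "\<lambda>_. True" "\<lambda>y. \<not> E z y" z tg "\<lambda>x. sn (tg x)"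
proof
  show "DD (\<lambda>e. \<not> E z (e 0))" by (intro ddl)
  have 1: "DD (\<lambda>e. e (Suc 0) = tg (e 0))" unfolding tg_iff by (intro ddl)
  then show "DD (\<lambda>e. e (Suc 0) = tg (e 0))" .
  have "DD (\<lambda>e. \<exists>w. w = tg (e 0) \<and> e (Suc 0) = sn w)"
    unfolding sn_iff by (intro ddl DD_sub2[of "\<lambda>x y. y = tg x", OF 1])
  then show "DD (\<lambda>e. e (Suc 0) = sn (tg (e 0)))" by simp
  show "\<not> E x z" for x by (rule z)
  show "\<not> E z z" by (rule z)
  show "\<not> \<not> E z (tg x)" for x using tg by blast
  show "x = y" if "\<not> E z x" "\<not> E z y" "tg x = tg y" for x y
    using that tg by (intro extL) metis
  show "\<not> E z (sn (tg x))" if "\<not> E z x" for x using sn tg z by metis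
  show "x = y" if "\<not> E z x" "\<not> E z y" "sn (tg x) = sn (tg y)" for x y
  proof -
    have "tg x = tg y" using that(3) sn by metis
    then show ?thesis using that tg by (intro extL) metis
  qed
  show "sn (tg x) \<noteq> z" for x using sn z by metis
qed

abbreviation "\<sigma> \<equiv> H.\<sigma>"
abbreviation "EB \<equiv> bool_mem E"

lemma emp_iff: "is_empty E w \<longleftrightarrow> w = z"
  unfolding is_empty_def z_iff by blast

lemma tog_iff: "is_toggle E x y \<longleftrightarrow> y = tg x"
  unfolding is_toggle_def tg_iff emp_iff by blast

lemma sng_iff: "is_singleton E x y \<longleftrightarrow> y = sn x"
  unfolding is_singleton_def sn_iff by blast

lemma NL_iff: "NL E x \<longleftrightarrow> H.N x"
  unfolding NL_def H.N_def emp_iff tog_iff sng_iff by simp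

lemma sgL_iff: "sgL E x w \<longleftrightarrow> w = \<sigma> x"
  unfolding sgL_def H.\<sigma>_iff NL_iff tog_iff sng_iff by metis

lemma EB_iff: "EB x y \<longleftrightarrow> E (\<sigma> x) y \<noteq> E z y"
  unfolding bool_mem_def sgL_iff emp_iff by simp

text \<open>This makes self-membership mean exactly containing \<open>z\<close>. For each shape of
  \<open>\<sigma> y\<close>, its belonging to \<open>y\<close> would create a membership cycle of
  length at most two.\<close>

lemma \<sigma>_not_in: "\<not> E (\<sigma> y) y"
  by (rule H.\<sigma>_cases[of y]) (use m_irrefl m_asym tg sn in metis)+

sublocale J: linked E EB \<sigma> z
proof
  show "EB x y \<longleftrightarrow> E (\<sigma> x) y \<noteq> E z y" for x y by (rule EB_iff)
  show "EB y y \<longleftrightarrow> E z y" for y using EB_iff \<sigma>_not_in by blast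
  show "\<sigma> v = v \<or> (\<forall>u. E u (\<sigma> v) \<longleftrightarrow> E u v \<or> u = z) \<or>
      ((\<forall>u. E u (\<sigma> v) \<longleftrightarrow> u = v) \<and> (\<exists>x0. v = \<sigma> x0 \<and> (\<forall>u. E u v \<longleftrightarrow> E u x0 \<or> u = z)))" for v
  proof (rule H.\<sigma>_cases[of v])
    fix y assume y: "H.N y" "v = tg y" "\<sigma> v = sn (tg y)"
    then have "v = \<sigma> y" using H.\<sigma>_N by simp
    moreover have "\<forall>u. E u (\<sigma> v) \<longleftrightarrow> u = v" using y sn by simp
    moreover have "\<forall>u. E u v \<longleftrightarrow> E u y \<or> u = z" using y tg by simp
    ultimately show ?thesis by metis
  qed (use tg in simp)+
qed (use H.\<sigma>_z H.\<sigma>_inj H.\<sigma>_surj z in blast)+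

lemma DD_EB: "TT t \<Longrightarrow> TT u \<Longrightarrow> DD (\<lambda>e. EB (t e) (u e))"
proof (rule DD_sub2)
  have "DD (\<lambda>e. \<exists>w. w = \<sigma> (e 0) \<and> \<not> (E w (e (Suc 0)) \<longleftrightarrow> E z (e (Suc 0))))"
    by (intro ddl H.DD_\<sigma>)
  then show "DD (\<lambda>e. EB (e 0) (e (Suc 0)))" by (simp add: EB_iff)
qed

text \<open>The image under \<open>\<sigma>\<close> exists without Replacement: ranks rise by at
  most one level, so it is bounded by the second level after one that contains
  \<open>a\<close>.\<close>

lemma sigma_set: "DD (\<lambda>e. P (e 0)) \<Longrightarrow> \<exists>b. \<not> E z b \<and> (\<forall>x. E (\<sigma> x) b \<longleftrightarrow> E x a \<and> P x)"
proof -
  assume P: "DD (\<lambda>e. P (e 0))"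
  obtain r where r: "levl r" "E a r" using in_levl by blast
  have D: "DD (\<lambda>e. \<exists>x. E x a \<and> P x \<and> e 0 = \<sigma> x)"
    by (intro ddl H.DD_\<sigma> DD_sub1[OF P])
  have "E w (nxs 2 r)" if w: "\<exists>x. E x a \<and> P x \<and> w = \<sigma> x" for w
  proof -
    obtain x where x: "E x a" "w = \<sigma> x" using w by blast
    then have "gsub E x r" using levl_transD[OF r] levl_trans[OF r(1)] by blast
    moreover have R: "J.RR x w" using x(2) J.RR_def by simp
    ultimately have "gsub E w (nx r)" by (intro sub_shift[OF J.R_L[OF R] r(1) nx(1,2)[OF r(1)]])
    then show ?thesis using nx_mem[OF nx(1)[OF r(1)]] by (simp add: numeral_2_eq_2)
  qed
  from bounded_set[of "\<lambda>w. \<exists>x. E x a \<and> P x \<and> w = \<sigma> x", OF D this] obtain b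
    where b: "\<And>w. E w b \<longleftrightarrow> (\<exists>x. E x a \<and> P x \<and> w = \<sigma> x)" by blast
  have "\<not> E z b" unfolding b using H.\<sigma>_z by metis
  moreover have "\<forall>x. E (\<sigma> x) b \<longleftrightarrow> E x a \<and> P x" unfolding b using H.\<sigma>_inj by metis
  ultimately show ?thesis by blast
qed

text \<open>The displacement of ranks is symmetric, so preimages are bounded like images.\<close>

lemma unsigma_set: "\<exists>b. \<forall>x. E x b \<longleftrightarrow> E (\<sigma> x) a"
proof -
  obtain r where r: "levl r" "E a r" using in_levl by blast
  have "DD (\<lambda>e. \<exists>w. w = \<sigma> (e 0) \<and> E w a)" by (intro ddl H.DD_\<sigma>)
  then have D: "DD (\<lambda>e. E (\<sigma> (e 0)) a)" by simp
  have "E w (nxs 2 r)" if w: "E (\<sigma> w) a" for w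
  proof -
    have "gsub E (\<sigma> w) r" using levl_transD[OF r w] levl_trans[OF r(1)] by blast
    moreover have R: "J.RR (\<sigma> w) w" using J.RR_def by simp
    ultimately have "gsub E w (nx r)" by (intro sub_shift[OF J.R_L[OF R] r(1) nx(1,2)[OF r(1)]])
    then show ?thesis using nx_mem[OF nx(1)[OF r(1)]] by (simp add: numeral_2_eq_2)
  qed
  from bounded_set[of "\<lambda>w. E (\<sigma> w) a", OF D this] show ?thesis by blast
qed

sublocale B: definable_boolean_sets DD TT EB
proof
  show "DD (\<lambda>e. EB (t e) (u e))" if "TT t" "TT u" for t u by (rule DD_EB) fact+
  \<comment> \<open>Complementation toggles \<open>z\<close> and leaves membership of the values of
    \<open>\<sigma>\<close> alone.\<close>
  have cmpl: "\<exists>c. (\<forall>x. E (\<sigma> x) c \<longleftrightarrow> E (\<sigma> x) a) \<and> (E z c \<longleftrightarrow> \<not> E z a)" for a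
  proof (cases "E z a")
    case True
    have "DD (\<lambda>e. e 0 \<noteq> z)" by (intro ddl)
    from sep[of "\<lambda>x. x \<noteq> z", OF this, of a] show ?thesis using True H.\<sigma>_z by blast
  next
    case False
    then show ?thesis using tg[of _ a] H.\<sigma>_z by metis
  qed
  show "\<exists>c. (\<forall>x. EB x c \<longleftrightarrow> \<not> EB x a) \<and> (\<not> EB a a \<longleftrightarrow> EB c c)" for a
    using cmpl[of a] unfolding J.j2 EB_iff by metis
  show "x = y" if eq: "\<And>v. EB v x = EB v y" for x y
  proof (cases "E z x = E z y")
    case True
    then have "E (\<sigma> v) x = E (\<sigma> v) y" for v using eq[of v] EB_iff by blast
    then show ?thesis using True H.\<sigma>_surj by (intro extL) metis
  next
    case False
    then have n: "E (\<sigma> v) x \<noteq> E (\<sigma> v) y" for v using eq[of v] EB_iff by blast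
    \<comment> \<open>If just one of \<open>x\<close> and \<open>y\<close> is high, each value of
      \<open>\<sigma>\<close> belongs to exactly one of them; but a level above both is such a value
      and belongs to neither.\<close>
    obtain r where r: "levl r" "E x r" "E y r" using in_levl2 by blast
    have "r \<noteq> z" using r z by blast
    then obtain v where "r = \<sigma> v" using H.\<sigma>_surj by blast
    then show ?thesis using n[of v] levl_irrefl[OF r(1)] levl_transD[OF r(1,2)] levl_transD[OF r(1,3)] by blast
  qed
  show "\<exists>b. \<not> EB b b \<and> (\<forall>x. EB x b \<longleftrightarrow> Q x \<and> EB x a)" if Q: "DD (\<lambda>e. Q (e 0))" and a: "\<not> EB a a" for Q a
  proof -
    obtain a' where a': "\<And>x. E x a' \<longleftrightarrow> E (\<sigma> x) a" using unsigma_set by metis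
    obtain b where "\<not> E z b" "\<And>x. E (\<sigma> x) b \<longleftrightarrow> E x a' \<and> Q x" using sigma_set[OF Q] by metis
    then show ?thesis using a a' unfolding J.j2 EB_iff by (intro exI[of _ b]) metis
  qed
qed

lemma same_LB: "\<exists>b. low EB b \<and> (\<forall>x. bmem EB x b \<longleftrightarrow> E x a)"
proof -
  have "DD (\<lambda>e. e 0 = e 0)" by (intro ddl)
  from sigma_set[of "\<lambda>x. x = x", OF this, of a] show ?thesis
    unfolding J.bmem_iff J.low_iff by simp
qed

sublocale two: two_structures DD TT E "\<lambda>_. True" "bmem EB" "low EB" z J.RR
proof -
  interpret BL: level_theory DD TT "bmem EB" "low EB" by (rule B.lev_B)
  show "two_structures DD TT E (\<lambda>_. True) (bmem EB) (low EB) z J.RR"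
    by unfold_locales (fact z J.bmem_z J.A_L J.A_B J.RR_sym J.R_L J.R_B same_LB)+
qed

sublocale BF: strat_level_theory DD TT "bmem EB" "low EB"
  by unfold_locales (fact two.strat2 two.endless2)+

section \<open>Recovering ordinary membership from the defined boolean relation\<close>

lemma sng_EB: "is_singleton EB y w \<longleftrightarrow> w = sn (\<sigma> y)"
proof -
  have "EB u (sn (\<sigma> y)) \<longleftrightarrow> u = y" for u
    unfolding EB_iff sn using H.\<sigma>_inj H.\<sigma>_z by metis
  then show ?thesis unfolding is_singleton_def using B.extB[of w "sn (\<sigma> y)"] by metis
qed

lemma emp_EB: "is_empty EB w \<longleftrightarrow> w = z"
proof -
  have "\<not> EB u z" for u using EB_iff z by blast
  then show ?thesis unfolding is_empty_def using B.extB[of w z] by metis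
qed

lemma cmp_EB: "\<not> E z x \<Longrightarrow> is_complement EB x w \<longleftrightarrow> w = tg x"
proof -
  assume x: "\<not> E z x"
  have "EB u (tg x) \<longleftrightarrow> \<not> EB u x" for u
    unfolding EB_iff tg using x H.\<sigma>_z by metis
  then show ?thesis unfolding is_complement_def using B.extB[of w "tg x"] by metis
qed

text \<open>Low boolean sets and ordinary sets have the same extensions. This turns the quantifier
  of \<open>NB\<close> over low sets into one over ordinary sets.\<close>

lemma low_sets:
  "(\<forall>u. \<not> EB u u \<longrightarrow> P (\<lambda>x. EB x u)) \<longleftrightarrow> (\<forall>u. P (\<lambda>x. E x u))"
proof
  assume P: "\<forall>u. \<not> EB u u \<longrightarrow> P (\<lambda>x. EB x u)"
  show "\<forall>u. P (\<lambda>x. E x u)"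
  proof
    fix u
    obtain b where b: "low EB b" "\<And>x. bmem EB x b \<longleftrightarrow> E x u" using same_LB by metis
    then have "\<not> EB b b" "(\<lambda>x. EB x b) = (\<lambda>x. E x u)" unfolding low_def by (auto simp: B.bmem_of_low)
    then show "P (\<lambda>x. E x u)" using P by metis
  qed
next
  assume P: "\<forall>u. P (\<lambda>x. E x u)"
  show "\<forall>u. \<not> EB u u \<longrightarrow> P (\<lambda>x. EB x u)"
  proof (intro allI impI)
    fix u assume u: "\<not> EB u u"
    obtain b where b: "\<And>x. E x b \<longleftrightarrow> E (\<sigma> x) u" using unsigma_set by metis
    then have "(\<lambda>x. EB x u) = (\<lambda>x. E x b)" using u J.j2 EB_iff by blast
    then show "P (\<lambda>x. EB x u)" using P by metis
  qed
qed

text \<open>The boolean singleton of \<open>y\<close> is \<open>sn (\<sigma> y)\<close>. It agrees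
  with \<open>sn (tg y)\<close> on the orbit, and any level that contains it contains
  \<open>y\<close>, so \<open>N_agree\<close> applies.\<close>

lemma NB_EB: "NB EB x \<longleftrightarrow> H.N x"
proof -
  let ?s = "\<lambda>y. sn (\<sigma> y)"
  have "NB EB x \<longleftrightarrow> (\<forall>u. \<not> EB u u \<longrightarrow> EB x u \<and> (\<forall>y. \<not> E z y \<and> EB (?s y) u \<longrightarrow> EB y u) \<longrightarrow> EB z u)"
    unfolding NB_def sng_EB emp_EB J.j2 by (simp add: imp_conjL)
  also have "\<dots> \<longleftrightarrow> (\<forall>u. E x u \<and> (\<forall>y. \<not> E z y \<and> E (?s y) u \<longrightarrow> E y u) \<longrightarrow> E z u)"
    by (rule low_sets[of "\<lambda>X. X x \<and> (\<forall>y. \<not> E z y \<and> X (?s y) \<longrightarrow> X y) \<longrightarrow> X z"])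
  also have "\<dots> \<longleftrightarrow> (\<forall>u. True \<and> E x u \<and> (\<forall>y. \<not> E z y \<and> E (?s y) u \<longrightarrow> E y u) \<longrightarrow> E z u)" by simp
  also have "\<dots> \<longleftrightarrow> H.N x"
  proof (rule H.N_agree)
    show "?s y = sn (tg y)" if "H.N y" for y using H.\<sigma>_N[OF that] by simp
    show "E y r" if "levl r" "E (?s y) r" for y r
    proof -
      have 1: "E (\<sigma> y) r" using levl_transD[OF that] sn by blast
      show ?thesis
        by (rule H.\<sigma>_cases[of y]) (use 1 levl_transD[OF that(1) 1] levl_potent[OF that(1) 1, of y] tg sn in \<open>simp_all add: gsub_def\<close>)
    qed
  qed
  finally show ?thesis .
qed

lemma sgB_EB: "sgB EB x w \<longleftrightarrow> w = \<sigma> x"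
proof -
  have 1: "H.N y \<and> is_complement EB y x \<longleftrightarrow> H.N y \<and> x = tg y" for x y using cmp_EB H.N_L by blast
  have 2: "H.N y \<and> x = tg y \<and> w = sn (\<sigma> y) \<longleftrightarrow> H.N y \<and> x = tg y \<and> w = sn (tg y)" for y
    using H.\<sigma>_N by auto
  have 3: "H.N y \<and> is_complement EB y x \<and> is_singleton EB y w \<longleftrightarrow> H.N y \<and> x = tg y \<and> w = sn (tg y)" for y
    using 1[of y x] 2[of y] sng_EB by blast
  show ?thesis
    unfolding sgB_def H.\<sigma>_iff NB_EB 1 3 by blast
qed

theorem ord_mem_bool_mem: "ord_mem EB = E"
proof (intro HOL.ext)
  fix w y
  have "ord_mem EB w y \<longleftrightarrow> w = z \<and> E z y \<or> (\<exists>x. w = \<sigma> x \<and> E (\<sigma> x) y)"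
    unfolding ord_mem_def emp_EB sgB_EB J.j2 using EB_iff by blast
  also have "\<dots> \<longleftrightarrow> E w y" using H.\<sigma>_surj by metis
  finally show "ord_mem EB w y = E w y" .
qed

end

section \<open>From boolean to ordinary sets\<close>

locale BLTplus_structure = definable_boolean_sets DD TT E + strat_level_theory DD TT "bmem E" "low E" for DD :: "((nat \<Rightarrow> 'a) \<Rightarrow> bool) \<Rightarrow> bool" and TT E
begin

abbreviation "mm \<equiv> bmem E"

definition z :: 'a where "z = (SOME w. \<forall>u. \<not> E u w)"
definition co :: "'a \<Rightarrow> 'a" where "co x = (SOME y. \<forall>u. E u y \<longleftrightarrow> \<not> E u x)"
definition sn :: "'a \<Rightarrow> 'a" where "sn x = (SOME y. \<forall>u. E u y \<longleftrightarrow> u = x)"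

lemma z: "\<not> E u z"
proof -
  have "DD (\<lambda>e. e 0 \<noteq> e 0)" by (intro ddl)
  from sep[of "\<lambda>x. x \<noteq> x", OF this] have "\<exists>w. \<forall>u. \<not> E u w" unfolding low_def bmem_def by blast
  from someI_ex[OF this] show ?thesis unfolding z_def by blast
qed

lemma mz: "\<not> mm u z"
  using z unfolding bmem_def by blast

lemma co: "E u (co x) \<longleftrightarrow> \<not> E u x"
proof -
  have "\<exists>y. \<forall>u. E u y \<longleftrightarrow> \<not> E u x" using compB[of x] by blast
  from someI_ex[OF this] show ?thesis unfolding co_def by blast
qed

lemma co_iff: "y = co x \<longleftrightarrow> (\<forall>u. E u y \<longleftrightarrow> \<not> E u x)"
  using co extB[of y "co x"] by metis

lemma co_low: "E (co x) (co x) \<longleftrightarrow> \<not> E x x"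
proof -
  obtain c where c: "\<forall>u. E u c \<longleftrightarrow> \<not> E u x" "\<not> E x x \<longleftrightarrow> E c c" using compB[of x] by blast
  then have "c = co x" using co_iff by blast
  then show ?thesis using c(2) by blast
qed

lemma co_mm: "mm u (co x) \<longleftrightarrow> mm u x"
  using co co_low unfolding bmem_def by metis

lemma sn: "E u (sn x) \<longleftrightarrow> u = x" and sn_low: "\<not> E (sn x) (sn x)"
proof -
  obtain r where "mm x r" using in_levl by blast
  moreover have "DD (\<lambda>e. e 0 = x)" by (intro ddl)
  ultimately obtain b where b: "low E b" "\<And>u. mm u b \<longleftrightarrow> u = x" using bounded_set[of "\<lambda>u. u = x" r] by blast
  then have b': "\<not> E b b" "\<forall>u. E u b \<longleftrightarrow> u = x" unfolding low_def bmem_def by blast+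
  from someI[of "\<lambda>y. \<forall>u. E u y \<longleftrightarrow> u = x", OF b'(2)] have s: "\<forall>u. E u (sn x) \<longleftrightarrow> u = x"
    unfolding sn_def .
  then show "E u (sn x) \<longleftrightarrow> u = x" by blast
  have "sn x = b" using s b' by (intro extB) blast
  then show "\<not> E (sn x) (sn x)" using b' by blast
qed

lemma sn_iff: "y = sn x \<longleftrightarrow> (\<forall>u. E u y \<longleftrightarrow> u = x)"
  using sn extB[of y "sn x"] by metis

lemma sn_mm: "mm u (sn x) \<longleftrightarrow> u = x"
  using sn sn_low unfolding bmem_def by blast

lemma z_iff: "w = z \<longleftrightarrow> (\<forall>u. \<not> E u w)"
  using z extB[of w z] by metis

lemmas ddb = ddl DD_E

sublocale H: coding DD TT mm "low E" "low E" z co sn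
proof
  show "DD (\<lambda>e. low E (e 0))" by (intro ddl)
  show "DD (\<lambda>e. e (Suc 0) = co (e 0))" unfolding co_iff by (intro ddb)
  show "DD (\<lambda>e. e (Suc 0) = sn (e 0))" unfolding sn_iff by (intro ddb)
  show "\<not> mm x z" for x by (rule mz)
  show "low E z" using z unfolding low_def by blast
  show "\<not> low E (co x)" if "low E x" for x using that co_low unfolding low_def by blast
  show "x = y" if "co x = co y" for x y using that co by (intro extB) metis
  show "low E (sn x)" for x using sn_low unfolding low_def by blast
  show "x = y" if "sn x = sn y" for x y using that sn by metis
  show "sn x \<noteq> z" for x using sn z by metis
qed

abbreviation "\<sigma> \<equiv> H.\<sigma>"
abbreviation "EL \<equiv> ord_mem E"

lemma emp_iff: "is_empty E w \<longleftrightarrow> w = z"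
  unfolding is_empty_def z_iff by blast

lemma sng_iff: "is_singleton E x y \<longleftrightarrow> y = sn x"
  unfolding is_singleton_def sn_iff by blast

lemma cmp_iff: "is_complement E x y \<longleftrightarrow> y = co x"
  unfolding is_complement_def co_iff by blast

lemma NB_iff: "NB E x \<longleftrightarrow> H.N x"
proof -
  have "NB E x \<longleftrightarrow> (\<forall>u. \<not> E u u \<longrightarrow> E x u \<and> (\<forall>y. \<not> E y y \<and> E (sn y) u \<longrightarrow> E y u) \<longrightarrow> E z u)"
    unfolding NB_def emp_iff sng_iff by (simp add: imp_conjL)
  also have "\<dots> \<longleftrightarrow> (\<forall>u. \<not> E u u \<longrightarrow> mm x u \<and> (\<forall>y. \<not> E y y \<and> mm (sn y) u \<longrightarrow> mm y u) \<longrightarrow> mm z u)"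
    by (simp add: bmem_def)
  also have "\<dots> \<longleftrightarrow> H.N x" unfolding H.N_def low_def by (simp add: imp_conjL)
  finally show ?thesis .
qed

lemma sgB_iff: "sgB E x w \<longleftrightarrow> w = \<sigma> x"
  unfolding sgB_def H.\<sigma>_iff NB_iff cmp_iff sng_iff by blast

lemma EL_iff: "EL w y \<longleftrightarrow> w = z \<and> E y y \<or> (\<exists>x. w = \<sigma> x \<and> mm x y)"
  unfolding ord_mem_def sgB_iff emp_iff bmem_def by blast

lemma EL_\<sigma>: "EL (\<sigma> x) y \<longleftrightarrow> mm x y"
  unfolding EL_iff using H.\<sigma>_z H.\<sigma>_inj by metis

lemma EL_z: "EL z y \<longleftrightarrow> E y y"
  unfolding EL_iff using H.\<sigma>_z by metis

lemma EL_cases: "w = z \<or> (\<exists>x. w = \<sigma> x)"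
  using H.\<sigma>_surj by blast

lemma EL_co: "\<not> E v v \<Longrightarrow> EL u (co v) \<longleftrightarrow> EL u v \<or> u = z"
  using EL_cases[of u] EL_\<sigma> EL_z co_mm co_low by metis

lemma EL_sn: "EL u (sn x) \<longleftrightarrow> u = \<sigma> x"
  using EL_cases[of u] EL_\<sigma> EL_z sn_mm sn_low H.\<sigma>_inj H.\<sigma>_z by metis

lemma N_low: "H.N x \<Longrightarrow> \<not> E x x"
  using H.N_L unfolding low_def by blast

sublocale J: linked EL E \<sigma> z
proof
  show "E x y \<longleftrightarrow> EL (\<sigma> x) y \<noteq> EL z y" for x y unfolding EL_\<sigma> EL_z bmem_def by blast
  show "E y y \<longleftrightarrow> EL z y" for y unfolding EL_z by blast
  show "\<not> EL u z" for u unfolding EL_iff using z mz by blast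
  show "\<sigma> v = v \<or> (\<forall>u. EL u (\<sigma> v) \<longleftrightarrow> EL u v \<or> u = z) \<or>
      ((\<forall>u. EL u (\<sigma> v) \<longleftrightarrow> u = v) \<and> (\<exists>x0. v = \<sigma> x0 \<and> (\<forall>u. EL u v \<longleftrightarrow> EL u x0 \<or> u = z)))" for v
  proof (rule H.\<sigma>_cases[of v])
    fix y assume y: "H.N y" "v = co y" "\<sigma> v = sn y"
    then have "v = \<sigma> y" using H.\<sigma>_N by simp
    moreover have "\<forall>u. EL u (\<sigma> v) \<longleftrightarrow> u = v" using y EL_sn calculation by simp
    moreover have "\<forall>u. EL u v \<longleftrightarrow> EL u y \<or> u = z" using y EL_co[OF N_low[OF y(1)]] by simp
    ultimately show ?thesis by metis
  qed (use EL_co N_low in simp)+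
qed (use H.\<sigma>_z H.\<sigma>_inj H.\<sigma>_surj in blast)+

lemma DD_EL: "TT t \<Longrightarrow> TT u \<Longrightarrow> DD (\<lambda>e. EL (t e) (u e))"
proof (rule DD_sub2)
  show "DD (\<lambda>e. EL (e 0) (e (Suc 0)))" unfolding EL_iff by (intro ddb H.DD_\<sigma>)
qed

text \<open>Complementation changes the sign of a low set but not its low part, so every bounded
  class occurs with either sign.\<close>

lemma signed_set:
  assumes "DD (\<lambda>e. P (e 0))" "\<And>x. P x \<Longrightarrow> mm x r"
  shows "\<exists>b. (\<forall>x. mm x b \<longleftrightarrow> P x) \<and> (E b b \<longleftrightarrow> S)"
proof -
  obtain b where b: "low E b" "\<And>x. mm x b \<longleftrightarrow> P x" using bounded_set[OF assms] by metis
  then show ?thesis using co_mm[of _ b] co_low[of b] unfolding low_def by metis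
qed

text \<open>An ordinary set is assembled from a low part and a sign: the low part collects preimages
  under \<open>\<sigma>\<close>, and the sign records whether \<open>z\<close> belongs.\<close>

lemma unsigma_set: "DD (\<lambda>e. P (e 0)) \<Longrightarrow> \<exists>b. \<forall>x. EL x b \<longleftrightarrow> mm x a \<and> P x"
proof -
  assume P: "DD (\<lambda>e. P (e 0))"
  obtain r where r: "levl r" "mm a r" using in_levl by blast
  have "DD (\<lambda>e. \<exists>w. w = \<sigma> (e 0) \<and> mm w a \<and> P w)" by (intro ddl H.DD_\<sigma> DD_sub1[OF P])
  then have D: "DD (\<lambda>e. mm (\<sigma> (e 0)) a \<and> P (\<sigma> (e 0)))" by simp
  have "mm w (nxs 2 r)" if w: "mm (\<sigma> w) a \<and> P (\<sigma> w)" for w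
  proof -
    have "gsub mm (\<sigma> w) r" using levl_transD[OF r] w levl_trans[OF r(1)] by blast
    moreover have R: "J.RR (\<sigma> w) w" using J.RR_def by simp
    ultimately have "gsub mm w (nx r)" by (intro sub_shift[OF J.R_B[OF R] r(1) nx(1,2)[OF r(1)]])
    then show ?thesis using nx_mem[OF nx(1)[OF r(1)]] by (simp add: numeral_2_eq_2)
  qed
  from signed_set[of "\<lambda>w. mm (\<sigma> w) a \<and> P (\<sigma> w)", OF D this, of "mm z a \<and> P z"] obtain b
    where "\<And>x. mm x b \<longleftrightarrow> mm (\<sigma> x) a \<and> P (\<sigma> x)" "E b b \<longleftrightarrow> mm z a \<and> P z" by metis
  then have "\<forall>x. EL x b \<longleftrightarrow> mm x a \<and> P x" using EL_cases EL_\<sigma> EL_z by metis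
  then show ?thesis by blast
qed

lemma same_BL: "\<exists>b. True \<and> (\<forall>x. EL x b \<longleftrightarrow> mm x a)"
proof -
  have "DD (\<lambda>e. e 0 = e 0)" by (intro ddl)
  from unsigma_set[of "\<lambda>x. x = x", OF this, of a] show ?thesis by simp
qed

lemma sigma_set: "\<exists>b. low E b \<and> (\<forall>x. mm x b \<longleftrightarrow> EL x a)"
proof -
  obtain r where r: "levl r" "mm a r" using in_levl by blast
  have D: "DD (\<lambda>e. EL (e 0) a)" by (intro ddl DD_EL)
  have "mm w (nxs 2 r)" if w: "EL w a" for w
  proof -
    have 1: "gsub mm w (nx r)"
    proof (cases "w = z")
      case True
      then show ?thesis using mz unfolding gsub_def by blast
    next
      case False
      then obtain x where x: "w = \<sigma> x" "mm x a" using w EL_iff by blast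
      then have "gsub mm x r" using levl_transD[OF r] levl_trans[OF r(1)] by blast
      moreover have R: "J.RR x w" using x(1) J.RR_def by simp
      ultimately show ?thesis by (intro sub_shift[OF J.R_B[OF R] r(1) nx(1,2)[OF r(1)]])
    qed
    then show ?thesis using nx_mem[OF nx(1)[OF r(1)]] by (simp add: numeral_2_eq_2)
  qed
  from bounded_set[of "\<lambda>w. EL w a", OF D this] show ?thesis by blast
qed

lemma EL_ext: "(\<And>u. EL u x = EL u y) \<Longrightarrow> x = y"
proof -
  assume eq: "\<And>u. EL u x = EL u y"
  have "E x x = E y y" "\<And>u. mm u x = mm u y" using eq EL_z EL_\<sigma> by metis+
  then show ?thesis by (intro extB) (auto simp: bmem_def)
qed

lemma EL_sep: "DD (\<lambda>e. Q (e 0)) \<Longrightarrow> \<exists>b. True \<and> (\<forall>x. EL x b \<longleftrightarrow> EL x a \<and> Q x)"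
proof -
  assume Q: "DD (\<lambda>e. Q (e 0))"
  obtain b where b: "\<And>x. mm x b \<longleftrightarrow> EL x a" using sigma_set[of a] by metis
  obtain c where "\<And>x. EL x c \<longleftrightarrow> mm x b \<and> Q x" using unsigma_set[OF Q, of b] by metis
  then show ?thesis using b by blast
qed

lemma lev_L: "level_theory DD TT EL (\<lambda>_. True)"
proof unfold_locales
  show "DD (\<lambda>e. EL (t e) (u e))" if "TT t" "TT u" for t u by (rule DD_EL) fact+
  have "DD (\<lambda>e. e 0 = e 0)" by (intro ddl)
  then show "DD (\<lambda>e. True)" by simp
  show "x = y" if "\<And>u. EL u x = EL u y" for x y using EL_ext that by blast
qed (rule EL_sep)

sublocale two: two_structures DD TT mm "low E" EL "\<lambda>_. True" z J.RR
proof -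
  interpret LL: level_theory DD TT EL "\<lambda>_. True" by (rule lev_L)
  show "two_structures DD TT mm (low E) EL (\<lambda>_. True) z J.RR"
    by unfold_locales (fact mz J.ELz J.A_B' J.A_L' J.RR_sym J.R_L J.R_B same_BL)+
qed

sublocale LF: strat_level_theory DD TT EL "\<lambda>_. True"
  by unfold_locales (fact two.strat2 two.endless2)+

section \<open>Recovering boolean membership from the defined ordinary relation\<close>

lemma emp_EL: "is_empty EL w \<longleftrightarrow> w = z"
  unfolding is_empty_def using J.ELz EL_ext[of w z] by metis

lemma tog_EL: "\<not> E x x \<Longrightarrow> is_toggle EL x y \<longleftrightarrow> y = co x"
  unfolding is_toggle_def emp_EL using EL_co[of x] EL_ext[of y "co x"] by metis

lemma sng_EL: "is_singleton EL (\<sigma> x) y \<longleftrightarrow> y = sn x"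
  unfolding is_singleton_def using EL_sn EL_ext[of y "sn x"] by metis

text \<open>The inverse of \<open>\<sigma>\<close>. The ordinary singleton of
  \<open>\<sigma> x\<close> is the boolean singleton of \<open>x\<close>, so that of
  \<open>co y\<close> is \<open>sn (\<tau> (co y))\<close>.\<close>

definition \<tau> :: "'a \<Rightarrow> 'a" where "\<tau> w = (SOME x. w = \<sigma> x)"

lemma \<tau>: "\<not> E x x \<Longrightarrow> co x = \<sigma> (\<tau> (co x))"
proof -
  assume x: "\<not> E x x"
  then have "co x \<noteq> z" using co_low z by metis
  then have "\<exists>y. co x = \<sigma> y" using H.\<sigma>_surj by blast
  then show ?thesis unfolding \<tau>_def by (rule someI_ex)
qed

lemma all_sets:
  "(\<forall>u. low E u \<longrightarrow> P (\<lambda>x. mm x u)) \<longleftrightarrow> (\<forall>u. P (\<lambda>x. EL x u))"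
proof
  assume P: "\<forall>u. low E u \<longrightarrow> P (\<lambda>x. mm x u)"
  show "\<forall>u. P (\<lambda>x. EL x u)"
  proof
    fix u
    obtain b where b: "low E b" "\<And>x. mm x b \<longleftrightarrow> EL x u" using sigma_set by metis
    then have "(\<lambda>x. mm x b) = (\<lambda>x. EL x u)" by auto
    then show "P (\<lambda>x. EL x u)" using P b(1) by metis
  qed
next
  assume P: "\<forall>u. P (\<lambda>x. EL x u)"
  show "\<forall>u. low E u \<longrightarrow> P (\<lambda>x. mm x u)"
  proof (intro allI impI)
    fix u
    obtain b where b: "\<And>x. EL x b \<longleftrightarrow> mm x u" using same_BL by metis
    then have "(\<lambda>x. mm x u) = (\<lambda>x. EL x b)" by auto
    then show "P (\<lambda>x. mm x u)" using P by metis
  qed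
qed

text \<open>Toggling and taking the ordinary singleton yields \<open>sn (\<tau> (co y))\<close>,
  which equals \<open>sn y\<close> only as long as \<open>\<sigma> y\<close> is \<open>co y\<close>.
  \<open>N_agree\<close> covers the rest, once each level containing this singleton is seen to
  contain \<open>y\<close>.\<close>

lemma NL_EL: "NL EL x \<longleftrightarrow> H.N x"
proof -
  let ?s = "\<lambda>y. sn (\<tau> (co y))"
  have *: "(\<forall>w. is_empty EL w \<longrightarrow> \<not> EL w y) \<and> is_toggle EL y y1 \<and> is_singleton EL y1 y2 \<longleftrightarrow> \<not> E y y \<and> y1 = co y \<and> y2 = ?s y" for y y1 y2
    unfolding emp_EL using EL_z tog_EL \<tau> sng_EL by metis
  have "NL EL x \<longleftrightarrow> (\<forall>u. EL x u \<and> (\<forall>y y1 y2. ((\<forall>w. is_empty EL w \<longrightarrow> \<not> EL w y) \<and> is_toggle EL y y1 \<and> is_singleton EL y1 y2) \<and> EL y2 u \<longrightarrow> EL y u)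
     \<longrightarrow> EL z u)"
    unfolding NL_def emp_EL by simp
  also have "\<dots> \<longleftrightarrow> (\<forall>u. EL x u \<and> (\<forall>y. low E y \<and> EL (?s y) u \<longrightarrow> EL y u) \<longrightarrow> EL z u)"
    unfolding * low_def by simp
  also have "\<dots> \<longleftrightarrow> (\<forall>u. low E u \<longrightarrow> mm x u \<and> (\<forall>y. low E y \<and> mm (?s y) u \<longrightarrow> mm y u) \<longrightarrow> mm z u)"
    by (rule all_sets[of "\<lambda>X. X x \<and> (\<forall>y. low E y \<and> X (?s y) \<longrightarrow> X y) \<longrightarrow> X z", symmetric])
  also have "\<dots> \<longleftrightarrow> (\<forall>u. low E u \<and> mm x u \<and> (\<forall>y. low E y \<and> mm (?s y) u \<longrightarrow> mm y u) \<longrightarrow> mm z u)"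
    by (simp add: imp_conjL)
  also have "\<dots> \<longleftrightarrow> H.N x"
  proof (rule H.N_agree)
    show "?s y = sn y" if "H.N y" for y
      using \<tau>[OF N_low[OF that]] H.\<sigma>_N[OF that] H.\<sigma>_inj by metis
    show "mm y r" if y: "low E y" and r: "levl r" and s: "mm (?s y) r" for y r
    proof -
      let ?v = "\<tau> (co y)"
      have v: "mm ?v r" using levl_transD[OF r s] sn_mm by blast
      have yl: "\<not> E y y" using y unfolding low_def .
      note t = \<tau>[OF yl]
      show ?thesis
      proof (rule H.\<sigma>_cases[of ?v])
        assume "\<sigma> ?v = co ?v"
        then have "co y = co ?v" using t by simp
        then have "y = ?v" using co by (intro extB) metis
        then show ?thesis using v by simp
      next
        fix x assume "\<sigma> ?v = sn x"
        \<comment> \<open>This shape is impossible: \<open>co y\<close> is high, whereas singletons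
          are low.\<close>
        then have "E (sn x) (sn x)" using t co_low[of y] yl by simp
        then show ?thesis using sn_low by blast
      next
        assume "\<sigma> ?v = ?v"
        then have "mm (co y) r" using v t by simp
        then show ?thesis using levl_potent[OF r, of "co y" y] co_mm unfolding gsub_def by blast
      qed
    qed
  qed
  finally show ?thesis .
qed

lemma sgL_EL: "sgL EL x w \<longleftrightarrow> w = \<sigma> x"
proof -
  have 1: "H.N y \<and> is_toggle EL y x \<longleftrightarrow> H.N y \<and> x = co y" for x y using tog_EL N_low by blast
  have 2: "(\<exists>y. H.N y \<and> x = co y) \<and> is_singleton EL x w \<longleftrightarrow> (\<exists>y. H.N y \<and> x = co y \<and> w = sn y)"
    using sng_EL H.\<sigma>_N by metis
  show ?thesis
    unfolding sgL_def H.\<sigma>_iff NL_EL 1 2 by blast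
qed

theorem bool_mem_ord_mem: "bool_mem EL = E"
proof (intro HOL.ext)
  fix x y
  show "bool_mem EL x y = E x y"
    unfolding bool_mem_def sgL_EL emp_EL using J.j1[of x y] by blast
qed

end

section \<open>Named semantics\<close>

primrec nv :: "(nat \<Rightarrow> 'a) \<Rightarrow> (nat \<Rightarrow> 'a \<Rightarrow> 'a) \<Rightarrow> ntrm \<Rightarrow> 'a" where
  "nv e f (NV n) = e n"
| "nv e f (NAp g t) = f g (nv e f t)"

primrec nsat :: "('a \<Rightarrow> 'a \<Rightarrow> bool) \<Rightarrow> ('a \<Rightarrow> 'a \<Rightarrow> bool) \<Rightarrow> ('a \<Rightarrow> bool) set \<Rightarrow> ('a \<Rightarrow> 'a) set \<Rightarrow>
    (nat \<Rightarrow> 'a) \<Rightarrow> (nat \<Rightarrow> 'a \<Rightarrow> bool) \<Rightarrow> (nat \<Rightarrow> 'a \<Rightarrow> 'a) \<Rightarrow> nfm \<Rightarrow> bool" where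
  "nsat Q E PP FF e p f (NMem s t) = E (nv e f s) (nv e f t)"
| "nsat Q E PP FF e p f (NEq s t) = Q (nv e f s) (nv e f t)"
| "nsat Q E PP FF e p f (NPA i t) = p i (nv e f t)"
| "nsat Q E PP FF e p f NBot = False"
| "nsat Q E PP FF e p f (NImp \<phi> \<psi>) = (nsat Q E PP FF e p f \<phi> \<longrightarrow> nsat Q E PP FF e p f \<psi>)"
| "nsat Q E PP FF e p f (NAll n \<phi>) = (\<forall>x. nsat Q E PP FF (e(n := x)) p f \<phi>)"
| "nsat Q E PP FF e p f (NAllP n \<phi>) = (\<forall>X\<in>PP. nsat Q E PP FF e (p(n := X)) f \<phi>)"
| "nsat Q E PP FF e p f (NAllF n \<phi>) = (\<forall>g\<in>FF. nsat Q E PP FF e p (f(n := g)) \<phi>)"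

lemma scons_idx: "(\<lambda>n. scons a e (idx (x # vs) n)) = (\<lambda>n. e (idx vs n))(x := a)"
  by (auto simp: fun_eq_iff)

lemma tv_dbT: "tv e f (dbT vs fs t) = nv (\<lambda>n. e (idx vs n)) (\<lambda>n. f (idx fs n)) t"
  by (induction t) auto

lemma sat_db: "sat Q E PP FF e p f (db vs ps fs \<phi>) =
    nsat Q E PP FF (\<lambda>n. e (idx vs n)) (\<lambda>n. p (idx ps n)) (\<lambda>n. f (idx fs n)) \<phi>"
  by (induction \<phi> arbitrary: vs ps fs e p f) (simp_all add: tv_dbT scons_idx del: idx.simps(2))

lemma sat_sent: "sat Q E PP FF e p f (sent \<phi>) = nsat Q E PP FF e p f \<phi>"
  by (simp add: sent_def sat_db)

lemma nsat_derived [simp]: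
  "nsat Q E PP FF e p f (NNot \<phi>) = (\<not> nsat Q E PP FF e p f \<phi>)"
  "nsat Q E PP FF e p f (NAnd \<phi> \<psi>) = (nsat Q E PP FF e p f \<phi> \<and> nsat Q E PP FF e p f \<psi>)"
  "nsat Q E PP FF e p f (NOr \<phi> \<psi>) = (nsat Q E PP FF e p f \<phi> \<or> nsat Q E PP FF e p f \<psi>)"
  "nsat Q E PP FF e p f (NIff \<phi> \<psi>) = (nsat Q E PP FF e p f \<phi> \<longleftrightarrow> nsat Q E PP FF e p f \<psi>)"
  "nsat Q E PP FF e p f (NEx n \<phi>) = (\<exists>x. nsat Q E PP FF (e(n := x)) p f \<phi>)"
  "nsat Q E PP FF e p f (mem i j) = E (e i) (e j)"
  "nsat Q E PP FF e p f (eqv i j) = Q (e i) (e j)"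
  by (auto simp: NNot_def NAnd_def NOr_def NIff_def NEx_def mem_def eqv_def)

lemma nsat_sub [simp]:
  "x \<noteq> n \<Longrightarrow> y \<noteq> n \<Longrightarrow> nsat Q E PP FF e p f (nsub n x y) \<longleftrightarrow> (\<forall>w. E w (e x) \<longrightarrow> E w (e y))"
  "x \<noteq> n \<Longrightarrow> y \<noteq> n \<Longrightarrow> nsat Q E PP FF e p f (ncsub n x y) \<longleftrightarrow> (\<forall>w. \<not> E w (e x) \<longrightarrow> E w (e y))"
  by (auto simp: nsub_def ncsub_def)

definition histS :: "('a \<Rightarrow> 'a \<Rightarrow> bool) \<Rightarrow> 'a \<Rightarrow> bool" where
  "histS E h \<longleftrightarrow> (\<forall>x. E x h \<longrightarrow> (\<forall>y. E y x \<longleftrightarrow> (\<exists>c. (\<forall>w. E w y \<longrightarrow> E w c) \<and> E c x \<and> E c h)))"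

definition levS :: "('a \<Rightarrow> 'a \<Rightarrow> bool) \<Rightarrow> 'a \<Rightarrow> bool" where
  "levS E s \<longleftrightarrow> (\<exists>h. histS E h \<and> (\<forall>y. E y s \<longleftrightarrow> (\<exists>c. (\<forall>w. E w y \<longrightarrow> E w c) \<and> E c h)))"

lemma nsat_level [simp]: "s < n \<Longrightarrow> nsat Q E PP FF e p f (level n s) \<longleftrightarrow> levS E (e s)"
  by (simp add: level_def hist_def inPot_def histS_def levS_def)

lemma nsat_blevel [simp]: "s < n \<Longrightarrow> nsat Q E PP FF e p f (blevel n s) \<longleftrightarrow> blevS E (e s)"
  by (simp add: blevel_def bhist_def inBpot_def bhistS_def blevS_def)

lemma levS_glev: "levS E s \<longleftrightarrow> glev E (\<lambda>_. True) s"
  unfolding levS_def histS_def glev_def ghist_def gsub_def by simp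

text \<open>Identity stays an arbitrary relation \<open>Q\<close>, because these readings are also
  used in term models to prove infinity.\<close>

lemma nsat_axioms:
  "nsat Q E PP FF e p f Extensionality \<longleftrightarrow> (\<forall>x y. (\<forall>z. E z x = E z y) \<longrightarrow> Q x y)"
  "nsat Q E PP FF e p f Separation \<longleftrightarrow> (\<forall>P\<in>PP. \<forall>a. \<exists>b. \<forall>x. E x b \<longleftrightarrow> P x \<and> E x a)"
  "nsat Q E PP FF e p f Pairing \<longleftrightarrow> (\<forall>a b. \<exists>c. \<forall>x. E x c \<longleftrightarrow> Q x a \<or> Q x b)"
  "nsat Q E PP FF e p f Union \<longleftrightarrow> (\<forall>a. \<exists>b. \<forall>x. E x b \<longleftrightarrow> (\<exists>y. E y a \<and> E x y))"
  "nsat Q E PP FF e p f Powerset \<longleftrightarrow> (\<forall>a. \<exists>b. \<forall>x. E x b \<longleftrightarrow> (\<forall>w. E w x \<longrightarrow> E w a))"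
  "nsat Q E PP FF e p f Infinity \<longleftrightarrow> (\<exists>a. (\<exists>z. E z a \<and> (\<forall>u. \<not> E u z)) \<and>
     (\<forall>x. E x a \<longrightarrow> (\<exists>y. E y a \<and> (\<forall>u. E u y \<longleftrightarrow> E u x \<or> Q u x))))"
  "nsat Q E PP FF e p f Foundation \<longleftrightarrow> (\<forall>a. (\<exists>x. E x a) \<longrightarrow> (\<exists>x. E x a \<and> (\<forall>y. E y x \<longrightarrow> \<not> E y a)))"
  "nsat Q E PP FF e p f Replacement \<longleftrightarrow> (\<forall>F\<in>FF. \<forall>a. \<exists>b. \<forall>x. E x a \<longrightarrow> E (F x) b)"
  "nsat Q E PP FF e p f Stratification \<longleftrightarrow> (\<forall>a. \<exists>s. levS E s \<and> (\<forall>w. E w a \<longrightarrow> E w s))"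
  "nsat Q E PP FF e p f LevelsEndless \<longleftrightarrow> (\<forall>s. levS E s \<longrightarrow> (\<exists>t. levS E t \<and> E s t))"
  "nsat Q E PP FF e p f Complements \<longleftrightarrow> (\<forall>a. \<exists>c. (\<forall>x. E x c \<longleftrightarrow> \<not> E x a) \<and> (\<not> E a a \<longleftrightarrow> E c c))"
  "nsat Q E PP FF e p f SeparationN \<longleftrightarrow> (\<forall>P\<in>PP. \<forall>a. \<not> E a a \<longrightarrow> (\<exists>b. \<not> E b b \<and> (\<forall>x. E x b \<longleftrightarrow> P x \<and> E x a)))"
  "nsat Q E PP FF e p f StratificationN \<longleftrightarrow> (\<forall>a. \<not> E a a \<longrightarrow> (\<exists>s. blevS E s \<and> (\<forall>w. E w a \<longrightarrow> E w s)))"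
  "nsat Q E PP FF e p f BLevelsEndless \<longleftrightarrow> (\<forall>s. blevS E s \<longrightarrow> (\<exists>t. blevS E t \<and> E s t))"
  "nsat Q E PP FF e p f InfinityN \<longleftrightarrow> (\<exists>s. blevS E s \<and> (\<exists>r. blevS E r \<and> E r s) \<and>
     (\<forall>q. blevS E q \<and> E q s \<longrightarrow> (\<exists>r. blevS E r \<and> E q r \<and> E r s)))"
  "nsat Q E PP FF e p f UnboundedN \<longleftrightarrow> (\<forall>F\<in>FF. \<forall>a. \<not> E a a \<longrightarrow> (\<exists>s. blevS E s \<and> (\<forall>x. E x a \<longrightarrow> E (F x) s)))"
  by (simp_all add: Extensionality_def Separation_def Pairing_def Union_def Powerset_def Infinity_def Foundation_def
      Replacement_def Stratification_def LevelsEndless_def Complements_def SeparationN_def StratificationN_def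
      BLevelsEndless_def InfinityN_def UnboundedN_def)

lemmas theory_defs = ZF_def LT_def LTplus_def BLT_def BLTplus_def BLT_ZF_def

lemmas nfm_defs = NNot_def NAnd_def NOr_def NIff_def NEx_def mem_def eqv_def nsub_def ncsub_def inPot_def inBpot_def
  hist_def level_def bhist_def blevel_def

lemma theory_closed:
  "\<gamma> \<in> ZF \<Longrightarrow> closed 0 0 0 \<gamma>" "\<gamma> \<in> LTplus \<Longrightarrow> closed 0 0 0 \<gamma>"
  "\<gamma> \<in> BLT_ZF \<Longrightarrow> closed 0 0 0 \<gamma>" "\<gamma> \<in> BLTplus \<Longrightarrow> closed 0 0 0 \<gamma>"
  unfolding theory_defs
  by (auto simp: sent_def nfm_defs Extensionality_def Separation_def Pairing_def Union_def Powerset_def Infinity_def Foundation_def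
      Replacement_def Stratification_def LevelsEndless_def Complements_def SeparationN_def StratificationN_def
      BLevelsEndless_def InfinityN_def UnboundedN_def)

section \<open>The translating formulas\<close>

definition nemp :: "nat \<Rightarrow> nat \<Rightarrow> nfm" where
  "nemp n w = NAll n (NNot (mem n w))"

definition ntog :: "nat \<Rightarrow> nat \<Rightarrow> nat \<Rightarrow> nfm" where
  "ntog n x y = NAll n (NIff (mem n y) (NOr (mem n x) (nemp (n+1) n)))"

definition nsng :: "nat \<Rightarrow> nat \<Rightarrow> nat \<Rightarrow> nfm" where
  "nsng n x y = NAll n (NIff (mem n y) (eqv n x))"

definition ncmp :: "nat \<Rightarrow> nat \<Rightarrow> nat \<Rightarrow> nfm" where
  "ncmp n x y = NAll n (NIff (mem n y) (NNot (mem n x)))"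

definition nNL :: "nat \<Rightarrow> nat \<Rightarrow> nfm" where
  "nNL n x = NAll n (NImp (NAnd (mem x n) (NAll (n+1) (NAll (n+2) (NAll (n+3)
      (NImp (NAnd (NAll (n+4) (NImp (nemp (n+5) (n+4)) (NNot (mem (n+4) (n+1)))))
        (NAnd (ntog (n+4) (n+1) (n+2)) (NAnd (nsng (n+4) (n+2) (n+3)) (mem (n+3) n)))) (mem (n+1) n))))))
      (NAll (n+1) (NImp (nemp (n+2) (n+1)) (mem (n+1) n))))"

definition nNB :: "nat \<Rightarrow> nat \<Rightarrow> nfm" where
  "nNB n x = NAll n (NImp (NAnd (NNot (mem n n)) (NAnd (mem x n) (NAll (n+1) (NAll (n+2)
      (NImp (NAnd (NNot (mem (n+1) (n+1))) (NAnd (nsng (n+3) (n+1) (n+2)) (mem (n+2) n))) (mem (n+1) n))))))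
      (NAll (n+1) (NImp (nemp (n+2) (n+1)) (mem (n+1) n))))"

definition nsgL :: "nat \<Rightarrow> nat \<Rightarrow> nat \<Rightarrow> nfm" where
  "nsgL n x w = NOr (NAnd (nNL n x) (ntog n x w)) (NOr
      (NAnd (NEx n (NAnd (nNL (n+1) n) (ntog (n+1) n x))) (nsng n x w))
      (NAnd (NNot (nNL n x)) (NAnd (NNot (NEx n (NAnd (nNL (n+1) n) (ntog (n+1) n x)))) (eqv w x))))"

definition nsgB :: "nat \<Rightarrow> nat \<Rightarrow> nat \<Rightarrow> nfm" where
  "nsgB n x w = NOr (NAnd (nNB n x) (ncmp n x w)) (NOr
      (NEx n (NAnd (nNB (n+1) n) (NAnd (ncmp (n+1) n x) (nsng (n+1) n w))))
      (NAnd (NNot (nNB n x)) (NAnd (NNot (NEx n (NAnd (nNB (n+1) n) (ncmp (n+1) n x)))) (eqv w x))))"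

definition nJ :: nfm where
  "nJ = NEx 2 (NAnd (nsgL 3 0 2) (NNot (NIff (mem 2 1) (NEx 3 (NAnd (nemp 4 3) (mem 3 1))))))"

definition nI :: nfm where
  "nI = NOr (NAnd (nemp 2 0) (mem 1 1)) (NEx 2 (NAnd (nsgB 3 2 0) (NNot (NIff (mem 2 1) (mem 1 1)))))"

definition fmJ :: fm where "fmJ = db [0, 1] [] [] nJ"
definition fmI :: fm where "fmI = db [0, 1] [] [] nI"

lemma nsat_coding [simp]:
  "w < n \<Longrightarrow> nsat Q E PP FF e p f (nemp n w) \<longleftrightarrow> is_empty E (e w)"
  "x < n \<Longrightarrow> y < n \<Longrightarrow> nsat Q E PP FF e p f (ntog n x y) \<longleftrightarrow> is_toggle E (e x) (e y)"
  "x < n \<Longrightarrow> y < n \<Longrightarrow> nsat (=) E PP FF e p f (nsng n x y) \<longleftrightarrow> is_singleton E (e x) (e y)"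
  "x < n \<Longrightarrow> y < n \<Longrightarrow> nsat Q E PP FF e p f (ncmp n x y) \<longleftrightarrow> is_complement E (e x) (e y)"
proof -
  have 1: "w < n \<Longrightarrow> nsat Q E PP FF e p f (nemp n w) \<longleftrightarrow> is_empty E (e w)" for n w e
    by (simp add: nemp_def is_empty_def)
  then show "w < n \<Longrightarrow> nsat Q E PP FF e p f (nemp n w) \<longleftrightarrow> is_empty E (e w)" .
  show "x < n \<Longrightarrow> y < n \<Longrightarrow> nsat Q E PP FF e p f (ntog n x y) \<longleftrightarrow> is_toggle E (e x) (e y)"
    by (simp add: ntog_def is_toggle_def 1)
  show "x < n \<Longrightarrow> y < n \<Longrightarrow> nsat (=) E PP FF e p f (nsng n x y) \<longleftrightarrow> is_singleton E (e x) (e y)"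
    by (simp add: nsng_def is_singleton_def)
  show "x < n \<Longrightarrow> y < n \<Longrightarrow> nsat Q E PP FF e p f (ncmp n x y) \<longleftrightarrow> is_complement E (e x) (e y)"
    by (simp add: ncmp_def is_complement_def)
qed

lemma nsat_N [simp]:
  "x < n \<Longrightarrow> nsat (=) E PP FF e p f (nNL n x) \<longleftrightarrow> NL E (e x)"
  "x < n \<Longrightarrow> nsat (=) E PP FF e p f (nNB n x) \<longleftrightarrow> NB E (e x)"
  by (simp_all add: nNL_def NL_def nNB_def NB_def)

lemma nsat_sg [simp]:
  "x < n \<Longrightarrow> w < n \<Longrightarrow> nsat (=) E PP FF e p f (nsgL n x w) \<longleftrightarrow> sgL E (e x) (e w)"
  "x < n \<Longrightarrow> w < n \<Longrightarrow> nsat (=) E PP FF e p f (nsgB n x w) \<longleftrightarrow> sgB E (e x) (e w)"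
  by (simp_all add: nsgL_def sgL_def nsgB_def sgB_def)

lemma sat_fmJ: "sat (=) E PP FF e p f fmJ \<longleftrightarrow> bool_mem E (e 0) (e 1)"
  by (simp add: fmJ_def sat_db nJ_def bool_mem_def)

lemma sat_fmI: "sat (=) E PP FF e p f fmI \<longleftrightarrow> ord_mem E (e 0) (e 1)"
  by (simp add: fmI_def sat_db nI_def ord_mem_def)

lemma interp_coding: "interp fmI" "interp fmJ"
  by (simp_all add: interp_def fmI_def fmJ_def nI_def nJ_def nsgB_def nsgL_def nNL_def nNB_def nemp_def ntog_def
      nsng_def ncmp_def nfm_defs)

section \<open>Definable relations of a Henkin model\<close>

text \<open>\<open>mg e c\<close> interleaves the variables (at even places) with parameters (at odd places).\<close>

definition mg :: "(nat \<Rightarrow> 'b) \<Rightarrow> (nat \<Rightarrow> 'b) \<Rightarrow> nat \<Rightarrow> 'b" where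
  "mg e c i = (if even i then e (i div 2) else c (i div 2))"

text \<open>Two formulas get a common parameter list: \<open>mgl\<close> sends parameter
  \<open>k\<close> to \<open>2 * k\<close>, \<open>mgr\<close> sends it to \<open>2 * k + 1\<close>,
  and both leave the variables in place.\<close>

definition mgl :: "nat \<Rightarrow> nat" where "mgl i = (if even i then i else 2 * i - 1)"
definition mgr :: "nat \<Rightarrow> nat" where "mgr i = (if even i then i else 2 * i + 1)"

lemma mg_even [simp]: "mg e c (2 * i) = e i" "mg e c (Suc (2 * i)) = c i"
  by (auto simp: mg_def)

lemma even_odd_nat: obtains k :: nat where "i = 2 * k" | k where "i = Suc (2 * k)"
  by (metis evenE oddE Suc_eq_plus1)

lemma mg_mgl: "mg e (mg c d) (mgl i) = mg e c i"
proof (rule even_odd_nat[of i])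
  fix k assume i: "i = Suc (2 * k)"
  then have "mgl i = Suc (2 * (2 * k))" by (simp add: mgl_def)
  then show ?thesis using i by (simp only: mg_even)
qed (simp add: mgl_def)

lemma mg_mgr: "mg e (mg c d) (mgr i) = mg e d i"
proof (rule even_odd_nat[of i])
  fix k assume i: "i = Suc (2 * k)"
  then have "mgr i = Suc (2 * Suc (2 * k))" by (simp add: mgr_def)
  then show ?thesis using i by (simp only: mg_even)
qed (simp add: mgr_def)

lemma range_scons: "x \<in> A \<Longrightarrow> range p \<subseteq> A \<Longrightarrow> range (scons x p) \<subseteq> A"
  by (auto simp: scons_def image_subset_iff split: nat.split)

lemma range_mg: "range p \<subseteq> A \<Longrightarrow> range q \<subseteq> A \<Longrightarrow> range (mg p q) \<subseteq> A"
  by (auto simp: mg_def)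

definition deft :: "('a \<Rightarrow> 'a) set \<Rightarrow> ((nat \<Rightarrow> 'a) \<Rightarrow> 'a) \<Rightarrow> bool" where
  "deft FF t \<longleftrightarrow> (\<exists>u c f. range f \<subseteq> FF \<and> (\<forall>e. tv (mg e c) f u = t e))"

definition defb :: "('a \<Rightarrow> 'a \<Rightarrow> bool) \<Rightarrow> ('a \<Rightarrow> bool) set \<Rightarrow> ('a \<Rightarrow> 'a) set \<Rightarrow> ((nat \<Rightarrow> 'a) \<Rightarrow> bool) \<Rightarrow> bool" where
  "defb E PP FF R \<longleftrightarrow> (\<exists>\<phi> c p f. range p \<subseteq> PP \<and> range f \<subseteq> FF \<and> (\<forall>e. sat (=) E PP FF (mg e c) p f \<phi> = R e))"

lemma deftE:
  assumes "deft FF t" "deft FF u"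
  obtains v w c f where "range f \<subseteq> FF" "\<And>e. tv (mg e c) f v = t e" "\<And>e. tv (mg e c) f w = u e"
proof -
  obtain v c f w d g where *: "range f \<subseteq> FF" "\<And>e. tv (mg e c) f v = t e"
    "range g \<subseteq> FF" "\<And>e. tv (mg e d) g w = u e"
    using assms unfolding deft_def by metis
  show ?thesis
  proof (rule that[of "mg f g" "mg c d" "sbT (\<lambda>i. V (mgl i)) (\<lambda>i. 2 * i) v" "sbT (\<lambda>i. V (mgr i)) (\<lambda>i. Suc (2 * i)) w"])
    show "range (mg f g) \<subseteq> FF" using * by (simp add: range_mg)
  qed (simp_all add: tv_sbT mg_mgl mg_mgr *)
qed

lemma defbE:
  assumes "defb E PP FF R" "defb E PP FF R'"
  obtains \<phi> \<psi> c p f where "range p \<subseteq> PP" "range f \<subseteq> FF"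
    "\<And>e. sat (=) E PP FF (mg e c) p f \<phi> = R e" "\<And>e. sat (=) E PP FF (mg e c) p f \<psi> = R' e"
proof -
  obtain \<phi> c p f \<psi> d q g where *: "range p \<subseteq> PP" "range f \<subseteq> FF"
    "\<And>e. sat (=) E PP FF (mg e c) p f \<phi> = R e" "range q \<subseteq> PP" "range g \<subseteq> FF"
    "\<And>e. sat (=) E PP FF (mg e d) q g \<psi> = R' e"
    using assms unfolding defb_def by metis
  show ?thesis
  proof (rule that[of "mg p q" "mg f g" "mg c d" "sb (\<lambda>i. V (mgl i)) (\<lambda>i. 2 * i) (\<lambda>i. 2 * i) \<phi>"
        "sb (\<lambda>i. V (mgr i)) (\<lambda>i. Suc (2 * i)) (\<lambda>i. Suc (2 * i)) \<psi>"])
    show "range (mg p q) \<subseteq> PP" "range (mg f g) \<subseteq> FF" using * by (simp_all add: range_mg)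
  qed (simp_all add: sat_sb mg_mgl mg_mgr *)
qed

lemma defbI: "range p \<subseteq> PP \<Longrightarrow> range f \<subseteq> FF \<Longrightarrow> (\<And>e. sat (=) E PP FF (mg e c) p f \<phi> = R e) \<Longrightarrow> defb E PP FF R"
  unfolding defb_def by blast

lemma deftI: "range f \<subseteq> FF \<Longrightarrow> (\<And>e. tv (mg e c) f u = t e) \<Longrightarrow> deft FF t"
  unfolding deft_def by blast

lemma ex_env: "A \<noteq> {} \<Longrightarrow> \<exists>p :: nat \<Rightarrow> 'b. range p \<subseteq> A"
proof -
  assume "A \<noteq> {}"
  then obtain a where "a \<in> A" by blast
  then show ?thesis by (intro exI[of _ "\<lambda>_. a"]) auto
qed

locale henkin_frame =
  fixes E :: "'a \<Rightarrow> 'a \<Rightarrow> bool" and PP :: "('a \<Rightarrow> bool) set" and FF :: "('a \<Rightarrow> 'a) set"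
  assumes ne: "PP \<noteq> {}" "FF \<noteq> {}"
begin

lemma defb_mem:
  assumes "deft FF t" "deft FF u"
  shows "defb E PP FF (\<lambda>e. E (t e) (u e))"
proof -
  obtain p :: "nat \<Rightarrow> 'a \<Rightarrow> bool" where p: "range p \<subseteq> PP" using ex_env[OF ne(1)] by blast
  show ?thesis
  proof (rule deftE[OF assms])
    fix v w c f assume "range f \<subseteq> FF" "\<And>e. tv (mg e c) f v = t e" "\<And>e. tv (mg e c) f w = u e"
    then show ?thesis by (intro defbI[OF p, of f FF E c "Mem v w"]) auto
  qed
qed

lemma defb_pred:
  assumes "P \<in> PP" "deft FF t"
  shows "defb E PP FF (\<lambda>e. P (t e))"
proof -
  obtain u c f where "range f \<subseteq> FF" "\<forall>e. tv (mg e c) f u = t e" using assms(2) unfolding deft_def by blast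
  then show ?thesis
    by (intro defbI[of "\<lambda>_. P" PP f FF E c "PA 0 u"]) (use assms(1) in auto)
qed

lemma deft_fun:
  assumes "F \<in> FF" "deft FF t"
  shows "deft FF (\<lambda>e. F (t e))"
proof -
  obtain u c f where "range f \<subseteq> FF" "\<forall>e. tv (mg e c) f u = t e" using assms(2) unfolding deft_def by blast
  then show ?thesis
    by (intro deftI[of "scons F f" FF c "Ap 0 (liftFT 0 u)"]) (use assms(1) in \<open>simp_all add: tv_liftFT range_scons\<close>)
qed

lemma definability: "definability (defb E PP FF) (deft FF)"
proof
  obtain p :: "nat \<Rightarrow> 'a \<Rightarrow> bool" where p: "range p \<subseteq> PP" using ex_env[OF ne(1)] by blast
  obtain f :: "nat \<Rightarrow> 'a \<Rightarrow> 'a" where f: "range f \<subseteq> FF" using ex_env[OF ne(2)] by blast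
  show "deft FF (\<lambda>e. e i)" for i
    by (rule deftI[OF f, of _ "V (2 * i)"]) simp
  show "deft FF (\<lambda>e. c)" for c
    by (rule deftI[OF f, of "\<lambda>_. c" "V 1"]) (simp add: mg_def)
  show "deft FF (\<lambda>e. t (\<lambda>i. e (Suc i)))" if t: "deft FF t" for t
  proof -
    obtain u c f where *: "range f \<subseteq> FF" "\<And>e. tv (mg e c) f u = t e" using t unfolding deft_def by metis
    \<comment> \<open>Variable \<open>i\<close> sits at place \<open>2 * i\<close>, so a shift by
      one moves even places by two and fixes the parameters.\<close>
    have "(\<lambda>n. mg e c (if even n then n + 2 else n)) = mg (\<lambda>i. e (Suc i)) c" for e
      by (auto simp: fun_eq_iff mg_def)
    then show ?thesis
      by (intro deftI[OF *(1), of c "sbT (\<lambda>n. V (if even n then n + 2 else n)) (\<lambda>n. n) u"])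
        (simp add: tv_sbT *)
  qed
  show "defb E PP FF (\<lambda>e. t e = u e)" if "deft FF t" "deft FF u" for t u
  proof (rule deftE[OF that])
    fix v w c f assume "range f \<subseteq> FF" "\<And>e. tv (mg e c) f v = t e" "\<And>e. tv (mg e c) f w = u e"
    then show ?thesis by (intro defbI[OF p, of f FF E c "Eq v w"]) auto
  qed
  show "defb E PP FF (\<lambda>e. \<not> R e)" if R: "defb E PP FF R" for R
  proof (rule defbE[OF R R])
    fix \<phi> c p f assume "range p \<subseteq> PP" "range f \<subseteq> FF" "\<And>e. sat (=) E PP FF (mg e c) p f \<phi> = R e"
    then show ?thesis by (intro defbI[of p PP f FF E c "Not \<phi>"]) auto
  qed
  show "defb E PP FF (\<lambda>e. R e \<longrightarrow> R' e)" if "defb E PP FF R" "defb E PP FF R'" for R R'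
  proof (rule defbE[OF that])
    fix \<phi> \<psi> c p f assume "range p \<subseteq> PP" "range f \<subseteq> FF"
      "\<And>e. sat (=) E PP FF (mg e c) p f \<phi> = R e" "\<And>e. sat (=) E PP FF (mg e c) p f \<psi> = R' e"
    then show ?thesis by (intro defbI[of p PP f FF E c "Imp \<phi> \<psi>"]) auto
  qed
  show "defb E PP FF (\<lambda>e. \<forall>x. Q x e)" if Q: "defb E PP FF (\<lambda>e. Q (e 0) (\<lambda>i. e (Suc i)))" for Q
  proof (rule defbE[OF Q Q])
    fix \<phi> c p f assume *: "range p \<subseteq> PP" "range f \<subseteq> FF"
      "\<And>e. sat (=) E PP FF (mg e c) p f \<phi> = Q (e 0) (\<lambda>i. e (Suc i))"
    \<comment> \<open>Place 0 is the quantified variable; the even place \<open>2 * k\<close> refers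
      to variable \<open>k - 1\<close> of the outer environment, and parameters move past the new
      entry.\<close>
    have **: "(\<lambda>n. scons x (mg e c) (if n = 0 then 0 else if even n then n - 1 else Suc n)) = mg (scons x e) c" for x e
    proof
      fix n
      show "scons x (mg e c) (if n = 0 then 0 else if even n then n - 1 else Suc n) = mg (scons x e) c n"
      proof (rule even_odd_nat[of n])
        fix k assume "n = 2 * k"
        then show ?thesis by (cases k) (simp_all, simp_all add: mg_def)
      next
        fix k assume n: "n = Suc (2 * k)"
        then have "scons x (mg e c) (if n = 0 then 0 else if even n then n - 1 else Suc n) = mg e c (Suc (2 * k))" by simp
        then show ?thesis using n by (simp only: mg_even)
      qed
    qed
    show ?thesis
      by (rule defbI[OF *(1,2), of _ c "All (sb (\<lambda>n. V (if n = 0 then 0 else if even n then n - 1 else Suc n)) (\<lambda>n. n) (\<lambda>n. n) \<phi>)"])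
        (simp add: sat_sb * **)
  qed
qed

end

section \<open>Henkin models of theories\<close>

locale henkin_model =
  fixes \<Gamma> Q and E :: "'a \<Rightarrow> 'a \<Rightarrow> bool" and PP FF
  assumes hmodel: "hmodel \<Gamma> Q E PP FF"
begin

sublocale henkin_frame E PP FF
  using hmodel unfolding henkin_frame_def hmodel_def by blast

lemma satI: "prv \<Gamma> \<phi> \<Longrightarrow> range p \<subseteq> PP \<Longrightarrow> range f \<subseteq> FF \<Longrightarrow> sat Q E PP FF e p f \<phi>"
  using hmodel unfolding hmodel_def by blast

lemma sat0: "prv \<Gamma> \<phi> \<Longrightarrow> \<exists>p f. sat Q E PP FF e p f \<phi>"
proof -
  assume \<phi>: "prv \<Gamma> \<phi>"
  obtain p :: "nat \<Rightarrow> 'a \<Rightarrow> bool" and f :: "nat \<Rightarrow> 'a \<Rightarrow> 'a" where "range p \<subseteq> PP" "range f \<subseteq> FF" using ex_env[OF ne(1)] ex_env[OF ne(2)] by blast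
  then show ?thesis using satI[OF \<phi>] by blast
qed

lemma axiom: "sent \<alpha> \<in> \<Gamma> \<Longrightarrow> \<exists>e p f. nsat Q E PP FF e p f \<alpha>"
  using sat0[OF prv.ax, of "sent \<alpha>"] by (simp add: sat_sent)

lemma Q_refl: "Q a a"
  using sat0[OF prv.Refl[of \<Gamma> "V 0"], of "\<lambda>_. a"] by simp

lemma Q_sym: "Q a b \<Longrightarrow> Q b a"
  \<comment> \<open>Leibniz for the property of being equal to \<open>a\<close> carries
    \<open>Q a a\<close> to \<open>Q b a\<close>.\<close>
  using sat0[OF prv.Leib[of \<Gamma> "V 0" "V 1" "Eq (V 0) (V 1)"], of "scons a (scons b (\<lambda>_. b))"] Q_refl by simp

lemma Q_mem1: "Q a b \<Longrightarrow> E a c \<Longrightarrow> E b c"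
  \<comment> \<open>Instantiating variable 0 lowers the index 3 to 2, where the environment holds
    \<open>c\<close>.\<close>
  using sat0[OF prv.Leib[of \<Gamma> "V 0" "V 1" "Mem (V 0) (V 3)"], of "scons a (scons b (\<lambda>_. c))"]
  by (simp add: numeral_3_eq_3)

lemma Q_mem2: "Q a b \<Longrightarrow> E c a \<Longrightarrow> E c b"
  using sat0[OF prv.Leib[of \<Gamma> "V 0" "V 1" "Mem (V 3) (V 0)"], of "scons a (scons b (\<lambda>_. c))"]
  by (simp add: numeral_3_eq_3)

lemma compP:
  assumes "range p \<subseteq> PP" "range f \<subseteq> FF"
  shows "(\<lambda>x. sat Q E PP FF (scons x e) p f \<phi>) \<in> PP"
proof -
  have "\<exists>X\<in>PP. \<forall>x. X x \<longleftrightarrow> sat Q E PP FF (scons x e) p f \<phi>"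
    using satI[OF prv.CompP[of \<Gamma> \<phi>] assms, of e] by (simp add: sat_liftP0)
  then obtain X where "X \<in> PP" "X = (\<lambda>x. sat Q E PP FF (scons x e) p f \<phi>)" by blast
  then show ?thesis by simp
qed

lemma compF:
  assumes "range p \<subseteq> PP" "range f \<subseteq> FF"
    and "\<And>x. \<exists>y. sat Q E PP FF (scons y (scons x e)) p f \<phi> \<and>
      (\<forall>y'. sat Q E PP FF (scons y' (scons x e)) p f \<phi> \<longrightarrow> Q y' y)"
  shows "\<exists>g\<in>FF. \<forall>x. sat Q E PP FF (scons (g x) (scons x e)) p f \<phi>"
  using satI[OF prv.CompF[of \<Gamma> \<phi>] assms(1,2), of e] assms(3)
  by (simp add: sat_lift1[unfolded One_nat_def] sat_subst0 sat_liftF0)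

lemma mem_PP: "(\<lambda>x. E x a) \<in> PP"
proof -
  obtain p :: "nat \<Rightarrow> 'a \<Rightarrow> bool" and f :: "nat \<Rightarrow> 'a \<Rightarrow> 'a" where "range p \<subseteq> PP" "range f \<subseteq> FF" using ex_env[OF ne(1)] ex_env[OF ne(2)] by blast
  from compP[OF this, of "\<lambda>_. a" "Mem (V 0) (V 1)"] show ?thesis by simp
qed

lemma mem_PP': "(\<lambda>x. E x a \<and> \<not> E x x) \<in> PP"
proof -
  obtain p :: "nat \<Rightarrow> 'a \<Rightarrow> bool" and f :: "nat \<Rightarrow> 'a \<Rightarrow> 'a" where "range p \<subseteq> PP" "range f \<subseteq> FF" using ex_env[OF ne(1)] ex_env[OF ne(2)] by blast
  from compP[OF this, of "\<lambda>_. a" "And (Mem (V 0) (V 1)) (Not (Mem (V 0) (V 0)))"] show ?thesis by simp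
qed

lemma const_FF: "\<exists>g\<in>FF. \<forall>x. Q (g x) c"
proof -
  obtain p :: "nat \<Rightarrow> 'a \<Rightarrow> bool" and f :: "nat \<Rightarrow> 'a \<Rightarrow> 'a" where "range p \<subseteq> PP" "range f \<subseteq> FF" using ex_env[OF ne(1)] ex_env[OF ne(2)] by blast
  from compF[OF this, of "\<lambda>_. c" "Eq (V 0) (V 2)"] show ?thesis
    using Q_refl by (auto simp: numeral_2_eq_2)
qed

text \<open>Earlier terms of the sequence belong to later ones; since \<open>Q\<close> respects
  membership, two equal terms would give an object in \<open>P\<close> that belongs to
  itself.\<close>

lemma chain:
  assumes "P s" "\<And>s. P s \<Longrightarrow> \<exists>t. P t \<and> E s t \<and> (\<forall>r. P r \<longrightarrow> E r s \<longrightarrow> E r t)" "\<And>s. P s \<Longrightarrow> \<not> E s s"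
  shows "\<exists>s :: nat \<Rightarrow> 'a. \<forall>j. \<forall>i<j. \<not> Q (s i) (s j)"
proof -
  have "\<exists>s. \<forall>n :: nat. P (s n) \<and> (E (s n) (s (Suc n)) \<and> (\<forall>r. P r \<longrightarrow> E r (s n) \<longrightarrow> E r (s (Suc n))))"
    by (rule dependent_nat_choice) (use assms in blast)+
  then obtain s where s: "\<And>n. P (s n)" "\<And>n. E (s n) (s (Suc n))"
    "\<And>n r. P r \<Longrightarrow> E r (s n) \<Longrightarrow> E r (s (Suc n))" by metis
  have "E (s i) (s j)" if "i < j" for i j
    using that
  proof (induction j)
    case (Suc j)
    then show ?case using s(2)[of j] s(3)[OF s(1)[of i], of j] by (cases "i = j") auto
  qed simp
  then have "\<not> Q (s i) (s j)" if "i < j" for i j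
    using Q_mem1[of "s i" "s j" "s j"] assms(3)[OF s(1)] that by blast
  then show ?thesis by blast
qed

end

locale normal_henkin_model = henkin_model \<Gamma> "(=)" E PP FF for \<Gamma> and E :: "'a \<Rightarrow> 'a \<Rightarrow> bool" and PP FF
begin

lemma defb_PP:
  assumes "defb E PP FF (\<lambda>e. R (e 0))"
  shows "R \<in> PP"
proof -
  obtain \<phi> c p f where *: "range p \<subseteq> PP" "range f \<subseteq> FF" "\<And>e. sat (=) E PP FF (mg e c) p f \<phi> = R (e 0)"
    using assms unfolding defb_def by metis
  \<comment> \<open>Only variable 0 matters to \<open>R\<close>, so every even place is read as
    variable 0; the parameter at place \<open>2 * k + 1\<close> becomes variable
    \<open>k + 1\<close>.\<close>
  have **: "(\<lambda>n. scons x c (if even n then 0 else Suc (n div 2))) = mg (\<lambda>_. x) c" for x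
    by (auto simp: fun_eq_iff mg_def)
  have "(\<lambda>x. sat (=) E PP FF (scons x c) p f (sb (\<lambda>n. V (if even n then 0 else Suc (n div 2))) (\<lambda>n. n) (\<lambda>n. n) \<phi>)) \<in> PP"
    by (rule compP[OF *(1,2)])
  then show ?thesis by (simp add: sat_sb ** *)
qed

lemma defb_FF:
  assumes "defb E PP FF (\<lambda>e. R (e 0) (e (Suc 0)))" "\<And>x. \<exists>!y. R y x"
  shows "\<exists>g\<in>FF. \<forall>x. R (g x) x"
proof -
  obtain \<phi> c p f where *: "range p \<subseteq> PP" "range f \<subseteq> FF" "\<And>e. sat (=) E PP FF (mg e c) p f \<phi> = R (e 0) (e (Suc 0))"
    using assms(1) unfolding defb_def by metis
  \<comment> \<open>The value is variable 0 and the argument variable 1, which also fills all later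
    even places; parameter \<open>k\<close> becomes variable \<open>k + 2\<close>.\<close>
  let ?r = "\<lambda>n. if n = 0 then 0 else if even n then 1 else Suc (Suc (n div 2))"
  have **: "(\<lambda>n. scons y (scons x c) (?r n)) = mg (scons y (\<lambda>_. x)) c" for x y
    by (auto simp: fun_eq_iff mg_def scons_def split: nat.splits elim: evenE)
  let ?\<psi> = "sb (\<lambda>n. V (?r n)) (\<lambda>n. n) (\<lambda>n. n) \<phi>"
  have s: "sat (=) E PP FF (scons y (scons x c)) p f ?\<psi> \<longleftrightarrow> R y x" for x y
    by (simp add: sat_sb ** *)
  have "\<exists>g\<in>FF. \<forall>x. sat (=) E PP FF (scons (g x) (scons x c)) p f ?\<psi>"
    by (rule compF[OF *(1,2)]) (use assms(2) in \<open>simp only: s, blast\<close>)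
  then show ?thesis unfolding s .
qed

interpretation D: definability "defb E PP FF" "deft FF" by (rule definability)

lemma DD_True: "defb E PP FF (\<lambda>e. True)"
  using D.DD_eq[OF D.TT_var D.TT_var, of 0 0] by simp

lemma lev_L:
  assumes ext: "\<And>x y. (\<And>z. E z x = E z y) \<Longrightarrow> x = y"
    and sep: "\<And>P a. P \<in> PP \<Longrightarrow> \<exists>b. \<forall>x. E x b \<longleftrightarrow> P x \<and> E x a"
  shows "level_theory (defb E PP FF) (deft FF) E (\<lambda>_. True)"
proof
  show "\<exists>b. True \<and> (\<forall>x. E x b \<longleftrightarrow> E x a \<and> Q x)" if "defb E PP FF (\<lambda>e. Q (e 0))" for Q a
    using sep[OF defb_PP[OF that], of a] by blast
qed (use defb_mem DD_True ext in blast)+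

lemma LTplus_structureI:
  assumes "\<And>x y. (\<And>z. E z x = E z y) \<Longrightarrow> x = y"
    and "\<And>P a. P \<in> PP \<Longrightarrow> \<exists>b. \<forall>x. E x b \<longleftrightarrow> P x \<and> E x a"
    and strat: "\<And>a. \<exists>s. levS E s \<and> (\<forall>w. E w a \<longrightarrow> E w s)"
    and endless: "\<And>s. levS E s \<Longrightarrow> \<exists>t. levS E t \<and> E s t"
  shows "LTplus_structure (defb E PP FF) (deft FF) E"
proof -
  interpret level_theory "defb E PP FF" "deft FF" E "\<lambda>_. True" by (rule lev_L) fact+
  show ?thesis
    by unfold_locales (use strat endless in \<open>simp_all add: levS_glev gsub_def\<close>)
qed

lemma BLTplus_structureI:
  assumes ext: "\<And>x y. (\<And>z. E z x = E z y) \<Longrightarrow> x = y"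
    and cmpl: "\<And>a. \<exists>c. (\<forall>x. E x c \<longleftrightarrow> \<not> E x a) \<and> (\<not> E a a \<longleftrightarrow> E c c)"
    and sep: "\<And>P a. P \<in> PP \<Longrightarrow> \<not> E a a \<Longrightarrow> \<exists>b. \<not> E b b \<and> (\<forall>x. E x b \<longleftrightarrow> P x \<and> E x a)"
    and strat: "\<And>a. \<not> E a a \<Longrightarrow> \<exists>s. blevS E s \<and> (\<forall>w. E w a \<longrightarrow> E w s)"
    and endless: "\<And>s. blevS E s \<Longrightarrow> \<exists>t. blevS E t \<and> E s t"
  shows "BLTplus_structure (defb E PP FF) (deft FF) E"
proof -
  interpret B: definable_boolean_sets "defb E PP FF" "deft FF" E
  proof
    show "\<exists>b. \<not> E b b \<and> (\<forall>x. E x b \<longleftrightarrow> Q x \<and> E x a)" if "defb E PP FF (\<lambda>e. Q (e 0))" "\<not> E a a" for Q a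
      using sep[OF defb_PP[OF that(1)] that(2)] .
  qed (fact defb_mem ext cmpl)+
  interpret L: level_theory "defb E PP FF" "deft FF" "bmem E" "low E" by (rule B.lev_B)
  show ?thesis
  proof
    show "\<exists>s. L.levl s \<and> gsub (bmem E) a s" for a
    proof -
      obtain c where c: "\<forall>x. E x c \<longleftrightarrow> \<not> E x a" "\<not> E a a \<longleftrightarrow> E c c" using cmpl by blast
      \<comment> \<open>\<open>b\<close> is the low one of \<open>a\<close> and its
        complement.\<close>
      obtain b where b: "\<not> E b b" "\<forall>x. bmem E x a \<longleftrightarrow> E x b"
        using c unfolding bmem_def by (cases "E a a") auto
      obtain s where "blevS E s" "\<forall>w. E w b \<longrightarrow> E w s" using strat[OF b(1)] by blast
      then show ?thesis
        using b B.bmem_of_low[OF B.blevS_low] unfolding gsub_def B.blevS_glev[symmetric] by metis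
    qed
    show "\<exists>t. L.levl t \<and> bmem E s t" if "L.levl s" for s
      using endless[of s] that B.bmem_of_low[OF B.blevS_low] unfolding B.blevS_glev[symmetric] by metis
  qed
qed

lemma LTplus_structure_models:
  assumes "LTplus_structure (defb E PP FF) (deft FF) E" and "\<alpha> \<in> {Extensionality, Complements, SeparationN, StratificationN, BLevelsEndless}"
  shows "nsat (=) (bool_mem E) PP FF e p f \<alpha>"
proof -
  interpret LTplus_structure "defb E PP FF" "deft FF" E by fact
  have 1: "\<exists>s. blevS EB s \<and> (\<forall>w. EB w a \<longrightarrow> EB w s)" if a: "\<not> EB a a" for a
  proof -
    obtain s where s: "blevS EB s" "gsub (bmem EB) a s" using BF.strat[of a] B.blevS_glev by metis
    then show ?thesis
      using B.bmem_of_low[OF a] B.bmem_of_low[OF B.blevS_low[OF s(1)]] unfolding gsub_def by blast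
  qed
  have 2: "\<exists>t. blevS EB t \<and> EB s t" if "blevS EB s" for s
    using BF.endless[of s] that B.bmem_of_low[OF B.blevS_low] unfolding B.blevS_glev[symmetric] by metis
  have 3: "\<exists>b. \<not> EB b b \<and> (\<forall>x. EB x b \<longleftrightarrow> P x \<and> EB x a)" if "P \<in> PP" "\<not> EB a a" for P a
    using B.sepB[OF defb_pred[OF that(1) D.TT_var] that(2)] .
  show ?thesis
    using assms(2) 1 2 3 B.extB B.compB by (auto simp: nsat_axioms)
qed

lemma BLTplus_structure_models:
  assumes "BLTplus_structure (defb E PP FF) (deft FF) E" and "\<alpha> \<in> {Extensionality, Separation, Stratification, LevelsEndless}"
  shows "nsat (=) (ord_mem E) PP FF e p f \<alpha>"
proof -
  interpret BLTplus_structure "defb E PP FF" "deft FF" E by fact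
  have 1: "\<exists>b. \<forall>x. EL x b \<longleftrightarrow> P x \<and> EL x a" if "P \<in> PP" for P a
    using EL_sep[OF defb_pred[OF that D.TT_var], of a] by blast
  show ?thesis
    using assms(2) 1 EL_ext LF.strat LF.endless by (auto simp: nsat_axioms levS_glev gsub_def)
qed

end

text \<open>The abstract level theory presupposes genuine equality. Here identity is only
  \<open>Q\<close>, so a fragment is redone by hand: levels are transitive, closed under subsets and
  not self-membered.\<close>

lemma LTplus_inf:
  assumes "hmodel LTplus Q E PP FF"
  shows "\<exists>s :: nat \<Rightarrow> 'a. \<forall>j. \<forall>i<j. \<not> Q (s i) (s j)"
proof -
  interpret henkin_model LTplus Q E PP FF by (unfold_locales) (rule assms)
  note ax = axiom[of Separation] axiom[of Stratification] axiom[of LevelsEndless]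
  have sep: "\<And>P a. P \<in> PP \<Longrightarrow> \<exists>b. \<forall>x. E x b \<longleftrightarrow> P x \<and> E x a"
    and strat: "\<And>a. \<exists>s. levS E s \<and> (\<forall>w. E w a \<longrightarrow> E w s)"
    and endless: "\<And>s. levS E s \<Longrightarrow> \<exists>t. levS E t \<and> E s t"
    using ax by (simp_all add: nsat_axioms LTplus_def LT_def)
  have pot: "E r t" if t: "levS E t" and st: "E s t" and rs: "E r s \<or> (\<forall>w. E w r \<longrightarrow> E w s)" for r s t
  proof -
    obtain h where h: "histS E h" and ht: "\<And>y. E y t \<longleftrightarrow> (\<exists>c. (\<forall>w. E w y \<longrightarrow> E w c) \<and> E c h)"
      using t unfolding levS_def by metis
    obtain c where c: "\<forall>w. E w s \<longrightarrow> E w c" "E c h" using ht st by metis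
    show ?thesis
    proof (cases "E r s")
      case True
      then have "E r c" using c(1) by blast
      then obtain d where "\<forall>w. E w r \<longrightarrow> E w d" "E d h" using h[unfolded histS_def] c(2) by metis
      then show ?thesis using ht by metis
    next
      case False
      then have "\<forall>w. E w r \<longrightarrow> E w c" using rs c(1) by blast
      then show ?thesis using ht c(2) by metis
    qed
  qed
  have irr: "\<not> E s s" if s: "levS E s" for s
  proof
    assume ss: "E s s"
    obtain d where d: "\<And>x. E x d \<longleftrightarrow> (E x s \<and> \<not> E x x) \<and> E x s" using sep[OF mem_PP', of s s] by metis
    then have "E d s" using pot[OF s ss, of d] by metis
    then show False using d[of d] by blast
  qed
  obtain s where "levS E s" using strat by blast
  then show ?thesis
    by (rule chain[of "levS E"]) (use endless pot irr in metis)+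
qed

lemma (in henkin_model) boolean_setsI:
  assumes "\<And>x y. (\<And>z. E z x = E z y) \<Longrightarrow> Q x y"
    and "\<And>a. \<exists>c. (\<forall>x. E x c \<longleftrightarrow> \<not> E x a) \<and> (\<not> E a a \<longleftrightarrow> E c c)"
    and sep: "\<And>P a. P \<in> PP \<Longrightarrow> \<not> E a a \<Longrightarrow> \<exists>b. \<not> E b b \<and> (\<forall>x. E x b \<longleftrightarrow> P x \<and> E x a)"
  shows "boolean_sets E"
proof
  show "E x x = E y y" if "\<And>z. E z x = E z y" for x y
    using assms(1)[OF that] assms(1)[OF that[symmetric]] Q_mem1 Q_mem2 by metis
  show "\<exists>b. \<not> E b b \<and> (\<forall>x. E x b \<longleftrightarrow> E x y \<and> E x a)" if "\<not> E a a" for a y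
    by (rule sep[OF mem_PP that])
  show "\<exists>b. \<not> E b b \<and> (\<forall>x. E x b \<longleftrightarrow> (E x y \<and> \<not> E x x) \<and> E x a)" if "\<not> E a a" for a y
    by (rule sep[OF mem_PP' that])
qed fact

lemma (in henkin_model) BLT_inf:
  assumes "\<And>x y. (\<And>z. E z x = E z y) \<Longrightarrow> Q x y"
    and cmpl: "\<And>a. \<exists>c. (\<forall>x. E x c \<longleftrightarrow> \<not> E x a) \<and> (\<not> E a a \<longleftrightarrow> E c c)"
    and "\<And>P a. P \<in> PP \<Longrightarrow> \<not> E a a \<Longrightarrow> \<exists>b. \<not> E b b \<and> (\<forall>x. E x b \<longleftrightarrow> P x \<and> E x a)"
    and strat: "\<And>a. \<not> E a a \<Longrightarrow> \<exists>s. blevS E s \<and> (\<forall>w. E w a \<longrightarrow> E w s)"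
    and endless: "\<And>s. blevS E s \<Longrightarrow> \<exists>t. blevS E t \<and> E s t"
  shows "\<exists>s :: nat \<Rightarrow> 'a. \<forall>j. \<forall>i<j. \<not> Q (s i) (s j)"
proof -
  interpret boolean_sets E by (rule boolean_setsI) fact+
  obtain a where "\<not> E a a" using cmpl by metis
  then obtain s where "blevS E s" using strat by blast
  then show ?thesis
    by (rule chain[of "blevS E"]) (use endless blevS_trans blevS_low in metis)+
qed

lemma BLTplus_inf:
  assumes "hmodel BLTplus Q E PP FF"
  shows "\<exists>s :: nat \<Rightarrow> 'a. \<forall>j. \<forall>i<j. \<not> Q (s i) (s j)"
proof -
  interpret henkin_model BLTplus Q E PP FF by (unfold_locales) (rule assms)
  note ax = axiom[of Extensionality] axiom[of Complements] axiom[of SeparationN] axiom[of StratificationN] axiom[of BLevelsEndless]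
  show ?thesis
    by (rule BLT_inf) (use ax in \<open>simp_all add: nsat_axioms BLTplus_def BLT_def\<close>)
qed

text \<open>Endlessness is no axiom of this theory. Unboundedness, applied to the function with
  constant value \<open>s\<close> on a nonempty low set taken from Infinity, yields a level that
  contains \<open>s\<close>.\<close>

lemma BLT_ZF_endless:
  assumes "hmodel BLT_ZF Q E PP FF" "blevS E s"
  shows "\<exists>t. blevS E t \<and> E s t"
proof -
  interpret henkin_model BLT_ZF Q E PP FF by (unfold_locales) (rule assms)
  note ax = axiom[of Extensionality] axiom[of Complements] axiom[of SeparationN] axiom[of InfinityN] axiom[of UnboundedN]
  have 1: "\<And>x y. (\<And>z. E z x = E z y) \<Longrightarrow> Q x y"
    "\<And>a. \<exists>c. (\<forall>x. E x c \<longleftrightarrow> \<not> E x a) \<and> (\<not> E a a \<longleftrightarrow> E c c)"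
    "\<And>P a. P \<in> PP \<Longrightarrow> \<not> E a a \<Longrightarrow> \<exists>b. \<not> E b b \<and> (\<forall>x. E x b \<longleftrightarrow> P x \<and> E x a)"
    using ax by (simp_all add: nsat_axioms BLT_ZF_def BLT_def)
  interpret boolean_sets E by (rule boolean_setsI) fact+
  obtain a r where a: "blevS E a" "E r a" using ax by (auto simp: nsat_axioms BLT_ZF_def BLT_def)
  obtain g where g: "g \<in> FF" "\<forall>x. Q (g x) s" using const_FF by blast
  have "\<exists>t. blevS E t \<and> (\<forall>x. E x a \<longrightarrow> E (g x) t)"
    using ax(5) g(1) blevS_low[OF a(1)] by (simp add: nsat_axioms BLT_ZF_def)
  then show ?thesis using a(2) g(2) Q_mem1 by metis
qed

lemma BLT_ZF_inf:
  assumes "hmodel BLT_ZF Q E PP FF"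
  shows "\<exists>s :: nat \<Rightarrow> 'a. \<forall>j. \<forall>i<j. \<not> Q (s i) (s j)"
proof -
  interpret henkin_model BLT_ZF Q E PP FF by (unfold_locales) (rule assms)
  note ax = axiom[of Extensionality] axiom[of Complements] axiom[of SeparationN] axiom[of StratificationN]
  show ?thesis
    by (rule BLT_inf[OF _ _ _ _ BLT_ZF_endless[OF assms]]) (use ax in \<open>simp_all add: nsat_axioms BLT_ZF_def BLT_def\<close>)
qed

text \<open>Adjoining \<open>s\<close> to itself generates the chain, and Foundation excludes
  self-membership.\<close>

lemma ZF_inf:
  assumes "hmodel ZF Q E PP FF"
  shows "\<exists>s :: nat \<Rightarrow> 'a. \<forall>j. \<forall>i<j. \<not> Q (s i) (s j)"
proof -
  interpret henkin_model ZF Q E PP FF by (unfold_locales) (rule assms)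
  note ax = axiom[of Pairing] axiom[of Union] axiom[of Foundation]
  have pair: "\<And>a b. \<exists>c. \<forall>x. E x c \<longleftrightarrow> Q x a \<or> Q x b"
    and union: "\<And>a. \<exists>b. \<forall>x. E x b \<longleftrightarrow> (\<exists>y. E y a \<and> E x y)"
    and found: "\<And>a x. E x a \<Longrightarrow> \<exists>x. E x a \<and> (\<forall>y. E y x \<longrightarrow> \<not> E y a)"
    using ax by (auto simp: nsat_axioms ZF_def)
  have "\<not> E s s" for s
  proof
    assume s: "E s s"
    obtain c where c: "\<And>x. E x c \<longleftrightarrow> Q x s" using pair[of s s] by metis
    then have "E s c" using Q_refl by blast
    then obtain x where "Q x s" "\<forall>y. E y x \<longrightarrow> \<not> Q y s" using found c by metis
    then show False using s Q_mem2 Q_refl Q_sym by metis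
  qed
  moreover have "\<exists>t. E s t \<and> (\<forall>r. E r s \<longrightarrow> E r t)" for s
  proof -
    obtain c where c: "\<And>x. E x c \<longleftrightarrow> Q x s" using pair[of s s] by metis
    obtain d where d: "\<And>x. E x d \<longleftrightarrow> Q x s \<or> Q x c" using pair by metis
    obtain t where t: "\<And>x. E x t \<longleftrightarrow> (\<exists>y. E y d \<and> E x y)" using union by metis
    then show ?thesis using c d Q_refl by metis
  qed
  ultimately show ?thesis
    using chain[of "\<lambda>_. True"] by simp
qed

theorem LTplus_BLTplus: "defeq LTplus BLTplus"
proof (rule defeq_semantic[of _ _ fmI ord_mem fmJ bool_mem])
  fix E :: "nat \<Rightarrow> nat \<Rightarrow> bool" and PP FF
  {
    assume "hmodel LTplus (=) E PP FF"
    then interpret normal_henkin_model LTplus E PP FF by unfold_locales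
    note ax = axiom[of Extensionality] axiom[of Separation] axiom[of Stratification] axiom[of LevelsEndless]
    have l: "LTplus_structure (defb E PP FF) (deft FF) E"
      by (rule LTplus_structureI) (use ax in \<open>simp_all add: nsat_axioms LTplus_def LT_def\<close>)
    then show "ord_mem (bool_mem E) = E" by (rule LTplus_structure.ord_mem_bool_mem)
    show "sat (=) (bool_mem E) PP FF e p f \<alpha>" if "\<alpha> \<in> BLTplus" for e p f \<alpha>
      using that LTplus_structure_models[OF l] by (auto simp: BLTplus_def BLT_def sat_sent)
  }
  {
    assume "hmodel BLTplus (=) E PP FF"
    then interpret normal_henkin_model BLTplus E PP FF by unfold_locales
    note ax = axiom[of Extensionality] axiom[of Complements] axiom[of SeparationN] axiom[of StratificationN] axiom[of BLevelsEndless]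
    have l: "BLTplus_structure (defb E PP FF) (deft FF) E"
      by (rule BLTplus_structureI) (use ax in \<open>simp_all add: nsat_axioms BLTplus_def BLT_def\<close>)
    then show "bool_mem (ord_mem E) = E" by (rule BLTplus_structure.bool_mem_ord_mem)
    show "sat (=) (ord_mem E) PP FF e p f \<alpha>" if "\<alpha> \<in> LTplus" for e p f \<alpha>
      using that BLTplus_structure_models[OF l] by (auto simp: LTplus_def LT_def sat_sent)
  }
qed (fact theory_closed LTplus_inf BLTplus_inf interp_coding sat_fmI sat_fmJ)+

section \<open>Level theory inside ZF\<close>

text \<open>\<open>appr E a n F\<close>: the function \<open>F\<close> follows the recursion \<open>F 0 = a\<close>, \<open>F (k + 1) = \<Union>(F k)\<close> for \<open>k \<in> n\<close>.
  Function variables replace sets of ordered pairs in the construction of transitive closures.\<close>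

definition appr :: "('a \<Rightarrow> 'a \<Rightarrow> bool) \<Rightarrow> 'a \<Rightarrow> 'a \<Rightarrow> ('a \<Rightarrow> 'a) \<Rightarrow> bool" where
  "appr E a n F \<longleftrightarrow> (\<forall>w. (\<forall>u. \<not> E u w) \<longrightarrow> F w = a) \<and>
     (\<forall>k k'. E k n \<and> (\<forall>u. E u k' \<longleftrightarrow> E u k \<or> u = k) \<longrightarrow> (\<forall>x. E x (F k') \<longleftrightarrow> (\<exists>y. E y (F k) \<and> E x y)))"

locale ZF_structure = level_theory DD TT E "\<lambda>_. True" for DD :: "((nat \<Rightarrow> 'a) \<Rightarrow> bool) \<Rightarrow> bool" and TT E +
  fixes FF :: "('a \<Rightarrow> 'a) set"
  assumes pair: "\<exists>c. \<forall>x. E x c \<longleftrightarrow> x = a \<or> x = b"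
    and union: "\<exists>b. \<forall>x. E x b \<longleftrightarrow> (\<exists>y. E y a \<and> E x y)"
    and power: "\<exists>b. \<forall>x. E x b \<longleftrightarrow> sub x a"
    and inf: "\<exists>a. (\<exists>z. E z a \<and> (\<forall>u. \<not> E u z)) \<and> (\<forall>x. E x a \<longrightarrow> (\<exists>y. E y a \<and> (\<forall>u. E u y \<longleftrightarrow> E u x \<or> u = x)))"
    and found: "E x a \<Longrightarrow> \<exists>x. E x a \<and> (\<forall>y. E y x \<longrightarrow> \<not> E y a)"
    and repl: "F \<in> FF \<Longrightarrow> \<exists>b. \<forall>x. E x a \<longrightarrow> E (F x) b"
    and FF_ex: "DD (\<lambda>e. R (e 0) (e (Suc 0))) \<Longrightarrow> (\<And>x. \<exists>!y. R y x) \<Longrightarrow> \<exists>g\<in>FF. \<forall>x. R (g x) x"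
    and TT_F: "F \<in> FF \<Longrightarrow> TT t \<Longrightarrow> TT (\<lambda>e. F (t e))"
    and DD_rec: "DD (\<lambda>e. \<exists>F\<in>FF. appr E a (e (Suc 0)) F \<and> e 0 = F (e (Suc 0)))"
begin

section \<open>Natural numbers, iterated unions and transitive closures in ZF\<close>

lemma extE: "(\<And>u. E u x = E u y) \<Longrightarrow> x = y"
  using ext by blast

lemma asym: "E x y \<Longrightarrow> \<not> E y x"
proof
  assume xy: "E x y" "E y x"
  obtain c where c: "\<And>u. E u c \<longleftrightarrow> u = x \<or> u = y" using pair by metis
  then show False using found[of x c] xy by metis
qed

lemma irrefl: "\<not> E x x"
  using asym by blast

definition un :: "'a \<Rightarrow> 'a" where "un a = (SOME b. \<forall>x. E x b \<longleftrightarrow> (\<exists>y. E y a \<and> E x y))"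

lemma un: "E x (un a) \<longleftrightarrow> (\<exists>y. E y a \<and> E x y)"
  using someI_ex[OF union[of a]] unfolding un_def by blast

lemma un_iff: "b = un a \<longleftrightarrow> (\<forall>x. E x b \<longleftrightarrow> (\<exists>y. E y a \<and> E x y))"
  using un extE[of b "un a"] by metis

lemma cup: "\<exists>c. \<forall>x. E x c \<longleftrightarrow> E x a \<or> E x b"
proof -
  obtain d where d: "\<And>u. E u d \<longleftrightarrow> u = a \<or> u = b" using pair by metis
  show ?thesis by (rule exI[of _ "un d"]) (auto simp: un d)
qed

definition z :: 'a where "z = (SOME w. \<forall>u. \<not> E u w)"

lemma z: "\<not> E u z"
proof -
  have "\<exists>w. \<forall>u. \<not> E u w" using inf by blast
  from someI_ex[OF this] show ?thesis unfolding z_def by blast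
qed

lemma z_iff: "(\<forall>u. \<not> E u w) \<longleftrightarrow> w = z"
  using z extE[of w z] by metis

definition suc :: "'a \<Rightarrow> 'a" where "suc x = (SOME y. \<forall>u. E u y \<longleftrightarrow> E u x \<or> u = x)"

lemma suc: "E u (suc x) \<longleftrightarrow> E u x \<or> u = x"
proof -
  obtain d where d: "\<And>u. E u d \<longleftrightarrow> u = x \<or> u = x" using pair by metis
  obtain c where "\<And>u. E u c \<longleftrightarrow> E u x \<or> E u d" using cup by metis
  then have "\<exists>y. \<forall>u. E u y \<longleftrightarrow> E u x \<or> u = x" using d by metis
  from someI_ex[OF this] show ?thesis unfolding suc_def by blast
qed

lemma suc_iff: "(\<forall>u. E u y \<longleftrightarrow> E u x \<or> u = x) \<longleftrightarrow> y = suc x"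
  using suc extE[of y "suc x"] by metis

lemma suc_inj: "suc x = suc y \<Longrightarrow> x = y"
  using suc asym by metis

lemma suc_z: "suc x \<noteq> z"
  using suc z by metis

lemma DD_suc: "DD (\<lambda>e. e (Suc 0) = suc (e 0))"
  unfolding suc_iff[symmetric] by (intro ddl)

lemma omega_ex: "\<exists>om. E z om \<and> (\<forall>n. E n om \<longrightarrow> E (suc n) om) \<and>
    (\<forall>u. E z u \<and> (\<forall>n. E n u \<longrightarrow> E (suc n) u) \<longrightarrow> sub om u)"
proof -
  obtain a where a: "E z a" "\<And>x. E x a \<Longrightarrow> E (suc x) a"
    using inf unfolding z_iff suc_iff by blast
  have "DD (\<lambda>e. \<forall>u. E z u \<and> (\<forall>n w. E n u \<and> w = suc n \<longrightarrow> E w u) \<longrightarrow> E (e 0) u)"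
    by (intro ddl DD_sub2[of "\<lambda>x y. y = suc x", OF DD_suc])
  from sep[of "\<lambda>x. \<forall>u. E z u \<and> (\<forall>n w. E n u \<and> w = suc n \<longrightarrow> E w u) \<longrightarrow> E x u", OF this, of a]
  obtain om where om: "\<And>x. E x om \<longleftrightarrow> E x a \<and> (\<forall>u. E z u \<and> (\<forall>n. E n u \<longrightarrow> E (suc n) u) \<longrightarrow> E x u)" by auto
  show ?thesis
  proof (intro exI[of _ om] conjI allI impI)
    show "E z om" using om a(1) by blast
    show "E (suc n) om" if "E n om" for n using that a(2) unfolding om by blast
    show "sub om u" if "E z u \<and> (\<forall>n. E n u \<longrightarrow> E (suc n) u)" for u
      unfolding gsub_def om using that by blast
  qed
qed

definition om :: 'a where
  "om = (SOME om. E z om \<and> (\<forall>n. E n om \<longrightarrow> E (suc n) om) \<and>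
    (\<forall>u. E z u \<and> (\<forall>n. E n u \<longrightarrow> E (suc n) u) \<longrightarrow> sub om u))"

lemma om: "E z om" "E n om \<Longrightarrow> E (suc n) om" "E z u \<Longrightarrow> (\<And>n. E n u \<Longrightarrow> E (suc n) u) \<Longrightarrow> sub om u"
  using someI_ex[OF omega_ex] unfolding om_def[symmetric] by blast+

lemma om_induct:
  assumes D: "DD (\<lambda>e. P (e 0))" and 0: "P z" and S: "\<And>n. E n om \<Longrightarrow> P n \<Longrightarrow> P (suc n)" and n: "E n om"
  shows "P n"
proof -
  obtain u where u: "\<And>x. E x u \<longleftrightarrow> E x om \<and> P x" using sep[OF D, of om] by metis
  have "sub om u" by (rule om(3)) (use u 0 S om in blast)+
  then show ?thesis using u n gsubD by metis
qed

lemma appr_iff: "appr E a n F \<longleftrightarrow> F z = a \<and> (\<forall>k. E k n \<longrightarrow> F (suc k) = un (F k))"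
proof -
  have *: "(\<forall>x. E x (F k') \<longleftrightarrow> (\<exists>y. E y (F k) \<and> E x y)) \<longleftrightarrow> F k' = un (F k)" for k k'
    using un_iff by metis
  show ?thesis unfolding appr_def z_iff suc_iff * by simp
qed

text \<open>Graph of the map from \<open>n\<close> to the n-fold iterated union of
  \<open>a\<close>.\<close>

definition Gr :: "'a \<Rightarrow> 'a \<Rightarrow> 'a \<Rightarrow> bool" where
  "Gr a y n \<longleftrightarrow> (\<exists>F\<in>FF. appr E a n F \<and> y = F n)"

lemma DD_Gr: "TT t \<Longrightarrow> TT u \<Longrightarrow> DD (\<lambda>e. Gr a (t e) (u e))"
proof (rule DD_sub2)
  show "DD (\<lambda>e. Gr a (e 0) (e (Suc 0)))" unfolding Gr_def by (rule DD_rec)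
qed

lemma Gr_z: "Gr a a z"
proof -
  have "DD (\<lambda>e. e 0 = a)" by (intro ddl)
  from FF_ex[of "\<lambda>y _. y = a", OF this] obtain g where "g \<in> FF" "\<forall>x. g x = a" by blast
  then show ?thesis unfolding Gr_def appr_iff using z by metis
qed

lemma Gr_z_iff: "Gr a y z \<longleftrightarrow> y = a"
  using Gr_z unfolding Gr_def appr_iff by metis

lemma Gr_suc: "Gr a y (suc n) \<Longrightarrow> \<exists>v. Gr a v n \<and> y = un v"
  unfolding Gr_def appr_iff suc by metis

lemma Gr_unique: "E n om \<Longrightarrow> Gr a y n \<Longrightarrow> Gr a y' n \<Longrightarrow> y = y'"
proof -
  assume n: "E n om"
  have "\<forall>y y'. Gr a y n \<and> Gr a y' n \<longrightarrow> y = y'"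
  proof (rule om_induct[OF _ _ _ n])
    show "DD (\<lambda>e. \<forall>y y'. Gr a y (e 0) \<and> Gr a y' (e 0) \<longrightarrow> y = y')" by (intro ddl DD_Gr)
    show "\<forall>y y'. Gr a y z \<and> Gr a y' z \<longrightarrow> y = y'" using Gr_z_iff by metis
    show "\<forall>y y'. Gr a y (suc n) \<and> Gr a y' (suc n) \<longrightarrow> y = y'"
      if "\<forall>y y'. Gr a y n \<and> Gr a y' n \<longrightarrow> y = y'" for n
      using that Gr_suc by metis
  qed
  then show "Gr a y n \<Longrightarrow> Gr a y' n \<Longrightarrow> y = y'" by blast
qed

text \<open>The approximation is changed at the single argument \<open>suc n\<close>, which differs
  from \<open>k\<close> and from \<open>suc k\<close> for every \<open>k\<close> in
  \<open>n\<close>, so the earlier steps of the recursion survive.\<close>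

lemma Gr_step:
  assumes "Gr a y n"
  shows "Gr a (un y) (suc n)"
proof -
  obtain F where F: "F \<in> FF" "F z = a" "\<And>k. E k n \<Longrightarrow> F (suc k) = un (F k)" "y = F n"
    using assms unfolding Gr_def appr_iff by blast
  let ?R = "\<lambda>y x. x = suc n \<and> y = un (F n) \<or> x \<noteq> suc n \<and> y = F x"
  have "DD (\<lambda>e. ?R (e 0) (e (Suc 0)))" by (intro ddl TT_F[OF F(1)])
  from FF_ex[of ?R, OF this] obtain g where g: "g \<in> FF" "\<And>x. ?R (g x) x" by blast
  have gs: "g (suc n) = un (F n)" using g(2)[of "suc n"] by blast
  have go: "g x = F x" if "x \<noteq> suc n" for x using g(2)[of x] that by blast
  have 1: "n \<noteq> suc n" using suc irrefl by metis
  have 2: "k \<noteq> suc n" if "E k n" for k using that suc asym by metis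
  have "g (suc k) = un (g k)" if "E k (suc n)" for k
  proof (cases "k = n")
    case True
    then show ?thesis using gs go[OF 1] by simp
  next
    case False
    then have k: "E k n" using that suc by blast
    have "suc k \<noteq> suc n" using False suc_inj by blast
    then show ?thesis using go[of "suc k"] go[OF 2[OF k]] F(3)[OF k] by simp
  qed
  moreover have "g z = a" using go[of z] F(2) suc_z by metis
  ultimately show ?thesis
    unfolding Gr_def appr_iff using g(1) gs F(4) by metis
qed

lemma Gr_ex: "E n om \<Longrightarrow> \<exists>y. Gr a y n"
proof (rule om_induct[of "\<lambda>n. \<exists>y. Gr a y n"])
  show "DD (\<lambda>e. \<exists>y. Gr a y (e 0))" by (intro ddl DD_Gr)
qed (use Gr_z Gr_step in blast)+

lemma replace:
  assumes "DD (\<lambda>e. R (e 0) (e (Suc 0)))" "\<And>x. \<exists>!y. R y x"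
  shows "\<exists>b. \<forall>x y. E x a \<longrightarrow> R y x \<longrightarrow> E y b"
proof -
  obtain g where g: "g \<in> FF" "\<forall>x. R (g x) x" using FF_ex[OF assms] by blast
  then have "y = g x" if "R y x" for x y using assms(2)[of x] that by blast
  then show ?thesis using repl[OF g(1), of a] by metis
qed

text \<open>Replacement along \<open>om\<close> collects all iterated unions of \<open>a\<close>;
  the union of this collection is transitive.\<close>

lemma trans_closure: "\<exists>u. sub a u \<and> (\<forall>x. E x u \<longrightarrow> sub x u)"
proof -
  \<comment> \<open>The default value \<open>z\<close> outside \<open>om\<close> makes the relation
    total, as function variables require.\<close>
  let ?R = "\<lambda>y n. E n om \<and> Gr a y n \<or> \<not> E n om \<and> y = z"
  have "DD (\<lambda>e. ?R (e 0) (e (Suc 0)))" by (intro ddl DD_Gr)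
  moreover have "\<exists>!y. ?R y x" for x
  proof (cases "E x om")
    case True
    then show ?thesis using Gr_ex[OF True] Gr_unique[OF True] by blast
  qed auto
  ultimately obtain b where "\<forall>x y. E x om \<longrightarrow> ?R y x \<longrightarrow> E y b"
    using replace[of ?R om] by blast
  then have b: "E y b" if "E n om" "Gr a y n" for n y using that by blast
  have "DD (\<lambda>e. \<exists>n. E n om \<and> Gr a (e 0) n)" by (intro ddl DD_Gr)
  from sep[of "\<lambda>y. \<exists>n. E n om \<and> Gr a y n", OF this, of b]
  obtain c where c: "\<And>y. E y c \<longleftrightarrow> (\<exists>n. E n om \<and> Gr a y n)" using b by metis
  show ?thesis
  proof (intro exI[of _ "un c"] conjI allI impI)
    have "E a c" using c Gr_z om(1) by blast
    then show "sub a (un c)" unfolding gsub_def un by blast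
    fix x assume "E x (un c)"
    then obtain y n where y: "E x y" "E n om" "Gr a y n" using un c by metis
    then have "E (un y) c" using c om(2) Gr_step by blast
    then show "sub x (un c)" using y(1) un unfolding gsub_def by metis
  qed
qed

text \<open>The construction of \<open>pot_ex\<close> inside ZF: the levels in \<open>b\<close> with
  the levels below them form a history that generates \<open>p\<close>. Union and Powerset supply
  the bounds for the two separations.\<close>

lemma level_above: "\<exists>p. levl p \<and> (\<forall>s. levl s \<and> E s b \<longrightarrow> E s p)"
proof -
  let ?H = "\<lambda>r. levl r \<and> (\<exists>s. E s b \<and> levl s \<and> (r = s \<or> E r s))"
  obtain c where c: "\<And>x. E x c \<longleftrightarrow> E x b \<or> E x (un b)" using cup by metis
  have D: "DD (\<lambda>e. ?H (e 0))" by (intro ddl)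
  have "E r c" if "?H r" for r using that c un by metis
  then obtain h where h: "\<And>r. E r h \<longleftrightarrow> ?H r" using sep[OF D, of c] by metis
  obtain d where d: "\<And>x. E x d \<longleftrightarrow> sub x (un h)" using power by metis
  have D: "DD (\<lambda>e. \<exists>q. E q h \<and> sub (e 0) q)" by (intro ddl)
  have "E y d" if "\<exists>q. E q h \<and> sub y q" for y
    using that unfolding d gsub_def un by blast
  then obtain p where p: "\<And>y. E y p \<longleftrightarrow> (\<exists>q. E q h \<and> sub y q)" using sep[OF D, of d] by metis
  have "histo h"
    unfolding ghist_def
  proof (intro conjI allI impI TrueI)
    show "E y q \<longleftrightarrow> (\<exists>r. True \<and> sub y r \<and> E r q \<and> E r h)" if q: "E q h" for q y
    proof -
      have 1: "levl q" using q h by blast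
      have "E r h" if r: "levl r" "E r q" for r
        using q r h levl_transD by metis
      then show ?thesis
        using levl_mem[OF 1, of y] levl_potent[OF 1] by metis
    qed
  qed
  then have "levl p" unfolding glev_def using p by metis
  moreover have "E s p" if "levl s" "E s b" for s
    using p h that gsub_refl by metis
  ultimately show ?thesis by blast
qed

lemma endlessZ: "levl s \<Longrightarrow> \<exists>t. levl t \<and> E s t"
proof -
  obtain c where "\<And>u. E u c \<longleftrightarrow> u = s \<or> u = s" using pair by metis
  then show "levl s \<Longrightarrow> \<exists>t. levl t \<and> E s t" using level_above[of c] by metis
qed

text \<open>Each member of \<open>a\<close> is sent to the least level that includes it, Replacement
  collects these levels, and \<open>level_above\<close> puts them into a single level. Minimality
  under inclusion makes the choice unique.\<close>

lemma good_step:
  assumes "\<And>x. E x a \<Longrightarrow> \<exists>s. levl s \<and> sub x s"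
  shows "\<exists>s. levl s \<and> sub a s"
proof -
  let ?L = "\<lambda>y x. levl y \<and> sub x y \<and> (\<forall>t. levl t \<and> sub x t \<longrightarrow> sub y t)"
  let ?R = "\<lambda>y x. ?L y x \<or> \<not> (\<exists>s. levl s \<and> sub x s) \<and> y = z"
  have D: "DD (\<lambda>e. ?R (e 0) (e (Suc 0)))" by (intro ddl)
  have L: "\<exists>y. ?L y x" if s: "levl s" "sub x s" for x s
  proof -
    have "DD (\<lambda>e. sub x (e 0))" by (intro ddl)
    from levl_least_sub[OF this s] show ?thesis by blast
  qed
  have U: "y = y'" if "?L y x" "?L y' x" for x y y'
  proof -
    have "sub y y'" "sub y' y" using that by blast+
    then show ?thesis unfolding gsub_def by (intro extE) blast
  qed
  have "\<exists>!y. ?R y x" for x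
  proof (cases "\<exists>s. levl s \<and> sub x s")
    case True
    then obtain y where "?L y x" using L by blast
    then show ?thesis using U True by (intro ex1I[of _ y]) blast+
  next
    case False
    then show ?thesis by blast
  qed
  with D obtain b where b: "\<forall>x y. E x a \<longrightarrow> ?R y x \<longrightarrow> E y b"
    using replace[of ?R a] by blast
  obtain p where p: "levl p" "\<forall>s. levl s \<and> E s b \<longrightarrow> E s p" using level_above by blast
  have "E x p" if x: "E x a" for x
  proof -
    obtain y where y: "?L y x" using L assms[OF x] by blast
    then have "E y b" using b x by blast
    then show ?thesis using y p levl_potent[OF p(1)] by blast
  qed
  then show ?thesis using p(1) unfolding gsub_def by blast
qed

text \<open>Induction on membership: within a transitive set, a minimal set included in no level has
  only members that are included in levels, against \<open>good_step\<close>.\<close>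

lemma stratZ: "\<exists>s. levl s \<and> sub a s"
proof (rule ccontr)
  let ?G = "\<lambda>x. \<exists>s. levl s \<and> sub x s"
  assume "\<not> ?G a"
  then obtain x where x: "E x a" "\<not> ?G x" using good_step by blast
  obtain u where u: "sub a u" "\<And>x. E x u \<Longrightarrow> sub x u" using trans_closure by blast
  have "DD (\<lambda>e. \<not> ?G (e 0))" by (intro ddl)
  from sep[of "\<lambda>x. \<not> ?G x", OF this, of u] obtain c where c: "\<And>x. E x c \<longleftrightarrow> E x u \<and> \<not> ?G x" by metis
  have "E x c" using c x gsubD[OF u(1)] by blast
  then obtain y where y: "E y c" "\<And>w. E w y \<Longrightarrow> \<not> E w c" using found by blast
  have "?G w" if "E w y" for w
    using y(2)[OF that] c gsubD[OF u(2) that] y(1) by metis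
  then have "?G y" by (rule good_step)
  then show False using y(1) c by blast
qed

lemma LTplus_structure: "LTplus_structure DD TT E"
  by unfold_locales (use stratZ endlessZ in blast)+

end

context LTplus_structure
begin

text \<open>The least level including an inductive set is no successor \<open>nx r\<close>: the set
  successor of a member \<open>x\<close> would be included in \<open>r\<close>, which puts
  \<open>x\<close> into \<open>r\<close>, so \<open>r\<close> would already include the set.\<close>

lemma limit_of_infinity:
  assumes a: "E w a" "\<And>x. E x a \<Longrightarrow> \<exists>y. E y a \<and> (\<forall>u. E u y \<longleftrightarrow> E u x \<or> u = x)"
  shows "\<exists>s r. glim E (\<lambda>_. True) s \<and> levl r \<and> E r s"
proof -
  have "DD (\<lambda>e. gsub E a (e 0))" by (intro ddl)
  moreover obtain s0 where "levl s0" "gsub E a s0" using strat by blast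
  ultimately obtain s where s: "levl s" "gsub E a s" and min: "\<And>t. levl t \<Longrightarrow> gsub E a t \<Longrightarrow> gsub E s t"
    using levl_least_sub[of "\<lambda>t. gsub E a t" s0] by blast
  have ws: "E w s" using gsubD[OF s(2) a(1)] .
  obtain r where r: "levl r" "E r s" using levl_memD[OF s(1) ws] by blast
  have "glim E (\<lambda>_. True) s"
    unfolding glim_def
  proof (intro conjI allI impI)
    fix r assume r: "levl r \<and> E r s"
    have "nx r \<noteq> s"
    proof
      assume n: "nx r = s"
      have "E x r" if x: "E x a" for x
      proof -
        obtain y where y: "E y a" "\<forall>u. E u y \<longleftrightarrow> E u x \<or> u = x" using a(2)[OF x] by blast
        then have "gsub E y r" using gsubD[OF s(2)] n nx_mem r by metis
        then show ?thesis using y(2) gsubD by metis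
      qed
      then have "gsub E s r" using min r unfolding gsub_def by blast
      then have "E r r" using r gsubD by metis
      then show False using m_irrefl by blast
    qed
    then show "\<exists>t. levl t \<and> E r t \<and> E t s" using nx[of r] r s(1) by blast
  qed (rule s)
  then show ?thesis using r by blast
qed

text \<open>A limit level is itself inductive: the set successor of a member is included in a level
  strictly below.\<close>

lemma infinity_of_limit:
  assumes s: "glim E (\<lambda>_. True) s" and r: "levl r" "E r s"
  shows "E z s" "E x s \<Longrightarrow> \<exists>y. E y s \<and> (\<forall>u. E u y \<longleftrightarrow> E u x \<or> u = x)"
proof -
  have sl: "levl s" using s unfolding glim_def by blast
  have "gsub E z r" using z unfolding gsub_def by blast
  then show "E z s" by (rule levl_potent[OF sl r(2)])
  assume "E x s"
  then obtain q where q: "levl q" "E q s" "gsub E x q" using levl_memD[OF sl] by blast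
  then obtain t where t: "levl t" "E q t" "E t s" using s unfolding glim_def by blast
  obtain y where y: "\<forall>u. E u y \<longleftrightarrow> E u x \<or> u = x" using adj_ex by blast
  have xt: "E x t" by (rule levl_potent[OF t(1,2) q(3)])
  then have "gsub E y t" using y levl_transD[OF t(1) xt] unfolding gsub_def by blast
  then have "E y s" by (rule levl_potent[OF sl t(3)])
  then show "\<exists>y. E y s \<and> (\<forall>u. E u y \<longleftrightarrow> E u x \<or> u = x)" using y by blast
qed

section \<open>The other ZF axioms from levels\<close>

lemma pairing: "\<exists>c. \<forall>x. E x c \<longleftrightarrow> x = a \<or> x = b"
proof -
  obtain r where "E a r" "E b r" using in_levl2 by blast
  moreover have "DD (\<lambda>e. e 0 = a \<or> e 0 = b)" by (intro ddl)
  ultimately show ?thesis using bounded_set[of "\<lambda>x. x = a \<or> x = b" r] by blast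
qed

lemma unions: "\<exists>b. \<forall>x. E x b \<longleftrightarrow> (\<exists>y. E y a \<and> E x y)"
proof -
  obtain r where r: "levl r" "E a r" using in_levl by blast
  have "DD (\<lambda>e. \<exists>y. E y a \<and> E (e 0) y)" by (intro ddl)
  moreover have "E x r" if "\<exists>y. E y a \<and> E x y" for x
    using that levl_transD[OF r(1)] r(2) by blast
  ultimately show ?thesis using bounded_set[of "\<lambda>x. \<exists>y. E y a \<and> E x y" r] by blast
qed

lemma powersets: "\<exists>b. \<forall>x. E x b \<longleftrightarrow> (\<forall>w. E w x \<longrightarrow> E w a)"
proof -
  obtain r where r: "levl r" "E a r" using in_levl by blast
  have "DD (\<lambda>e. gsub E (e 0) a)" by (intro ddl)
  moreover have "E x r" if "gsub E x a" for x
    using that levl_potent[OF r] by blast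
  ultimately show ?thesis using bounded_set[of "\<lambda>x. gsub E x a" r] unfolding gsub_def by blast
qed

lemma foundation: "E x a \<Longrightarrow> \<exists>x. E x a \<and> (\<forall>y. E y x \<longrightarrow> \<not> E y a)"
proof -
  have "DD (\<lambda>e. E (e 0) a)" by (intro ddl)
  then show "E x a \<Longrightarrow> \<exists>x. E x a \<and> (\<forall>y. E y x \<longrightarrow> \<not> E y a)" using m_min[of "\<lambda>x. E x a" x] by blast
qed

end

text \<open>In \<open>nappr\<close> and \<open>nrec\<close>, variables 0, 1, 2 are the value,
  \<open>a\<close> and \<open>n\<close>; these are the places that \<open>mg\<close> gives to
  variable 0, parameter 0 and variable 1.\<close>

definition nappr :: nfm where
  "nappr = NAnd (NAll 3 (NImp (NAll 4 (NNot (mem 4 3))) (NEq (NAp 0 (NV 3)) (NV 1))))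
      (NAll 3 (NAll 4 (NImp (NAnd (mem 3 2) (NAll 5 (NIff (mem 5 4) (NOr (mem 5 3) (eqv 5 3)))))
        (NAll 5 (NIff (NMem (NV 5) (NAp 0 (NV 4))) (NEx 6 (NAnd (NMem (NV 6) (NAp 0 (NV 3))) (mem 5 6))))))))"

definition nrec :: nfm where
  "nrec = NNot (NAllF 0 (NNot (NAnd nappr (NEq (NV 0) (NAp 0 (NV 2))))))"

lemma nsat_nappr: "nsat (=) E PP FF e p f nappr \<longleftrightarrow> appr E (e 1) (e 2) (f 0)"
  by (simp add: nappr_def appr_def)

lemma nsat_nrec: "nsat (=) E PP FF e p f nrec \<longleftrightarrow> (\<exists>F\<in>FF. appr E (e 1) (e 2) F \<and> e 0 = F (e 2))"
  by (simp add: nrec_def nsat_nappr)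

lemma (in henkin_frame) defb_rec: "defb E PP FF (\<lambda>e. \<exists>F\<in>FF. appr E a (e (Suc 0)) F \<and> e 0 = F (e (Suc 0)))"
proof -
  obtain p :: "nat \<Rightarrow> 'a \<Rightarrow> bool" where p: "range p \<subseteq> PP" using ex_env[OF ne(1)] by blast
  obtain f :: "nat \<Rightarrow> 'a \<Rightarrow> 'a" where f: "range f \<subseteq> FF" using ex_env[OF ne(2)] by blast
  show ?thesis
    by (rule defbI[OF p f, of E "\<lambda>_. a" "sent nrec"]) (simp add: sat_sent nsat_nrec mg_def)
qed

theorem ZF_BLT_ZF: "defeq ZF BLT_ZF"
proof (rule defeq_semantic[of _ _ fmI ord_mem fmJ bool_mem])
  fix E :: "nat \<Rightarrow> nat \<Rightarrow> bool" and PP FF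
  {
    assume "hmodel ZF (=) E PP FF"
    then interpret normal_henkin_model ZF E PP FF by unfold_locales
    note ax = axiom[of Extensionality] axiom[of Separation] axiom[of Pairing] axiom[of Union] axiom[of Powerset]
      axiom[of Infinity] axiom[of Foundation] axiom[of Replacement]
    have repl: "\<exists>b. \<forall>x. E x a \<longrightarrow> E (F x) b" if "F \<in> FF" for F a
      using ax(8) that by (simp add: nsat_axioms ZF_def)
    have inf: "\<exists>a. (\<exists>z. E z a \<and> (\<forall>u. \<not> E u z)) \<and> (\<forall>x. E x a \<longrightarrow> (\<exists>y. E y a \<and> (\<forall>u. E u y \<longleftrightarrow> E u x \<or> u = x)))"
      using ax(6) by (simp add: nsat_axioms ZF_def)
    interpret L: level_theory "defb E PP FF" "deft FF" E "\<lambda>_. True"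
      by (rule lev_L) (use ax in \<open>simp_all add: nsat_axioms ZF_def\<close>)
    interpret Z: ZF_structure "defb E PP FF" "deft FF" E FF
    proof
      show "\<exists>c. \<forall>x. E x c \<longleftrightarrow> x = a \<or> x = b" for a b using ax(3) by (simp add: nsat_axioms ZF_def)
      show "\<exists>b. \<forall>x. E x b \<longleftrightarrow> (\<exists>y. E y a \<and> E x y)" for a using ax(4) by (simp add: nsat_axioms ZF_def)
      show "\<exists>b. \<forall>x. E x b \<longleftrightarrow> gsub E x a" for a using ax(5) by (simp add: nsat_axioms ZF_def gsub_def)
      show "\<exists>x. E x a \<and> (\<forall>y. E y x \<longrightarrow> \<not> E y a)" if "E x a" for x a
        using ax(7) that by (auto simp: nsat_axioms ZF_def)
    qed (fact inf repl defb_FF deft_fun defb_rec)+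
    have l: "LTplus_structure (defb E PP FF) (deft FF) E" by (rule Z.LTplus_structure)
    then show "ord_mem (bool_mem E) = E" by (rule LTplus_structure.ord_mem_bool_mem)
    interpret T: LTplus_structure "defb E PP FF" "deft FF" E by (rule l)
    have low: "bmem T.EB x s \<longleftrightarrow> T.EB x s" if "blevS T.EB s" for x s
      using T.B.bmem_of_low[OF T.B.blevS_low[OF that]] .
    have I: "nsat (=) (bool_mem E) PP FF e p f InfinityN" for e p f
    proof -
      obtain a w where a: "E w a" "\<And>x. E x a \<Longrightarrow> \<exists>y. E y a \<and> (\<forall>u. E u y \<longleftrightarrow> E u x \<or> u = x)"
        using inf by blast
      obtain s r where "glim E (\<lambda>_. True) s" "L.levl r" "E r s" using T.limit_of_infinity[OF a] by blast
      then obtain s r where s: "glim (bmem T.EB) (low T.EB) s" "glev (bmem T.EB) (low T.EB) r" "bmem T.EB r s"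
        using T.two.limit2 by blast
      then show ?thesis
        unfolding nsat_axioms glim_def T.B.blevS_glev[symmetric] using low by metis
    qed
    have U: "nsat (=) (bool_mem E) PP FF e p f UnboundedN" for e p f
      unfolding nsat_axioms
    proof (intro ballI allI impI)
      fix F a assume F: "F \<in> FF" and a: "\<not> T.EB a a"
      \<comment> \<open>An ordinary set with the boolean members of \<open>a\<close>, so that
        Replacement applies; \<open>same_LB\<close> leads back. \<open>F\<close> is the same
        function in both structures.\<close>
      obtain a' where a': "\<And>x. E x a' \<longleftrightarrow> E (T.\<sigma> x) a" using T.unsigma_set by metis
      obtain b where b: "\<And>x. E x a' \<Longrightarrow> E (F x) b" using repl[OF F] by metis
      obtain b' where b': "\<And>x. bmem T.EB x b' \<longleftrightarrow> E x b" using T.same_LB by metis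
      obtain s where s: "blevS T.EB s" "gsub (bmem T.EB) b' s" using T.BF.strat T.B.blevS_glev by metis
      have "T.EB (F x) s" if "T.EB x a" for x
      proof -
        have "E x a'" using that a a' T.B.bmem_of_low[OF a] T.J.bmem_iff by metis
        then show ?thesis using b b' gsubD[OF s(2)] low[OF s(1)] by metis
      qed
      then show "\<exists>s. blevS T.EB s \<and> (\<forall>x. T.EB x a \<longrightarrow> T.EB (F x) s)" using s(1) by blast
    qed
    show "sat (=) (bool_mem E) PP FF e p f \<alpha>" if "\<alpha> \<in> BLT_ZF" for e p f \<alpha>
      using that LTplus_structure_models[OF l] I U by (auto simp: BLT_ZF_def BLT_def sat_sent)
  }
  {
    assume henkin_frame: "hmodel BLT_ZF (=) E PP FF"
    then interpret normal_henkin_model BLT_ZF E PP FF by unfold_locales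
    note ax = axiom[of Extensionality] axiom[of Complements] axiom[of SeparationN] axiom[of StratificationN]
      axiom[of InfinityN] axiom[of UnboundedN]
    have l: "BLTplus_structure (defb E PP FF) (deft FF) E"
      by (rule BLTplus_structureI[OF _ _ _ _ BLT_ZF_endless[OF henkin_frame]]) (use ax in \<open>simp_all add: nsat_axioms BLT_ZF_def BLT_def\<close>)
    then show "bool_mem (ord_mem E) = E" by (rule BLTplus_structure.bool_mem_ord_mem)
    interpret T: BLTplus_structure "defb E PP FF" "deft FF" E by (rule l)
    interpret L: LTplus_structure "defb E PP FF" "deft FF" T.EL by unfold_locales
    have low: "bmem E x s \<longleftrightarrow> E x s" if "blevS E s" for x s
      using T.bmem_of_low[OF T.blevS_low[OF that]] .
    have unb: "\<exists>s. blevS E s \<and> (\<forall>x. E x a \<longrightarrow> E (F x) s)" if "F \<in> FF" "\<not> E a a" for F a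
      using ax(6) that by (simp add: nsat_axioms BLT_ZF_def)
    have I: "nsat (=) (ord_mem E) PP FF e p f Infinity" for e p f
    proof -
      obtain s r where "blevS E s" "blevS E r" "E r s"
        "\<forall>q. blevS E q \<and> E q s \<longrightarrow> (\<exists>r. blevS E r \<and> E q r \<and> E r s)"
        using ax(5) by (auto simp: nsat_axioms BLT_ZF_def)
      then have "glim (bmem E) (low E) s" "glev (bmem E) (low E) r" "bmem E r s"
        unfolding glim_def T.blevS_glev[symmetric] using low by metis+
      then obtain s r where s: "glim T.EL (\<lambda>_. True) s" "glev T.EL (\<lambda>_. True) r" "T.EL r s"
        using T.two.limit2 by blast
      show ?thesis
        unfolding nsat_axioms using L.infinity_of_limit[OF s] L.z by blast
    qed
    have R: "nsat (=) (ord_mem E) PP FF e p f Replacement" for e p f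
      unfolding nsat_axioms
    proof (intro ballI allI)
      fix F a assume F: "F \<in> FF"
      \<comment> \<open>A low boolean set with the ordinary members of \<open>a\<close>, so that
        Unboundedness applies; \<open>same_BL\<close> turns the resulting level into an ordinary
        set.\<close>
      obtain a' where a': "low E a'" "\<And>x. bmem E x a' \<longleftrightarrow> T.EL x a" using T.sigma_set by metis
      have al: "\<not> E a' a'" using a'(1) unfolding low_def .
      obtain s where s: "blevS E s" "\<And>x. E x a' \<Longrightarrow> E (F x) s" using unb[OF F al] by metis
      obtain b where "\<And>x. T.EL x b \<longleftrightarrow> bmem E x s" using T.same_BL by metis
      then show "\<exists>b. \<forall>x. T.EL x a \<longrightarrow> T.EL (F x) b"
        using s a'(2) low[OF s(1)] T.bmem_of_low[OF al] by metis
    qed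
    have O: "nsat (=) (ord_mem E) PP FF e p f \<alpha>" if "\<alpha> \<in> {Pairing, Union, Powerset, Foundation}" for e p f \<alpha>
      using that L.pairing L.unions L.powersets L.foundation by (auto simp: nsat_axioms)
    show "sat (=) (ord_mem E) PP FF e p f \<alpha>" if "\<alpha> \<in> ZF" for e p f \<alpha>
      using that BLTplus_structure_models[OF l] I R O by (auto simp: ZF_def sat_sent)
  }
qed (fact theory_closed ZF_inf BLT_ZF_inf interp_coding sat_fmI sat_fmJ)+

theorem theorem16:
  shows "defeq ZF BLT_ZF \<and> defeq LTplus BLTplus"
  using ZF_BLT_ZF LTplus_BLTplus by blast

end
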